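(* Let $L, M\in K[\partial_t,\partial_{x_1},\dots,\partial_{x_n}]$. 1. A Darboux transformation $(M,N)\colon L \rightarrow L_1$ where $M$, $N$ are first order exists (for some $N,L_1$) if and only if $M$ is first order and $L = CM + cB$ for some operators $C$ and $B$ and some $c \in K$, where $[M,B] = 0$. 2. If $L$, $M$ (first order), $C$, $B$ and $c$ are as in part 1, we have the following for the corresponding Darboux transformation $(M,N)\colon L\to L_1$: - If $cB=0$, then $(M,N)$ is a Darboux transformation obtained from a factorization, and is also of Wronskian type. - If $cB \in K$ and $cB \neq 0$, then $(M,N)$ is a transformation of Type I. - If $cB \notin K$ (i.e. $cB$ is an operator of order larger than zero), then $(M,N)$ is a transformation of Wronskian type. The corresponding operators $N$ and $L_1$ for the Darboux transformation are $$N = c M c^{-1} , \qquad L_1=NC+cB , \qquad \text{if } cB \neq 0,$$ and in the case $cB=0$, $N$ is any operator with $\sigma(N) = \sigma(M)$, and $L_1=NC$.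
   Context: $K$ is a differential field of characteristic zero with commuting derivations $\partial_t,\partial_{x_1},\dots,\partial_{x_n}$, and $K[\partial_t,\partial_{x_1},\dots,\partial_{x_n}]$ is the ring of linear partial differential operators over $K$; all operators lie in this ring. Standing convention: either $K$ is differentially closed, or $K$ is assumed to contain the solutions of the partial differential equations encountered. Elements of $K$ are called functions. $\ker L$ is the set of $\phi\in K$ with $L[\phi]=0$. $\sigma(L)$ denotes the principal symbol of $L$, and $[M,B]=MB-BM$. A Darboux transformation $(M,N)\colon L\to L_1$, where $\sigma(L)=\sigma(L_1)$, is a pair of operators $(M,N)$ satisfying $NL=L_1M$. A Darboux transformation obtained from a factorization is one of the form $(M,N)\colon CM\to NC$, where $L=CM$ and $N$ is any operator with $\sigma(N)=\sigma(M)$. A Darboux transformation $(M,N)\colon L\to L_1$ is of Type I if there are an operator $C$ and a nonzero function $f\in K$ with $L=CM+f$, $N=M^{1/f}:=fM(1/f)$, and $L_1=M^{1/f}C+f$. A Darboux transformation $(M,N)\colon L\to L_1$ is of Wronskian type if, after a change of variables, $M$ can be put in the form $M(f)=\dfrac{W(f_1,\dots,f_m,f)}{W(f_1,\dots,f_m)}$, where $W$ denotes the Wronskian determinant with respect to one of the variables, and $f_1,\dots,f_m\in K$ ($m\ge1$) are linearly independent elements of $\ker L$.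
   Formalization: The third bullet (and uniqueness of N when cB ≠ 0) is stated only if cB is not of the form QM+f with f in K; otherwise it can fail, e.g. M=∂_t, C=0, c=1, L=B=∂_t+1. When cB=QM the claim follows from the first bullet applied to L=(C+Q)M. *)

theory Defs
  imports "HOL-Library.Poly_Mapping" "Jordan_Normal_Form.Determinant"
begin

text \<open>The finite type \<^typ>\<open>'i\<close> indexes the variables \<open>t, x\<^sub>1, \<dots>, x\<^sub>n\<close>; the differential field is
  the type \<^typ>\<open>'k\<close> together with the family \<open>d\<close> of its derivations.\<close>

locale differential_field =
  fixes d :: "'i::finite \<Rightarrow> 'k::field_char_0 \<Rightarrow> 'k"
  assumes d_add: "d i (a + b) = d i a + d i b"
    and d_mult: "d i (a * b) = d i a * b + a * d i b"
    and d_commute: "d i (d j a) = d j (d i a)"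

text \<open>The iterated derivation \<open>\<partial>\<^sup>\<alpha>\<close>; as the derivations commute, the order in which
  \<^const>\<open>Finite_Set.fold\<close> runs through the indices is irrelevant.\<close>

definition dpow :: "('i::finite \<Rightarrow> 'k \<Rightarrow> 'k) \<Rightarrow> ('i \<Rightarrow> nat) \<Rightarrow> 'k \<Rightarrow> 'k" where
  "dpow d \<alpha> u = Finite_Set.fold (\<lambda>i. d i ^^ \<alpha> i) u UNIV"


section \<open>Linear partial differential operators\<close>

text \<open>\<open>L :: ('i, 'k) dop\<close> stands for \<open>\<Sum>\<^sub>\<alpha> lookup L \<alpha> \<partial>\<^sup>\<alpha>\<close>, with the coefficients on the left.
  Operators are formal, i.e. determined by their coefficients, as elements of
  \<open>K[\<partial>\<^sub>t, \<partial>\<^sub>x\<^sub>1, \<dots>]\<close>.\<close>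

type_synonym ('i, 'k) dop = "('i \<Rightarrow> nat) \<Rightarrow>\<^sub>0 'k"

definition fn_op :: "'k::zero \<Rightarrow> ('i, 'k) dop" where
  "fn_op f = Poly_Mapping.single (\<lambda>_. 0) f"

definition is_fn :: "('i, 'k::zero) dop \<Rightarrow> bool" where
  "is_fn R \<longleftrightarrow> (\<exists>f. R = fn_op f)"

definition dapply :: "('i::finite \<Rightarrow> 'k::field_char_0 \<Rightarrow> 'k) \<Rightarrow> ('i, 'k) dop \<Rightarrow> 'k \<Rightarrow> 'k" where
  "dapply d L u = (\<Sum>\<alpha>\<in>Poly_Mapping.keys L. Poly_Mapping.lookup L \<alpha> * dpow d \<alpha> u)"

text \<open>Multiplication in the operator ring, obtained from the Leibniz rule
  \<open>a \<partial>\<^sup>\<alpha> \<cdot> b \<partial>\<^sup>\<beta> = \<Sum>\<^bsub>\<gamma> \<le> \<alpha>\<^esub> (\<alpha> choose \<gamma>) a (\<partial>\<^sup>\<gamma> b) \<partial>\<^sup>\<alpha>\<^sup>-\<^sup>\<gamma>\<^sup>+\<^sup>\<beta>\<close>.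
  It depends on the derivations, hence is not an instance of \<^class>\<open>times\<close>.\<close>

definition dmult :: "('i, 'k) dop \<Rightarrow> ('i::finite \<Rightarrow> 'k::field_char_0 \<Rightarrow> 'k) \<Rightarrow> ('i, 'k) dop \<Rightarrow> ('i, 'k) dop"
    ("(_ \<star>\<^bsub>_\<^esub> _)" [70, 0, 71] 70) where
  "A \<star>\<^bsub>d\<^esub> B = (\<Sum>\<alpha>\<in>Poly_Mapping.keys A. \<Sum>\<beta>\<in>Poly_Mapping.keys B. \<Sum>\<gamma> | \<forall>i. \<gamma> i \<le> \<alpha> i.
     Poly_Mapping.single (\<lambda>i. \<alpha> i - \<gamma> i + \<beta> i)
       (of_nat (\<Prod>i\<in>UNIV. \<alpha> i choose \<gamma> i) * Poly_Mapping.lookup A \<alpha> * dpow d \<gamma> (Poly_Mapping.lookup B \<beta>)))"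

definition ord :: "('i::finite, 'k::zero) dop \<Rightarrow> nat" where
  "ord L = (if L = 0 then 0 else Max ((\<lambda>\<alpha>. \<Sum>i\<in>UNIV. \<alpha> i) ` Poly_Mapping.keys L))"

text \<open>The principal symbol, a homogeneous polynomial in commuting variables given by its
  coefficient function.\<close>

definition psymbol :: "('i::finite, 'k::zero) dop \<Rightarrow> ('i \<Rightarrow> nat) \<Rightarrow> 'k" where
  "psymbol L = (\<lambda>\<alpha>. if (\<Sum>i\<in>UNIV. \<alpha> i) = ord L then Poly_Mapping.lookup L \<alpha> else 0)"


section \<open>The standing convention on the differential field\<close>

text \<open>Differential polynomials over \<open>K\<close> in indeterminates \<open>y\<^sub>0, y\<^sub>1, \<dots>\<close>: ordinary polynomials in the
  algebraically independent variables \<open>(j, \<alpha>)\<close>, which stand for \<open>\<partial>\<^sup>\<alpha> y\<^sub>j\<close>.\<close>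

type_synonym ('i, 'k) dpoly = "((nat \<times> ('i \<Rightarrow> nat)) \<Rightarrow>\<^sub>0 nat) \<Rightarrow>\<^sub>0 'k"

definition dpoly_eval :: "('i::finite \<Rightarrow> 'k::field_char_0 \<Rightarrow> 'k) \<Rightarrow> (nat \<Rightarrow> 'k) \<Rightarrow> ('i, 'k) dpoly \<Rightarrow> 'k" where
  "dpoly_eval d u f = (\<Sum>m\<in>Poly_Mapping.keys f. Poly_Mapping.lookup f m *
     (\<Prod>v\<in>Poly_Mapping.keys m. dpow d (snd v) (u (fst v)) ^ Poly_Mapping.lookup m v))"

text \<open>The derivation that extends \<open>d i\<close> and sends \<open>\<partial>\<^sup>\<alpha> y\<^sub>j\<close> to \<open>\<partial>\<^sub>i \<partial>\<^sup>\<alpha> y\<^sub>j\<close>.\<close>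

definition dpoly_deriv :: "('i::finite \<Rightarrow> 'k::field_char_0 \<Rightarrow> 'k) \<Rightarrow> 'i \<Rightarrow> ('i, 'k) dpoly \<Rightarrow> ('i, 'k) dpoly" where
  "dpoly_deriv d i f = (\<Sum>m\<in>Poly_Mapping.keys f. Poly_Mapping.single m (d i (Poly_Mapping.lookup f m)) +
     (\<Sum>v\<in>Poly_Mapping.keys m. Poly_Mapping.single
        (m - Poly_Mapping.single v 1 + Poly_Mapping.single (fst v, (snd v)(i := snd v i + 1)) 1)
        (of_nat (Poly_Mapping.lookup m v) * Poly_Mapping.lookup f m)))"

definition prime_differential_ideal ::
    "('i::finite \<Rightarrow> 'k::field_char_0 \<Rightarrow> 'k) \<Rightarrow> ('i, 'k) dpoly set \<Rightarrow> bool" where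
  "prime_differential_ideal d P \<longleftrightarrow>
     0 \<in> P \<and> (\<forall>f\<in>P. \<forall>g\<in>P. f + g \<in> P) \<and> (\<forall>f\<in>P. \<forall>g. g * f \<in> P) \<and>
     1 \<notin> P \<and> (\<forall>f g. f * g \<in> P \<longrightarrow> f \<in> P \<or> g \<in> P) \<and>
     (\<forall>f\<in>P. \<forall>i. dpoly_deriv d i f \<in> P)"

text \<open>Every finite system \<open>f = 0\<close> (\<open>f \<in> F\<close>), \<open>g \<noteq> 0\<close> that has a solution in some differential field
  extension of \<open>K\<close> has one in \<open>K\<close>. Solutions in extensions are recorded by their vanishing ideals
  \<open>P\<close>: these are exactly the prime differential ideals, \<open>P\<close> being the vanishing ideal of the
  tuple of residue classes of the \<open>y\<^sub>j\<close> in the fraction field of the residue ring of \<open>P\<close>.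
  An inequation with several factors is covered by their product.\<close>

definition differentially_closed :: "('i::finite \<Rightarrow> 'k::field_char_0 \<Rightarrow> 'k) \<Rightarrow> bool" where
  "differentially_closed d \<longleftrightarrow>
     (\<forall>F g. finite F \<longrightarrow> (\<exists>P. prime_differential_ideal d P \<and> F \<subseteq> P \<and> g \<notin> P) \<longrightarrow>
        (\<exists>u. (\<forall>f\<in>F. dpoly_eval d u f = 0) \<and> dpoly_eval d u g \<noteq> 0))"

text \<open>The weaker alternative: \<open>K\<close> contains the solutions of linear systems. A finite system
  \<open>P[u] = 0\<close> (\<open>P \<in> S\<close>) has a solution with \<open>Q[u] \<noteq> 0\<close>, unless \<open>Q[u] = 0\<close> is a formal consequence of
  the system, i.e. \<open>Q\<close> is in the left ideal generated by \<open>S\<close>.\<close>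

definition contains_linear_solutions :: "('i::finite \<Rightarrow> 'k::field_char_0 \<Rightarrow> 'k) \<Rightarrow> bool" where
  "contains_linear_solutions d \<longleftrightarrow>
     (\<forall>S Q. finite S \<longrightarrow> (\<nexists>A. Q = (\<Sum>P\<in>S. A P \<star>\<^bsub>d\<^esub> P)) \<longrightarrow>
        (\<exists>u. (\<forall>P\<in>S. dapply d P u = 0) \<and> dapply d Q u \<noteq> 0))"


section \<open>Darboux transformations\<close>

definition darboux ::
    "('i::finite \<Rightarrow> 'k::field_char_0 \<Rightarrow> 'k) \<Rightarrow> ('i, 'k) dop \<Rightarrow> ('i, 'k) dop \<Rightarrow> ('i, 'k) dop \<Rightarrow> ('i, 'k) dop \<Rightarrow> bool"
  where "darboux d M N L L1 \<longleftrightarrow> psymbol L = psymbol L1 \<and> N \<star>\<^bsub>d\<^esub> L = L1 \<star>\<^bsub>d\<^esub> M"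

definition from_factorization ::
    "('i::finite \<Rightarrow> 'k::field_char_0 \<Rightarrow> 'k) \<Rightarrow> ('i, 'k) dop \<Rightarrow> ('i, 'k) dop \<Rightarrow> ('i, 'k) dop \<Rightarrow> ('i, 'k) dop \<Rightarrow> bool"
  where "from_factorization d M N L L1 \<longleftrightarrow> darboux d M N L L1 \<and>
     (\<exists>C. L = C \<star>\<^bsub>d\<^esub> M \<and> L1 = N \<star>\<^bsub>d\<^esub> C \<and> psymbol N = psymbol M)"

definition type_I ::
    "('i::finite \<Rightarrow> 'k::field_char_0 \<Rightarrow> 'k) \<Rightarrow> ('i, 'k) dop \<Rightarrow> ('i, 'k) dop \<Rightarrow> ('i, 'k) dop \<Rightarrow> ('i, 'k) dop \<Rightarrow> bool"
  where "type_I d M N L L1 \<longleftrightarrow> darboux d M N L L1 \<and>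
     (\<exists>C f. f \<noteq> 0 \<and> L = C \<star>\<^bsub>d\<^esub> M + fn_op f \<and>
        N = fn_op f \<star>\<^bsub>d\<^esub> M \<star>\<^bsub>d\<^esub> fn_op (1 / f) \<and> L1 = N \<star>\<^bsub>d\<^esub> C + fn_op f)"

text \<open>New variables \<open>y\<^sub>k \<in> K\<close>, where \<open>A\<close> is the inverse \<open>A j i = \<partial>x\<^sub>i/\<partial>y\<^sub>j\<close> of the Jacobian matrix
  \<open>\<partial>y\<^sub>k/\<partial>x\<^sub>i\<close>.\<close>

definition change_of_variables ::
    "('i::finite \<Rightarrow> 'k::field_char_0 \<Rightarrow> 'k) \<Rightarrow> ('i \<Rightarrow> 'k) \<Rightarrow> ('i \<Rightarrow> 'i \<Rightarrow> 'k) \<Rightarrow> bool" where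
  "change_of_variables d y A \<longleftrightarrow>
     (\<forall>j k. (\<Sum>i\<in>UNIV. A j i * d i (y k)) = (if j = k then 1 else 0))"

text \<open>The derivation \<open>\<partial>/\<partial>y\<^sub>j\<close>, by the chain rule.\<close>

definition new_deriv ::
    "('i::finite \<Rightarrow> 'k::field_char_0 \<Rightarrow> 'k) \<Rightarrow> ('i \<Rightarrow> 'i \<Rightarrow> 'k) \<Rightarrow> 'i \<Rightarrow> 'k \<Rightarrow> 'k" where
  "new_deriv d A j u = (\<Sum>i\<in>UNIV. A j i * d i u)"

definition wronskian :: "('k::field_char_0 \<Rightarrow> 'k) \<Rightarrow> 'k list \<Rightarrow> 'k" where
  "wronskian D fs = det (mat (length fs) (length fs) (\<lambda>(r, s). (D ^^ r) (fs ! s)))"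

definition indep_over_constants :: "('i \<Rightarrow> 'k::field_char_0 \<Rightarrow> 'k) \<Rightarrow> 'k list \<Rightarrow> bool" where
  "indep_over_constants d fs \<longleftrightarrow>
     (\<forall>c. (\<forall>s<length fs. \<forall>i. d i (c s) = 0) \<longrightarrow> (\<Sum>s<length fs. c s * fs ! s) = 0 \<longrightarrow>
        (\<forall>s<length fs. c s = 0))"

text \<open>The condition \<open>wronskian \<dots> fs \<noteq> 0\<close> is implicit in the quotient of Wronskians; independence over
  the constants of all the derivations does not imply it.\<close>

definition wronskian_type ::
    "('i::finite \<Rightarrow> 'k::field_char_0 \<Rightarrow> 'k) \<Rightarrow> ('i, 'k) dop \<Rightarrow> ('i, 'k) dop \<Rightarrow> ('i, 'k) dop \<Rightarrow> ('i, 'k) dop \<Rightarrow> bool"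
  where "wronskian_type d M N L L1 \<longleftrightarrow> darboux d M N L L1 \<and>
     (\<exists>y A j fs. change_of_variables d y A \<and> fs \<noteq> [] \<and>
        (\<forall>f\<in>set fs. dapply d L f = 0) \<and> indep_over_constants d fs \<and>
        wronskian (new_deriv d A j) fs \<noteq> 0 \<and>
        (\<forall>f. dapply d M f = wronskian (new_deriv d A j) (fs @ [f]) / wronskian (new_deriv d A j) fs))"


section \<open>Decompositions of an operator\<close>

definition decomposition ::
    "('i::finite \<Rightarrow> 'k::field_char_0 \<Rightarrow> 'k) \<Rightarrow> ('i, 'k) dop \<Rightarrow> ('i, 'k) dop \<Rightarrow> ('i, 'k) dop \<Rightarrow> ('i, 'k) dop \<Rightarrow> 'k \<Rightarrow> bool"
  where "decomposition d L M C B c \<longleftrightarrow>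
     L = C \<star>\<^bsub>d\<^esub> M + fn_op c \<star>\<^bsub>d\<^esub> B \<and> M \<star>\<^bsub>d\<^esub> B - B \<star>\<^bsub>d\<^esub> M = 0"

text \<open>The remainder \<open>cB\<close> modulo \<open>M\<close> is not unique: \<open>B\<close> may contain left multiples of \<open>M\<close>. For instance
  \<open>L = \<partial>\<^sub>t + 1\<close>, \<open>M = \<partial>\<^sub>t\<close> admits \<open>C = 0\<close>, \<open>cB = \<partial>\<^sub>t + 1\<close> as well as \<open>C = 1\<close>, \<open>cB = 1\<close>; the
  transformation is of Type I and not of Wronskian type, since \<open>ker L \<inter> ker M = 0\<close>.
  A remainder is reduced if it is a function whenever it is congruent to one modulo left
  multiples of \<open>M\<close>. An operator free of the derivative along \<open>M\<close>, as is obtained by division after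
  straightening \<open>M\<close>, is reduced.\<close>

definition reduced :: "('i::finite \<Rightarrow> 'k::field_char_0 \<Rightarrow> 'k) \<Rightarrow> ('i, 'k) dop \<Rightarrow> ('i, 'k) dop \<Rightarrow> bool" where
  "reduced d M R \<longleftrightarrow> (\<forall>Q f. R = Q \<star>\<^bsub>d\<^esub> M + fn_op f \<longrightarrow> is_fn R)"

end

theory Submission
  imports Defs "HOL-Library.Function_Algebras"
begin

text \<open>A first-order operator \<open>M\<close> becomes a pure derivation after a change of variables and a gauge
transformation, and all claims can then be read off from division with remainder by that derivation.

In detail, write \<open>M = X + m\<close> with a nonzero vector field \<open>X\<close> and \<open>m \<in> K\<close>. The standing convention
provides coordinates \<open>y\<close> in which \<open>X = \<partial>/\<partial>y\<^sub>j\<close> (lemma \<open>straightening\<close>) and an \<open>f \<noteq> 0\<close> in the kernel of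
\<open>M\<close>, so that \<open>M = f \<partial>\<^sub>j f\<^sup>-\<^sup>1\<close> with \<open>\<partial>\<^sub>j = \<partial>/\<partial>y\<^sub>j\<close>
(\<open>first_order_kernel\<close>, \<open>gauge\<close>).

Existence of a decomposition (\<open>darboux_decomposition\<close>): if \<open>N L = L\<^sub>1 M\<close> with \<open>L\<close> and \<open>L\<^sub>1\<close> of equal
symbol and \<open>L \<noteq> 0\<close>, then comparing symbols gives \<open>\<sigma>(N) = \<sigma>(M)\<close>, hence \<open>N = M + h = c \<partial>\<^sub>j c\<^sup>-\<^sup>1\<close> for a \<open>c\<close> in the kernel
of \<open>N\<close>. Dividing \<open>L f\<close> by \<open>\<partial>\<^sub>j\<close> leaves a remainder \<open>c R\<close> in which \<open>\<partial>\<^sub>j\<close> does not occur, and the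
intertwining relation says that \<open>\<partial>\<^sub>j R\<close> is a left multiple of \<open>\<partial>\<^sub>j\<close>. The commutator
\<open>[\<partial>\<^sub>j, R]\<close> is then both free of \<open>\<partial>\<^sub>j\<close> and a left multiple of it, so it vanishes
(\<open>commuting_remainder\<close>); undoing the gauge transformation yields \<open>L = C M + c B\<close>.

The converse and the uniqueness of \<open>N\<close> and \<open>L\<^sub>1\<close> are computations in the operator ring, based on
the fact that symbols multiply and form a domain (\<open>conjugate_darboux\<close>, \<open>darboux_unique\<close>).

The transformation is of Wronskian type as soon as \<open>M\<close> and \<open>L\<close> have a common nonzero solution \<open>g\<close>: then
\<open>M u = W(g, u)/W(g)\<close> in the straightened variables (\<open>wronskian_type_if_common_kernel\<close>). If \<open>c B\<close> is
not a function and is reduced, such a \<open>g\<close> exists unless \<open>1\<close> lies in the left ideal generated by \<open>M\<close>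
and \<open>c B\<close>. Modulo left multiples of \<open>M\<close> that would make \<open>B\<close> a left-invertible operator, i.e. a function,
against reducedness (\<open>commuting_unit_remainder\<close>, \<open>reduced_common_kernel\<close>).

Two tools carry these arguments. Under the standing convention operators act faithfully on \<open>K\<close>, so
identities between operators are checked on functions (\<open>op_eqI\<close>), and operators are transported to new
variables as maps \<open>K \<rightarrow> K\<close>. Moreover a differentially closed field contains the solutions of linear
systems (\<open>contains_linear_solutions_if_differentially_closed\<close>), which leaves one hypothesis to work with.\<close>

text \<open>Exponents are functions; unfolding their sums would hide the terms \<open>\<alpha> + \<beta>\<close>
that the rules for iterated derivations are about.\<close>

declare plus_fun_apply [simp del] zero_fun_apply [simp del] minus_apply [simp del]

lemmas pointwise = plus_fun_apply zero_fun_apply minus_apply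

section \<open>Evaluating finitely supported functions\<close>

lemma sum_single_lookup: "(\<Sum>m\<in>Poly_Mapping.keys p. Poly_Mapping.single m (Poly_Mapping.lookup p m)) = p"
  by (rule poly_mapping_eqI) (simp add: lookup_sum lookup_single when_def in_keys_iff)

lemma keys_nonempty: "p \<noteq> 0 \<Longrightarrow> Poly_Mapping.keys p \<noteq> {}"
  by (auto simp: poly_mapping_eq_iff fun_eq_iff in_keys_iff set_eq_iff)

text \<open>Operators acting on a function, differential polynomials evaluated at a point, restrictions to a line
and the Kronecker substitution are all sums \<open>\<Sum> h(p\<^sub>m) \<chi>(m)\<close>, with \<open>\<chi>\<close> multiplicative in the last three cases.\<close>

definition pm_eval :: "('k::zero \<Rightarrow> 'r::comm_ring_1) \<Rightarrow> ('m \<Rightarrow> 'r) \<Rightarrow> ('m \<Rightarrow>\<^sub>0 'k) \<Rightarrow> 'r" where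
  "pm_eval h \<chi> p = (\<Sum>m\<in>Poly_Mapping.keys p. h (Poly_Mapping.lookup p m) * \<chi> m)"

locale additive_map =
  fixes h :: "'k::comm_ring_1 \<Rightarrow> 'r::comm_ring_1"
  assumes h_add: "h (a + b) = h a + h b"
begin

lemma h_zero: "h 0 = 0"
  using h_add[of 0 0] by simp

lemma pm_eval_superset:
  assumes "finite S" "Poly_Mapping.keys p \<subseteq> S"
  shows "pm_eval h \<chi> p = (\<Sum>m\<in>S. h (Poly_Mapping.lookup p m) * \<chi> m)"
  unfolding pm_eval_def
  by (rule sum.mono_neutral_left) (use assms in \<open>auto simp: in_keys_iff h_zero\<close>)

lemma pm_eval_zero [simp]: "pm_eval h \<chi> 0 = 0"
  by (simp add: pm_eval_def)

lemma pm_eval_single: "pm_eval h \<chi> (Poly_Mapping.single m c) = h c * \<chi> m"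
  by (simp add: pm_eval_def h_zero)

lemma pm_eval_add: "pm_eval h \<chi> (p + q) = pm_eval h \<chi> p + pm_eval h \<chi> q"
proof -
  let ?S = "Poly_Mapping.keys p \<union> Poly_Mapping.keys q"
  have "Poly_Mapping.keys (p + q) \<subseteq> ?S" by (rule keys_add)
  then show ?thesis
    by (simp add: pm_eval_superset[of ?S] lookup_add h_add distrib_right sum.distrib)
qed

lemma pm_eval_sum: "pm_eval h \<chi> (\<Sum>x\<in>S. p x) = (\<Sum>x\<in>S. pm_eval h \<chi> (p x))"
  by (induction S rule: infinite_finite_induct) (simp_all add: pm_eval_add)

lemma pm_eval_mult:
  fixes \<chi> :: "'m::comm_monoid_add \<Rightarrow> 'r"
  assumes h: "\<And>a b. h (a * b) = h a * h b" and \<chi>: "\<And>m n. \<chi> (m + n) = \<chi> m * \<chi> n"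
  shows "pm_eval h \<chi> (p * q) = pm_eval h \<chi> p * pm_eval h \<chi> q"
proof -
  have "p * q = (\<Sum>m\<in>Poly_Mapping.keys p. \<Sum>n\<in>Poly_Mapping.keys q.
      Poly_Mapping.single (m + n) (Poly_Mapping.lookup p m * Poly_Mapping.lookup q n))"
    by (subst (1 2) sum_single_lookup[symmetric]) (simp add: sum_product mult_single)
  then show ?thesis
    by (simp add: pm_eval_sum pm_eval_single h \<chi>)
       (simp add: pm_eval_def sum_product algebra_simps)
qed

end

section \<open>Multi-indices\<close>

definition mdeg :: "('i::finite \<Rightarrow> nat) \<Rightarrow> nat" where
  "mdeg \<alpha> = (\<Sum>i\<in>UNIV. \<alpha> i)"

definition unit_index :: "'i \<Rightarrow> 'i \<Rightarrow> nat" where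
  "unit_index i = (\<lambda>j. if j = i then 1 else 0)"

lemma unit_index_apply [simp]: "unit_index i i = 1" "j \<noteq> i \<Longrightarrow> unit_index i j = 0"
  by (simp_all add: unit_index_def)

lemma mdeg_add: "mdeg (\<alpha> + \<beta>) = mdeg \<alpha> + mdeg \<beta>"
  by (simp add: mdeg_def sum.distrib pointwise)

lemma mdeg_zero [simp]: "mdeg 0 = 0" and mdeg_unit_index [simp]: "mdeg (unit_index i) = 1"
  by (simp_all add: mdeg_def unit_index_def pointwise)

lemma mdeg_eq_0_iff [simp]: "mdeg \<alpha> = 0 \<longleftrightarrow> \<alpha> = 0"
  by (auto simp: mdeg_def fun_eq_iff pointwise)

lemma minus_unit_index_add: "\<alpha> i \<noteq> 0 \<Longrightarrow> (\<alpha> - unit_index i) + unit_index i = \<alpha>"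
  by (auto simp: fun_eq_iff unit_index_def pointwise)

lemma mdeg_Suc_cases:
  assumes "mdeg \<alpha> = Suc n"
  obtains \<beta> i where "\<alpha> = \<beta> + unit_index i" "mdeg \<beta> = n"
proof -
  have "\<alpha> \<noteq> 0" using assms by auto
  then obtain i where "\<alpha> i \<noteq> 0" by (auto simp: fun_eq_iff pointwise)
  then have "\<alpha> = (\<alpha> - unit_index i) + unit_index i" by (rule minus_unit_index_add[symmetric])
  moreover from this have "mdeg (\<alpha> - unit_index i) = n"
    using assms mdeg_add[of "\<alpha> - unit_index i" "unit_index i"] by simp
  ultimately show ?thesis by (rule that)
qed

lemma mindex_induct [case_names zero step]:
  assumes "P 0" "\<And>\<alpha> i. P \<alpha> \<Longrightarrow> P (\<alpha> + unit_index i)"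
  shows "P (\<alpha> :: 'i::finite \<Rightarrow> nat)"
proof (induction "mdeg \<alpha>" arbitrary: \<alpha>)
  case 0
  then show ?case using assms(1) by simp
next
  case (Suc n)
  then show ?case by (metis assms(2) mdeg_Suc_cases)
qed

lemma mdeg_1_cases:
  assumes "mdeg \<alpha> = 1"
  obtains i where "\<alpha> = unit_index i"
  using mdeg_Suc_cases[of \<alpha> 0] assms by auto

lemma mdeg_le_imp_eq:
  assumes "\<forall>i. \<beta> i \<le> \<alpha> i" "mdeg \<alpha> \<le> mdeg \<beta>"
  shows "\<beta> = (\<alpha> :: 'i::finite \<Rightarrow> nat)"
proof -
  have e: "\<alpha> = (\<alpha> - \<beta>) + \<beta>" using assms(1) by (simp add: fun_eq_iff pointwise)
  then have "mdeg \<alpha> = mdeg (\<alpha> - \<beta>) + mdeg \<beta>" by (metis mdeg_add)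
  then have "\<alpha> - \<beta> = 0" using assms(2) by simp
  with e show ?thesis by simp
qed

lemma finite_below: "finite {\<gamma>::'i::finite \<Rightarrow> nat. \<forall>i. \<gamma> i \<le> \<alpha> i}"
proof (rule finite_subset)
  show "{\<gamma>. \<forall>i. \<gamma> i \<le> \<alpha> i} \<subseteq> PiE UNIV (\<lambda>i. {..\<alpha> i})" by auto
  show "finite (PiE (UNIV::'i set) (\<lambda>i. {..\<alpha> i}))" by (rule finite_PiE) auto
qed

definition mchoose :: "('i::finite \<Rightarrow> nat) \<Rightarrow> ('i \<Rightarrow> nat) \<Rightarrow> nat" where
  "mchoose \<alpha> \<gamma> = (\<Prod>i\<in>UNIV. \<alpha> i choose \<gamma> i)"

text \<open>Splitting off one variable: this reduces the Leibniz rule for \<open>\<partial>\<^sup>\<alpha>\<close> to the one-variable rule.\<close>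

lemma mchoose_upd:
  assumes "\<alpha> i = 0" "\<gamma> i = 0"
  shows "mchoose (\<alpha>(i := n)) (\<gamma>(i := k)) = (n choose k) * mchoose \<alpha> \<gamma>"
proof -
  have "mchoose \<alpha> \<gamma> = (\<Prod>j\<in>UNIV - {i}. \<alpha> j choose \<gamma> j)"
    unfolding mchoose_def by (subst prod.remove[of UNIV i]) (simp_all add: assms)
  moreover have "mchoose (\<alpha>(i := n)) (\<gamma>(i := k)) = (n choose k) * (\<Prod>j\<in>UNIV - {i}. \<alpha> j choose \<gamma> j)"
    unfolding mchoose_def by (subst prod.remove[of UNIV i]) (auto intro!: prod.cong)
  ultimately show ?thesis by simp
qed

section \<open>Iterated derivations\<close>

context differential_field
begin

lemma d_zero [simp]: "d i 0 = 0"
  using d_add[of i 0 0] by simp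

lemma d_one [simp]: "d i 1 = 0"
  using d_mult[of i 1 1] by simp

lemma d_sum: "d i (\<Sum>x\<in>S. f x) = (\<Sum>x\<in>S. d i (f x))"
  by (induction S rule: infinite_finite_induct) (simp_all add: d_add)

lemma d_of_nat [simp]: "d i (of_nat n) = 0"
  by (induction n) (simp_all add: d_add)

lemma d_inverse: "a \<noteq> 0 \<Longrightarrow> d i (inverse a) = - (d i a / (a * a))"
proof -
  assume a: "a \<noteq> 0"
  have "d i a * inverse a + a * d i (inverse a) = 0"
    using d_mult[of i a "inverse a"] a by simp
  then show ?thesis using a by (simp add: field_simps add_eq_0_iff2)
qed

lemma funpow_d_add: "(d i ^^ n) (a + b) = (d i ^^ n) a + (d i ^^ n) b"
  by (induction n) (simp_all add: d_add)

lemma funpow_d_zero [simp]: "(d i ^^ n) 0 = 0"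
  by (induction n) simp_all

lemma funpow_d_sum: "(d i ^^ n) (\<Sum>x\<in>S. f x) = (\<Sum>x\<in>S. (d i ^^ n) (f x))"
  by (induction S rule: infinite_finite_induct) (simp_all add: funpow_d_add)

lemma funpow_d_of_nat_mult: "(d i ^^ n) (of_nat m * a) = of_nat m * (d i ^^ n) a"
  by (induction n) (simp_all add: d_mult)

lemma d_funpow_commute: "d j ((d i ^^ n) a) = (d i ^^ n) (d j a)"
  by (induction n) (simp_all add: d_commute)

lemma funpow_d_commute: "(d j ^^ m) ((d i ^^ n) a) = (d i ^^ n) ((d j ^^ m) a)"
  by (induction m) (simp_all add: d_funpow_commute)

lemma dpow_zero [simp]: "dpow d 0 u = u"
proof -
  have "Finite_Set.fold (\<lambda>i. d i ^^ 0) u S = u" if "finite S" for S :: "'i set"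
  proof -
    interpret comp_fun_commute "\<lambda>i. d i ^^ 0" by standard simp
    from that show ?thesis
    proof (induction S)
      case (insert x F)
      show ?case by (rule trans[OF fold_insert[OF insert.hyps]]) (subst insert.IH, simp)
    qed simp
  qed
  then show ?thesis by (simp add: dpow_def pointwise)
qed

lemma dpow_unit_index_add: "dpow d (\<alpha> + unit_index i) u = d i (dpow d \<alpha> u)"
proof -
  interpret A: comp_fun_commute "\<lambda>j. d j ^^ (\<alpha> + unit_index i) j"
    by standard (simp add: fun_eq_iff funpow_d_commute)
  interpret B: comp_fun_commute "\<lambda>j. d j ^^ \<alpha> j"
    by standard (simp add: fun_eq_iff funpow_d_commute)
  have "Finite_Set.fold (\<lambda>j. d j ^^ (\<alpha> + unit_index i) j) u (UNIV - {i})
      = Finite_Set.fold (\<lambda>j. d j ^^ \<alpha> j) u (UNIV - {i})"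
    by (rule Finite_Set.fold_cong[where S = UNIV])
       (use A.comp_fun_commute_on_axioms B.comp_fun_commute_on_axioms in \<open>auto simp: pointwise\<close>)
  moreover have "Finite_Set.fold (\<lambda>j. d j ^^ (\<alpha> + unit_index i) j) u UNIV
      = (d i ^^ (\<alpha> + unit_index i) i) (Finite_Set.fold (\<lambda>j. d j ^^ (\<alpha> + unit_index i) j) u (UNIV - {i}))"
    by (rule A.fold_rec) auto
  moreover have "Finite_Set.fold (\<lambda>j. d j ^^ \<alpha> j) u UNIV
      = (d i ^^ \<alpha> i) (Finite_Set.fold (\<lambda>j. d j ^^ \<alpha> j) u (UNIV - {i}))"
    by (rule B.fold_rec) auto
  moreover have "(\<alpha> + unit_index i) i = Suc (\<alpha> i)" by (simp add: pointwise)
  ultimately show ?thesis by (simp only: dpow_def) simp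
qed

lemma dpow_unit_index [simp]: "dpow d (unit_index i) u = d i u"
  using dpow_unit_index_add[of 0 i u] by simp

lemma dpow_add: "dpow d (\<alpha> + \<beta>) u = dpow d \<alpha> (dpow d \<beta> u)"
proof (induction \<alpha> rule: mindex_induct)
  case (step \<alpha> i)
  have "\<alpha> + unit_index i + \<beta> = (\<alpha> + \<beta>) + unit_index i" by (simp add: ac_simps)
  then show ?case using step by (simp only: dpow_unit_index_add)
qed simp

lemma dpow_plus: "dpow d \<alpha> (a + b) = dpow d \<alpha> a + dpow d \<alpha> b"
  by (induction \<alpha> rule: mindex_induct) (simp_all add: dpow_unit_index_add d_add)

lemma dpow_of_zero [simp]: "dpow d \<alpha> 0 = 0"
  by (induction \<alpha> rule: mindex_induct) (simp_all add: dpow_unit_index_add)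

lemma dpow_sum: "dpow d \<alpha> (\<Sum>x\<in>S. f x) = (\<Sum>x\<in>S. dpow d \<alpha> (f x))"
  by (induction S rule: infinite_finite_induct) (simp_all add: dpow_plus)

lemma dpow_upd: "\<alpha> i = 0 \<Longrightarrow> dpow d (\<alpha>(i := n)) u = (d i ^^ n) (dpow d \<alpha> u)"
proof (induction n)
  case (Suc n)
  have "\<alpha>(i := Suc n) = \<alpha>(i := n) + unit_index i" by (auto simp: fun_eq_iff unit_index_def pointwise)
  then have "dpow d (\<alpha>(i := Suc n)) u = d i (dpow d (\<alpha>(i := n)) u)" by (simp only: dpow_unit_index_add)
  with Suc show ?case by (simp del: fun_upd_apply)
qed (simp add: fun_upd_idem)

lemma funpow_d_mult:
  "(d i ^^ n) (a * b) = (\<Sum>k\<le>n. of_nat (n choose k) * (d i ^^ k) a * (d i ^^ (n - k)) b)"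
proof (induction n)
  case (Suc n)
  let ?t = "\<lambda>k. (d i ^^ k) a * (d i ^^ (Suc n - k)) b"
  have "(d i ^^ Suc n) (a * b)
      = (\<Sum>k\<le>n. of_nat (n choose k) * ?t (Suc k)) + (\<Sum>k\<le>n. of_nat (n choose k) * ?t k)"
    by (simp add: Suc d_sum d_mult Suc_diff_le algebra_simps sum.distrib)
  also have "(\<Sum>k\<le>n. of_nat (n choose k) * ?t k) = (\<Sum>k\<le>Suc n. of_nat (n choose k) * ?t k)"
    by simp
  also have "\<dots> = ?t 0 + (\<Sum>k\<le>n. of_nat (n choose Suc k) * ?t (Suc k))"
    by (subst sum.atMost_Suc_shift) simp
  also have "(\<Sum>k\<le>n. of_nat (n choose k) * ?t (Suc k)) + \<dots>
      = (\<Sum>k\<le>Suc n. of_nat (Suc n choose k) * ?t k)"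
    by (simp add: sum.atMost_Suc_shift algebra_simps sum.distrib del: sum.atMost_Suc)
  finally show ?case by (simp only: mult.assoc)
qed simp

text \<open>Induction on the support of \<open>\<alpha>\<close>. In the step \<open>\<alpha>\<close> is split into its part \<open>\<alpha>0\<close> away from \<open>i\<close> and its entry
\<open>n\<close> at \<open>i\<close>; the multi-indices below \<open>\<alpha>\<close> are the pairs of a multi-index below \<open>\<alpha>0\<close> and a \<open>k \<le> n\<close>.\<close>

lemma dpow_mult_supported:
  assumes "finite S" "\<forall>j. j \<notin> S \<longrightarrow> \<alpha> j = 0"
  shows "dpow d \<alpha> (a * b) =
    (\<Sum>\<gamma> | \<forall>i. \<gamma> i \<le> \<alpha> i. of_nat (mchoose \<alpha> \<gamma>) * dpow d \<gamma> a * dpow d (\<alpha> - \<gamma>) b)"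
  using assms
proof (induction S arbitrary: \<alpha> rule: finite_induct)
  case empty
  then have "\<alpha> = 0" by (auto simp: fun_eq_iff pointwise)
  moreover have "{\<gamma>::'i \<Rightarrow> nat. \<forall>i. \<gamma> i = 0} = {0}" by (auto simp: fun_eq_iff pointwise)
  moreover have "mchoose (0 :: 'i \<Rightarrow> nat) 0 = 1" by (simp add: mchoose_def pointwise)
  moreover have "(0::'i \<Rightarrow> nat) - 0 = 0" by (simp add: fun_eq_iff pointwise)
  moreover have "{\<gamma>::'i \<Rightarrow> nat. \<forall>i. \<gamma> i \<le> 0 i} = {0}" by (auto simp: fun_eq_iff pointwise)
  ultimately show ?case by simp
next
  case (insert i S)
  define n \<alpha>0 where "n = \<alpha> i" and "\<alpha>0 = \<alpha>(i := 0)"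
  have \<alpha>: "\<alpha> = \<alpha>0(i := n)" and z: "\<alpha>0 i = 0" by (simp_all add: n_def \<alpha>0_def)
  let ?S = "{\<gamma>. \<forall>j. \<gamma> j \<le> \<alpha>0 j}"
  have IH: "dpow d \<alpha>0 (a * b) =
    (\<Sum>\<gamma>\<in>?S. of_nat (mchoose \<alpha>0 \<gamma>) * dpow d \<gamma> a * dpow d (\<alpha>0 - \<gamma>) b)"
    using insert.prems by (intro insert.IH) (auto simp: \<alpha>0_def)
  have zS: "\<gamma> i = 0" if "\<gamma> \<in> ?S" for \<gamma> using that z by (metis le_zero_eq mem_Collect_eq)
  have "dpow d \<alpha> (a * b) = (d i ^^ n) (dpow d \<alpha>0 (a * b))"
    by (subst \<alpha>) (simp add: dpow_upd z)
  also have "\<dots> = (\<Sum>\<gamma>\<in>?S. \<Sum>k\<le>n. of_nat (mchoose \<alpha>0 \<gamma>) *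
     (of_nat (n choose k) * (d i ^^ k) (dpow d \<gamma> a) * (d i ^^ (n - k)) (dpow d (\<alpha>0 - \<gamma>) b)))"
    by (simp add: IH funpow_d_sum mult.assoc funpow_d_of_nat_mult)
       (simp add: funpow_d_mult sum_distrib_left mult.assoc)
  also have "\<dots> = (\<Sum>(\<gamma>, k)\<in>?S \<times> {..n}. of_nat (mchoose \<alpha>0 \<gamma>) *
     (of_nat (n choose k) * (d i ^^ k) (dpow d \<gamma> a) * (d i ^^ (n - k)) (dpow d (\<alpha>0 - \<gamma>) b)))"
    by (simp add: sum.cartesian_product)
  also have "\<dots> = (\<Sum>\<gamma> | \<forall>j. \<gamma> j \<le> \<alpha> j. of_nat (mchoose \<alpha> \<gamma>) * dpow d \<gamma> a * dpow d (\<alpha> - \<gamma>) b)"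
  proof (rule sum.reindex_bij_witness[where i = "\<lambda>\<gamma>. (\<gamma>(i := 0), \<gamma> i)" and j = "\<lambda>(\<gamma>, k). \<gamma>(i := k)"])
    fix p assume p: "p \<in> ?S \<times> {..n}"
    obtain \<gamma> k where [simp]: "p = (\<gamma>, k)" by (cases p)
    have g0: "\<gamma> i = 0" and g: "\<gamma> \<in> ?S" using p zS by auto
    show "(case p of (\<gamma>, k) \<Rightarrow> \<gamma>(i := k)) \<in> {\<gamma>. \<forall>j. \<gamma> j \<le> \<alpha> j}"
      using p by (auto simp: \<alpha>)
    show "((case p of (\<gamma>, k) \<Rightarrow> \<gamma>(i := k))(i := 0), (case p of (\<gamma>, k) \<Rightarrow> \<gamma>(i := k)) i) = p"
      using g0 by (simp add: fun_upd_idem)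
    have "\<alpha> - \<gamma>(i := k) = (\<alpha>0 - \<gamma>)(i := n - k)" by (auto simp: \<alpha> fun_eq_iff pointwise)
    moreover have "(\<alpha>0 - \<gamma>) i = 0" using z by (simp add: pointwise)
    ultimately show "(of_nat (mchoose \<alpha> (case p of (\<gamma>, k) \<Rightarrow> \<gamma>(i := k))) * dpow d (case p of (\<gamma>, k) \<Rightarrow> \<gamma>(i := k)) a *
          dpow d (\<alpha> - (case p of (\<gamma>, k) \<Rightarrow> \<gamma>(i := k))) b) =
         (case p of (\<gamma>, k) \<Rightarrow> of_nat (mchoose \<alpha>0 \<gamma>) *
     (of_nat (n choose k) * (d i ^^ k) (dpow d \<gamma> a) * (d i ^^ (n - k)) (dpow d (\<alpha>0 - \<gamma>) b)))"
      using g0 z by (simp add: \<alpha> mchoose_upd dpow_upd)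
  qed (auto simp: \<alpha>0_def n_def)
  finally show ?case .
qed

lemma dpow_mult:
  "dpow d \<alpha> (a * b) =
    (\<Sum>\<gamma> | \<forall>i. \<gamma> i \<le> \<alpha> i. of_nat (mchoose \<alpha> \<gamma>) * dpow d \<gamma> a * dpow d (\<alpha> - \<gamma>) b)"
  by (rule dpow_mult_supported[of UNIV]) auto

section \<open>Operators acting on functions\<close>

lemma dapply_pm_eval: "dapply d L u = pm_eval (\<lambda>x. x) (\<lambda>\<alpha>. dpow d \<alpha> u) L"
  by (simp add: dapply_def pm_eval_def)

lemma dapply_add: "dapply d (A + B) u = dapply d A u + dapply d B u"
proof -
  interpret additive_map "\<lambda>x::'k. x" by standard simp
  show ?thesis by (simp add: dapply_pm_eval pm_eval_add)
qed

lemma dapply_zero [simp]: "dapply d 0 u = 0"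
  by (simp add: dapply_def)

lemma dapply_sum: "dapply d (\<Sum>x\<in>S. A x) u = (\<Sum>x\<in>S. dapply d (A x) u)"
  by (induction S rule: infinite_finite_induct) (simp_all add: dapply_add)

lemma dapply_uminus: "dapply d (- A) u = - dapply d A u"
  using dapply_add[of A "- A" u] by (simp add: add_eq_0_iff)

lemma dapply_diff: "dapply d (A - B) u = dapply d A u - dapply d B u"
  using dapply_add[of A "- B" u] by (simp add: dapply_uminus)

lemma dapply_single: "dapply d (Poly_Mapping.single \<alpha> c) u = c * dpow d \<alpha> u"
  by (simp add: dapply_def)

lemma dapply_fn_op [simp]: "dapply d (fn_op f) u = f * u"
  by (simp add: fn_op_def dapply_single flip: zero_fun_def)

lemma dapply_of_zero [simp]: "dapply d A 0 = 0"
  by (simp add: dapply_def)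

lemma dapply_plus: "dapply d A (u + v) = dapply d A u + dapply d A v"
  by (simp add: dapply_def dpow_plus algebra_simps sum.distrib)

lemma dmult_alt: "A \<star>\<^bsub>d\<^esub> B = (\<Sum>\<alpha>\<in>Poly_Mapping.keys A. \<Sum>\<beta>\<in>Poly_Mapping.keys B. \<Sum>\<gamma> | \<forall>i. \<gamma> i \<le> \<alpha> i.
     Poly_Mapping.single (\<alpha> - \<gamma> + \<beta>)
       (of_nat (mchoose \<alpha> \<gamma>) * Poly_Mapping.lookup A \<alpha> * dpow d \<gamma> (Poly_Mapping.lookup B \<beta>)))"
  by (simp add: dmult_def mchoose_def plus_fun_def fun_diff_def)

text \<open>The product of operators is composition of maps; this is the Leibniz rule that the product is modelled on.\<close>

lemma dapply_dmult [simp]: "dapply d (A \<star>\<^bsub>d\<^esub> B) u = dapply d A (dapply d B u)"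
proof -
  have "dapply d A (dapply d B u) = (\<Sum>\<alpha>\<in>Poly_Mapping.keys A. \<Sum>\<beta>\<in>Poly_Mapping.keys B.
     Poly_Mapping.lookup A \<alpha> * dpow d \<alpha> (Poly_Mapping.lookup B \<beta> * dpow d \<beta> u))"
    by (simp add: dapply_def dpow_sum sum_distrib_left)
  also have "\<dots> = dapply d (A \<star>\<^bsub>d\<^esub> B) u"
    unfolding dmult_alt dapply_sum dapply_single dpow_add dpow_mult sum_distrib_left
    by (intro sum.cong refl) (simp only: ac_simps)
  finally show ?thesis by simp
qed

end

section \<open>Principal symbols\<close>

text \<open>The principal symbol as an element of the commutative polynomial ring, so that symbols can be multiplied
by the ordinary product of polynomial mappings.\<close>

definition top_part :: "('i::finite, 'k::comm_monoid_add) dop \<Rightarrow> ('i, 'k) dop" where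
  "top_part L = (\<Sum>\<alpha>\<in>Poly_Mapping.keys L. if mdeg \<alpha> = ord L then Poly_Mapping.single \<alpha> (Poly_Mapping.lookup L \<alpha>) else 0)"

lemma lookup_top_part: "Poly_Mapping.lookup (top_part L) = psymbol L"
proof (rule ext)
  fix \<alpha>
  have "Poly_Mapping.lookup (top_part L) \<alpha> =
    (\<Sum>\<beta>\<in>Poly_Mapping.keys L. if \<beta> = \<alpha> then if mdeg \<alpha> = ord L then Poly_Mapping.lookup L \<alpha> else 0 else 0)"
    unfolding top_part_def lookup_sum by (rule sum.cong) (auto simp: lookup_single)
  then show "Poly_Mapping.lookup (top_part L) \<alpha> = psymbol L \<alpha>"
    by (simp add: psymbol_def in_keys_iff mdeg_def)
qed

lemma psymbol_eq_iff: "psymbol A = psymbol B \<longleftrightarrow> top_part A = top_part B"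
  by (metis lookup_top_part poly_mapping_eq_iff)

lemma ord_eq: "L \<noteq> 0 \<Longrightarrow> ord L = Max (mdeg ` Poly_Mapping.keys L)"
  by (simp add: ord_def mdeg_def)

lemma mdeg_le_ord: "\<alpha> \<in> Poly_Mapping.keys L \<Longrightarrow> mdeg \<alpha> \<le> ord L"
  by (subst ord_eq) (auto intro!: Max_ge)

lemma ord_attained: "L \<noteq> 0 \<Longrightarrow> \<exists>\<alpha>\<in>Poly_Mapping.keys L. mdeg \<alpha> = ord L"
proof -
  assume L: "L \<noteq> 0"
  then have "mdeg ` Poly_Mapping.keys L \<noteq> {}"
    using keys_nonempty by auto
  then have "Max (mdeg ` Poly_Mapping.keys L) \<in> mdeg ` Poly_Mapping.keys L" by (intro Max_in) auto
  then show ?thesis unfolding ord_eq[OF L] by (auto simp: eq_commute)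
qed


lemma keys_top_part: "\<alpha> \<in> Poly_Mapping.keys (top_part L) \<Longrightarrow> mdeg \<alpha> = ord L"
  by (auto simp: in_keys_iff lookup_top_part psymbol_def mdeg_def split: if_splits)

lemma top_part_zero [simp]: "top_part 0 = 0"
  by (simp add: top_part_def)

lemma top_part_eq_0_iff [simp]: "top_part L = 0 \<longleftrightarrow> L = 0"
proof
  assume s: "top_part L = 0"
  show "L = 0"
  proof (rule ccontr)
    assume "L \<noteq> 0"
    then obtain \<alpha> where "\<alpha> \<in> Poly_Mapping.keys L" "mdeg \<alpha> = ord L" using ord_attained by blast
    then have "Poly_Mapping.lookup (top_part L) \<alpha> \<noteq> 0"
      by (simp add: lookup_top_part psymbol_def mdeg_def in_keys_iff)
    with s show False by simp
  qed
qed (simp add: top_part_def)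

definition deg_less :: "nat \<Rightarrow> ('i::finite, 'k::zero) dop \<Rightarrow> bool" where
  "deg_less n L \<longleftrightarrow> (\<forall>\<alpha>\<in>Poly_Mapping.keys L. mdeg \<alpha> < n)"

lemma deg_less_add: "deg_less n A \<Longrightarrow> deg_less n B \<Longrightarrow> deg_less n (A + B)"
  unfolding deg_less_def using keys_add[of A B] by blast

lemma deg_less_zero [simp]: "deg_less n 0"
  by (simp add: deg_less_def)

lemma deg_less_sum: "(\<And>x. x \<in> S \<Longrightarrow> deg_less n (A x)) \<Longrightarrow> deg_less n (\<Sum>x\<in>S. A x)"
  by (induction S rule: infinite_finite_induct) (auto intro: deg_less_add)

lemma deg_less_single: "mdeg \<alpha> < n \<Longrightarrow> deg_less n (Poly_Mapping.single \<alpha> c)"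
  by (auto simp: deg_less_def)

lemma deg_less_mult:
  fixes A B :: "('i::finite, 'k::comm_ring_1) dop"
  assumes "\<And>\<alpha> \<beta>. \<alpha> \<in> Poly_Mapping.keys A \<Longrightarrow> \<beta> \<in> Poly_Mapping.keys B \<Longrightarrow> mdeg \<alpha> + mdeg \<beta> < n"
  shows "deg_less n (A * B)"
  unfolding deg_less_def using keys_mult[of A B] assms by (fastforce simp: mdeg_add)

lemma deg_less_diff_top_part:
  fixes L :: "('i::finite, 'k::comm_ring_1) dop"
  shows "deg_less (ord L) (L - top_part L)"
  unfolding deg_less_def
proof
  fix \<alpha> assume a: "\<alpha> \<in> Poly_Mapping.keys (L - top_part L)"
  then have "mdeg \<alpha> \<noteq> ord L"
    by (auto simp: in_keys_iff lookup_minus lookup_top_part psymbol_def mdeg_def)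
  moreover from a have "\<alpha> \<in> Poly_Mapping.keys L"
    by (auto simp: in_keys_iff lookup_minus lookup_top_part psymbol_def split: if_splits)
  ultimately show "mdeg \<alpha> < ord L" using mdeg_le_ord[of \<alpha> L] by simp
qed

text \<open>Order and symbol are read off from any presentation as a nonzero homogeneous part plus lower terms.\<close>

lemma ord_top_part_unique:
  fixes L :: "('i::finite, 'k::comm_ring_1) dop"
  assumes "L = H + E" "H \<noteq> 0" "\<And>\<alpha>. \<alpha> \<in> Poly_Mapping.keys H \<Longrightarrow> mdeg \<alpha> = n" "deg_less n E"
  shows "ord L = n" "top_part L = H"
proof -
  have E: "Poly_Mapping.lookup E \<alpha> = 0" if "mdeg \<alpha> \<ge> n" for \<alpha>
    using assms(4) that by (force simp: deg_less_def in_keys_iff)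
  have H: "Poly_Mapping.lookup H \<alpha> = 0" if "mdeg \<alpha> \<noteq> n" for \<alpha>
    using assms(3) that by (force simp: in_keys_iff)
  obtain \<alpha> where \<alpha>: "\<alpha> \<in> Poly_Mapping.keys H"
    using keys_nonempty[OF assms(2)] by blast
  then have "\<alpha> \<in> Poly_Mapping.keys L" "mdeg \<alpha> = n"
    using assms(1,3) E by (auto simp: in_keys_iff lookup_add)
  moreover from this have "L \<noteq> 0" by auto
  moreover have "mdeg \<beta> \<le> n" if "\<beta> \<in> Poly_Mapping.keys L" for \<beta>
    using that E[of \<beta>] H[of \<beta>] assms(1) by (force simp: in_keys_iff lookup_add)
  ultimately show o: "ord L = n"
    by (metis le_antisym mdeg_le_ord ord_attained)
  show "top_part L = H"
  proof (rule poly_mapping_eqI)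
    fix \<alpha>
    have "Poly_Mapping.lookup L \<alpha> = Poly_Mapping.lookup H \<alpha> + Poly_Mapping.lookup E \<alpha>"
      by (simp add: assms(1) lookup_add)
    then show "Poly_Mapping.lookup (top_part L) \<alpha> = Poly_Mapping.lookup H \<alpha>"
      using E[of \<alpha>] H[of \<alpha>] by (simp add: lookup_top_part psymbol_def o flip: mdeg_def)
  qed
qed

lemma ord_cong: "top_part A = top_part B \<Longrightarrow> ord A = ord B"
proof (cases "A = 0")
  case False
  assume s: "top_part A = top_part B"
  from False obtain \<alpha> where "\<alpha> \<in> Poly_Mapping.keys (top_part A)"
    by (metis top_part_eq_0_iff in_keys_iff poly_mapping_eqI lookup_zero)
  with s show ?thesis by (metis keys_top_part)
qed (metis top_part_eq_0_iff)

section \<open>The polynomial ring of symbols is a domain\<close>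

text \<open>Exponents \<open>\<alpha> \<in> S\<close> are encoded as polynomials \<open>\<Sum> \<alpha>\<^sub>i x\<^bsup>e i\<^esup>\<close>; the finitely many differences of
distinct ones are nonzero polynomials and have only finitely many roots, so some natural number \<open>x\<close>
separates all of \<open>S\<close>.\<close>

lemma separating_weight:
  fixes S :: "('i::finite \<Rightarrow> nat) set"
  assumes "finite S"
  obtains w :: "'i \<Rightarrow> nat" where "inj_on (\<lambda>\<alpha>. \<Sum>i\<in>UNIV. w i * \<alpha> i) S"
proof -
  obtain e :: "'i \<Rightarrow> nat" where e: "inj e" using finite_imp_inj_to_nat_seg[of "UNIV::'i set"] by auto
  define P :: "('i \<Rightarrow> nat) \<Rightarrow> int poly" where "P \<alpha> = (\<Sum>i\<in>UNIV. monom (int (\<alpha> i)) (e i))" for \<alpha>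
  have "coeff (P \<alpha>) (e i) = int (\<alpha> i)" for \<alpha> i
    using e by (simp add: P_def coeff_sum inj_eq)
  then have "P \<alpha> \<noteq> P \<beta>" if "\<alpha> \<noteq> \<beta>" for \<alpha> \<beta> using that by (metis ext of_nat_eq_iff)
  define Q where "Q = (\<Prod>(\<alpha>, \<beta>)\<in>{(\<alpha>, \<beta>)\<in>S \<times> S. \<alpha> \<noteq> \<beta>}. P \<alpha> - P \<beta>)"
  have fin: "finite {(\<alpha>, \<beta>)\<in>S \<times> S. \<alpha> \<noteq> \<beta>}"
    by (rule finite_subset[of _ "S \<times> S"]) (use assms in auto)
  have "Q \<noteq> 0" unfolding Q_def using fin \<open>\<And>\<beta> \<alpha>. \<alpha> \<noteq> \<beta> \<Longrightarrow> P \<alpha> \<noteq> P \<beta>\<close> by (auto simp: prod_zero_iff)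
  then have "finite {x. poly Q x = 0}" by (rule poly_roots_finite)
  moreover have "infinite (range int)" by (rule range_inj_infinite) (auto intro: injI)
  ultimately obtain x where x: "poly Q (int x) \<noteq> 0"
    by (metis (mono_tags, lifting) finite_subset image_subsetI mem_Collect_eq)
  have *: "int (\<Sum>i\<in>UNIV. x ^ e i * \<alpha> i) = poly (P \<alpha>) (int x)" for \<alpha>
    by (simp add: P_def poly_sum poly_monom mult.commute)
  show ?thesis
  proof (rule that[of "\<lambda>i. x ^ e i"], rule inj_onI, rule ccontr)
    fix \<alpha> \<beta> assume a: "\<alpha> \<in> S" "\<beta> \<in> S" "(\<Sum>i\<in>UNIV. x ^ e i * \<alpha> i) = (\<Sum>i\<in>UNIV. x ^ e i * \<beta> i)" "\<alpha> \<noteq> \<beta>"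
    then have "poly (P \<alpha> - P \<beta>) (int x) = 0" by (metis * poly_diff diff_self)
    then have "poly Q (int x) = 0"
      unfolding Q_def poly_prod using fin a by (auto simp: prod_zero_iff intro!: bexI[of _ "(\<alpha>, \<beta>)"])
    with x show False by simp
  qed
qed

text \<open>Kronecker substitution \<open>x\<^sub>i \<mapsto> x\<^bsup>w i\<^esup>\<close> into univariate polynomials, with weights \<open>w\<close> that keep the
monomials of both factors distinct, so that neither factor is mapped to zero.\<close>

lemma poly_mapping_no_zero_divisors:
  fixes p q :: "('i::finite, 'k::idom) dop"
  assumes "p \<noteq> 0" "q \<noteq> 0"
  shows "p * q \<noteq> 0"
proof
  assume pq: "p * q = 0"
  obtain w :: "'i \<Rightarrow> nat" where
    w: "inj_on (\<lambda>\<alpha>. \<Sum>i\<in>UNIV. w i * \<alpha> i) (Poly_Mapping.keys p \<union> Poly_Mapping.keys q)"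
    by (rule separating_weight[of "Poly_Mapping.keys p \<union> Poly_Mapping.keys q"]) auto
  let ?w = "\<lambda>\<alpha>. \<Sum>i\<in>UNIV. w i * \<alpha> i"
  let ?ev = "pm_eval (\<lambda>c::'k. [:c:]) (\<lambda>\<alpha>. monom 1 (?w \<alpha>))"
  interpret additive_map "\<lambda>c::'k. [:c:]" by standard simp
  have nz: "?ev r \<noteq> 0" if "r \<noteq> 0" "inj_on ?w (Poly_Mapping.keys r)" for r
  proof -
    obtain \<alpha> where \<alpha>: "\<alpha> \<in> Poly_Mapping.keys r"
      using keys_nonempty[OF \<open>r \<noteq> 0\<close>] by blast
    have "coeff (?ev r) (?w \<alpha>) = (\<Sum>\<beta>\<in>Poly_Mapping.keys r. if \<beta> = \<alpha> then Poly_Mapping.lookup r \<alpha> else 0)"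
      unfolding pm_eval_def coeff_sum
      by (rule sum.cong) (use that(2) \<alpha> in \<open>auto simp: smult_monom dest: inj_onD\<close>)
    then show ?thesis using \<alpha> by (auto simp: in_keys_iff)
  qed
  have "?ev p * ?ev q = ?ev (p * q)"
    by (rule pm_eval_mult[symmetric]) (simp_all add: mult_monom pointwise algebra_simps sum.distrib)
  with pq have "?ev p = 0 \<or> ?ev q = 0" by simp
  moreover have "inj_on ?w (Poly_Mapping.keys p)" "inj_on ?w (Poly_Mapping.keys q)"
    using w by (auto intro: inj_on_subset)
  ultimately show False using nz assms by blast
qed

section \<open>The symbol of a product\<close>

context differential_field
begin

text \<open>In the Leibniz expansion the terms with \<open>\<gamma> = 0\<close> form the commutative product of the coefficients; every
other term has lost at least one derivation.\<close>

lemma dmult_decompose: "\<exists>E. A \<star>\<^bsub>d\<^esub> B = top_part A * top_part B + E \<and> deg_less (ord A + ord B) E"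
proof -
  define E1 where "E1 = (\<Sum>\<alpha>\<in>Poly_Mapping.keys A. \<Sum>\<beta>\<in>Poly_Mapping.keys B. \<Sum>\<gamma>\<in>{\<gamma>. \<forall>i. \<gamma> i \<le> \<alpha> i} - {0}.
     Poly_Mapping.single (\<alpha> - \<gamma> + \<beta>)
       (of_nat (mchoose \<alpha> \<gamma>) * Poly_Mapping.lookup A \<alpha> * dpow d \<gamma> (Poly_Mapping.lookup B \<beta>)))"
  have mch: "mchoose \<alpha> 0 = 1" for \<alpha> :: "'i \<Rightarrow> nat" by (simp add: mchoose_def pointwise)
  have sub0: "\<alpha> - 0 = (\<alpha> :: 'i \<Rightarrow> nat)" for \<alpha> by (simp add: fun_eq_iff pointwise)
  have "A * B = (\<Sum>\<alpha>\<in>Poly_Mapping.keys A. \<Sum>\<beta>\<in>Poly_Mapping.keys B.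
      Poly_Mapping.single (\<alpha> + \<beta>) (Poly_Mapping.lookup A \<alpha> * Poly_Mapping.lookup B \<beta>))"
    by (subst (1 2) sum_single_lookup[symmetric]) (simp add: sum_product mult_single)
  then have 1: "A \<star>\<^bsub>d\<^esub> B = A * B + E1"
    unfolding dmult_alt E1_def
    by (simp add: finite_below sum.remove[of _ 0] mch sub0 pointwise sum.distrib)
  have E1: "deg_less (ord A + ord B) E1"
    unfolding E1_def
  proof (intro deg_less_sum deg_less_single)
    fix \<alpha> \<beta> \<gamma> assume a: "\<alpha> \<in> Poly_Mapping.keys A" "\<beta> \<in> Poly_Mapping.keys B"
      "\<gamma> \<in> {\<gamma>. \<forall>i. \<gamma> i \<le> \<alpha> i} - {0}"
    then have "mdeg ((\<alpha> - \<gamma>) + \<gamma>) = mdeg \<alpha>"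
      by (intro arg_cong[of _ _ mdeg]) (auto simp: fun_eq_iff pointwise)
    moreover have "mdeg \<gamma> > 0" using a(3) by (metis DiffE gr0I insertI1 mdeg_eq_0_iff)
    ultimately show "mdeg (\<alpha> - \<gamma> + \<beta>) < ord A + ord B"
      using mdeg_le_ord[OF a(1)] mdeg_le_ord[OF a(2)] by (simp add: mdeg_add)
  qed
  have "A * B = top_part A * top_part B + (top_part A * (B - top_part B) + (A - top_part A) * B)" by (simp add: algebra_simps)
  moreover have "deg_less (ord A + ord B) (top_part A * (B - top_part B))"
    by (rule deg_less_mult) (use deg_less_diff_top_part[of B] in \<open>auto dest!: keys_top_part simp: deg_less_def\<close>)
  moreover have "deg_less (ord A + ord B) ((A - top_part A) * B)"
  proof (rule deg_less_mult)
    fix \<alpha> \<beta> assume "\<alpha> \<in> Poly_Mapping.keys (A - top_part A)" "\<beta> \<in> Poly_Mapping.keys B"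
    then show "mdeg \<alpha> + mdeg \<beta> < ord A + ord B"
      using deg_less_diff_top_part[of A] mdeg_le_ord[of \<beta> B] by (fastforce simp: deg_less_def)
  qed
  ultimately show ?thesis using 1 E1 by (metis (no_types, lifting) add.assoc deg_less_add)
qed

lemma dmult_zero_left [simp]: "0 \<star>\<^bsub>d\<^esub> B = 0" and dmult_zero_right [simp]: "B \<star>\<^bsub>d\<^esub> 0 = 0"
  by (simp_all add: dmult_def)

lemma
  assumes "A \<noteq> 0" "B \<noteq> 0"
  shows ord_dmult: "ord (A \<star>\<^bsub>d\<^esub> B) = ord A + ord B"
    and dmult_nonzero: "A \<star>\<^bsub>d\<^esub> B \<noteq> 0"
    and top_part_dmult_nonzero: "top_part (A \<star>\<^bsub>d\<^esub> B) = top_part A * top_part B"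
proof -
  obtain E where E: "A \<star>\<^bsub>d\<^esub> B = top_part A * top_part B + E" "deg_less (ord A + ord B) E"
    using dmult_decompose by blast
  have nz: "top_part A * top_part B \<noteq> 0" by (rule poly_mapping_no_zero_divisors) (use assms in auto)
  have k: "mdeg \<alpha> = ord A + ord B" if "\<alpha> \<in> Poly_Mapping.keys (top_part A * top_part B)" for \<alpha>
    using keys_mult[of "top_part A" "top_part B"] that by (auto simp: mdeg_add dest!: keys_top_part subsetD)
  show "ord (A \<star>\<^bsub>d\<^esub> B) = ord A + ord B" and s: "top_part (A \<star>\<^bsub>d\<^esub> B) = top_part A * top_part B"
    using ord_top_part_unique[OF E(1) nz k E(2)] by auto
  show "A \<star>\<^bsub>d\<^esub> B \<noteq> 0" using s nz by (metis top_part_eq_0_iff)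
qed

lemma top_part_dmult: "top_part (A \<star>\<^bsub>d\<^esub> B) = top_part A * top_part B"
proof (cases "A = 0 \<or> B = 0")
  case True
  then show ?thesis by auto
qed (use top_part_dmult_nonzero in auto)

end

section \<open>Monomials in infinitely many variables\<close>

definition monom_eval :: "('v \<Rightarrow> 'r::comm_ring_1) \<Rightarrow> ('v \<Rightarrow>\<^sub>0 nat) \<Rightarrow> 'r" where
  "monom_eval x m = (\<Prod>v\<in>Poly_Mapping.keys m. x v ^ Poly_Mapping.lookup m v)"

lemma monom_eval_superset:
  assumes "finite W" "Poly_Mapping.keys m \<subseteq> W"
  shows "monom_eval x m = (\<Prod>v\<in>W. x v ^ Poly_Mapping.lookup m v)"
  unfolding monom_eval_def
  by (rule prod.mono_neutral_left) (use assms in \<open>auto simp: in_keys_iff\<close>)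

lemma monom_eval_add: "monom_eval x (m + n) = monom_eval x m * monom_eval x n"
proof -
  let ?W = "Poly_Mapping.keys m \<union> Poly_Mapping.keys n"
  have "Poly_Mapping.keys (m + n) \<subseteq> ?W" by (rule keys_add)
  then show ?thesis
    by (simp add: monom_eval_superset[of ?W] lookup_add power_add prod.distrib)
qed

lemma monom_eval_single [simp]: "monom_eval x (Poly_Mapping.single v n) = x v ^ n"
  by (simp add: monom_eval_def)

lemma monom_eval_zero [simp]: "monom_eval x 0 = 1"
  by (simp add: monom_eval_def)

text \<open>Shared by the derivations of \<open>K\<close> and by the formal derivative of univariate polynomials. The two instances
are compared in lemma \<open>mpoly_eval_dpoly_deriv\<close>.\<close>

locale derivation_map =
  fixes D :: "'r::comm_ring_1 \<Rightarrow> 'r"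
  assumes D_mult: "D (a * b) = D a * b + a * D b"
begin

lemma D_one: "D 1 = 0"
  using D_mult[of 1 1] by simp

lemma D_power: "D (a ^ n) = of_nat n * a ^ (n - 1) * D a"
proof (induction n)
  case (Suc n)
  then show ?case by (cases n) (simp_all add: D_mult algebra_simps)
qed (simp add: D_one)

lemma D_prod:
  "finite W \<Longrightarrow> D (\<Prod>v\<in>W. f v) = (\<Sum>v\<in>W. (\<Prod>w\<in>W - {v}. f w) * D (f v))"
proof (induction W rule: finite_induct)
  case (insert a W)
  have "(\<Sum>v\<in>W. (\<Prod>w\<in>insert a W - {v}. f w) * D (f v)) = (\<Sum>v\<in>W. f a * ((\<Prod>w\<in>W - {v}. f w) * D (f v)))"
  proof (rule sum.cong)
    fix v assume "v \<in> W"
    with insert have "insert a W - {v} = insert a (W - {v})" by auto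
    with insert show "(\<Prod>w\<in>insert a W - {v}. f w) * D (f v) = f a * ((\<Prod>w\<in>W - {v}. f w) * D (f v))"
      by (simp add: mult.assoc)
  qed simp
  with insert show ?case
    by (simp add: D_mult sum_distrib_left insert_Diff_if mult.commute)
qed (simp add: D_one)

lemma D_monom_eval:
  "D (monom_eval x m) = (\<Sum>v\<in>Poly_Mapping.keys m.
     of_nat (Poly_Mapping.lookup m v) * monom_eval x (m - Poly_Mapping.single v 1) * D (x v))"
proof -
  let ?K = "Poly_Mapping.keys m"
  have "D (monom_eval x m) = (\<Sum>v\<in>?K. (\<Prod>w\<in>?K - {v}. x w ^ Poly_Mapping.lookup m w) * D (x v ^ Poly_Mapping.lookup m v))"
    unfolding monom_eval_def by (rule D_prod) simp
  also have "\<dots> = (\<Sum>v\<in>?K. of_nat (Poly_Mapping.lookup m v) * monom_eval x (m - Poly_Mapping.single v 1) * D (x v))"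
  proof (rule sum.cong)
    fix v assume v: "v \<in> ?K"
    have "Poly_Mapping.keys (m - Poly_Mapping.single v 1) \<subseteq> ?K"
      by (auto simp: in_keys_iff lookup_minus)
    then have "monom_eval x (m - Poly_Mapping.single v 1)
        = (\<Prod>w\<in>?K. x w ^ Poly_Mapping.lookup (m - Poly_Mapping.single v 1) w)"
      by (intro monom_eval_superset) auto
    also have "\<dots> = x v ^ (Poly_Mapping.lookup m v - 1) * (\<Prod>w\<in>?K - {v}. x w ^ Poly_Mapping.lookup m w)"
    proof -
      have "(\<Prod>w\<in>?K - {v}. x w ^ Poly_Mapping.lookup (m - Poly_Mapping.single v 1) w)
          = (\<Prod>w\<in>?K - {v}. x w ^ Poly_Mapping.lookup m w)"
        by (rule prod.cong) (auto simp: lookup_minus lookup_single when_def)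
      then show ?thesis using v by (subst prod.remove[of _ v]) (auto simp: lookup_minus)
    qed
    finally have E: "monom_eval x (m - Poly_Mapping.single v 1)
        = x v ^ (Poly_Mapping.lookup m v - 1) * (\<Prod>w\<in>?K - {v}. x w ^ Poly_Mapping.lookup m w)" .
    show "(\<Prod>w\<in>?K - {v}. x w ^ Poly_Mapping.lookup m w) * D (x v ^ Poly_Mapping.lookup m v)
       = of_nat (Poly_Mapping.lookup m v) * monom_eval x (m - Poly_Mapping.single v 1) * D (x v)"
      unfolding E D_power by (simp only: ac_simps)
  qed simp
  finally show ?thesis .
qed

end

section \<open>Polynomials on a line\<close>

abbreviation mpoly_eval :: "('v \<Rightarrow> 'k::comm_ring_1) \<Rightarrow> (('v \<Rightarrow>\<^sub>0 nat) \<Rightarrow>\<^sub>0 'k) \<Rightarrow> 'k" where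
  "mpoly_eval x \<equiv> pm_eval (\<lambda>c. c) (monom_eval x)"

text \<open>The polynomial \<open>s \<mapsto> f(x + s y)\<close>. Restricting to lines replaces multivariate arguments (primality,
directional derivatives) by facts about univariate polynomials over an infinite field.\<close>

definition line_poly :: "('v \<Rightarrow> 'k::comm_ring_1) \<Rightarrow> ('v \<Rightarrow> 'k) \<Rightarrow> (('v \<Rightarrow>\<^sub>0 nat) \<Rightarrow>\<^sub>0 'k) \<Rightarrow> 'k poly" where
  "line_poly x y = pm_eval (\<lambda>c. [:c:]) (monom_eval (\<lambda>v. [:x v, y v:]))"

lemma poly_line_poly: "poly (line_poly x y f) s = mpoly_eval (\<lambda>v. x v + s * y v) f"
  by (simp add: line_poly_def pm_eval_def monom_eval_def poly_sum poly_prod)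

interpretation id_additive: additive_map "\<lambda>c::'k::comm_ring_1. c"
  by standard simp

lemma mpoly_eval_mult: "mpoly_eval x (f * g) = mpoly_eval x f * mpoly_eval x g"
  by (rule id_additive.pm_eval_mult) (simp_all add: monom_eval_add)

lemma pderiv_line_poly:
  fixes x y :: "'v \<Rightarrow> 'k::idom"
  shows "poly (pderiv (line_poly x y f)) 0 = (\<Sum>m\<in>Poly_Mapping.keys f. Poly_Mapping.lookup f m *
     (\<Sum>v\<in>Poly_Mapping.keys m. of_nat (Poly_Mapping.lookup m v) * monom_eval x (m - Poly_Mapping.single v 1) * y v))"
proof -
  interpret derivation_map "pderiv :: 'k poly \<Rightarrow> 'k poly"
    by standard (simp only: pderiv_mult ac_simps)
  let ?X = "\<lambda>v. [:x v, y v:]"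
  have X: "poly (monom_eval ?X m) 0 = monom_eval x m" for m :: "'v \<Rightarrow>\<^sub>0 nat"
    by (simp add: monom_eval_def poly_prod)
  have pderiv_sum: "pderiv (\<Sum>m\<in>S. g m) = (\<Sum>m\<in>S. pderiv (g m))"
    for S and g :: "('v \<Rightarrow>\<^sub>0 nat) \<Rightarrow> 'k poly"
    by (induction S rule: infinite_finite_induct) (simp_all add: pderiv_add)
  have "pderiv (line_poly x y f) = (\<Sum>m\<in>Poly_Mapping.keys f. smult (Poly_Mapping.lookup f m) (pderiv (monom_eval ?X m)))"
    by (simp add: line_poly_def pm_eval_def pderiv_sum pderiv_smult)
  then show ?thesis
    unfolding D_monom_eval by (simp add: poly_sum X pderiv_pCons ac_simps del: One_nat_def)
qed

section \<open>The linear solutions in a differentially closed field\<close>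

lemma vector_space_dop: "vector_space (\<lambda>c (P :: ('i, 'k::field) dop). Poly_Mapping.single 0 c * P)"
  by standard (simp_all add: distrib_left distrib_right single_add mult_single flip: mult.assoc)

lemma lookup_scale: "Poly_Mapping.lookup (Poly_Mapping.single 0 c * P) \<alpha> = c * Poly_Mapping.lookup (P :: ('i, 'k::comm_ring_1) dop) \<alpha>"
proof -
  have "Poly_Mapping.single 0 c * P = (\<Sum>\<beta>\<in>Poly_Mapping.keys P. Poly_Mapping.single \<beta> (c * Poly_Mapping.lookup P \<beta>))"
    by (subst (1) sum_single_lookup[of P, symmetric]) (simp add: sum_distrib_left mult_single)
  then have "Poly_Mapping.lookup (Poly_Mapping.single 0 c * P) \<alpha> = 
     (\<Sum>\<beta>\<in>Poly_Mapping.keys P. if \<beta> = \<alpha> then c * Poly_Mapping.lookup P \<alpha> else 0)"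
    by (auto simp: lookup_sum lookup_single when_def intro!: sum.cong)
  then show ?thesis by (simp add: in_keys_iff)
qed

text \<open>Extend a basis of the subspace \<open>V\<close> by \<open>Q\<close> and take the coordinate of \<open>Q\<close>. A linear functional on operators is
recorded by its values \<open>x \<alpha>\<close> on the \<open>\<partial>\<^sup>\<alpha>\<close>.\<close>

lemma separating_functional:
  fixes V :: "('i, 'k::field) dop set"
  assumes "0 \<in> V" "\<And>P R. P \<in> V \<Longrightarrow> R \<in> V \<Longrightarrow> P + R \<in> V"
    and "\<And>c P. P \<in> V \<Longrightarrow> Poly_Mapping.single 0 c * P \<in> V" and "Q \<notin> V"
  obtains x where "\<And>P. P \<in> V \<Longrightarrow> pm_eval (\<lambda>c. c) x P = 0" "pm_eval (\<lambda>c. c) x Q \<noteq> 0"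
proof -
  let ?s = "\<lambda>c (P :: ('i, 'k) dop). Poly_Mapping.single 0 c * P"
  interpret vs: vector_space ?s by (rule vector_space_dop)
  interpret vector_space_pair ?s "(*) :: 'k \<Rightarrow> 'k \<Rightarrow> 'k"
    by standard (simp_all add: algebra_simps)
  have sub: "vs.subspace V" using assms by (simp add: vs.subspace_def)
  obtain B where B: "B \<subseteq> V" "vs.independent B" "V \<subseteq> vs.span B"
    by (rule vs.maximal_independent_subset)
  have "vs.span B \<subseteq> V" by (rule vs.span_minimal[OF B(1) sub])
  then have "vs.independent (insert Q B)" using B(2) assms(4) by (intro vs.independent_insertI) auto
  then obtain g where g: "Vector_Spaces.linear ?s (*) g" "\<forall>P\<in>insert Q B. g P = (if P = Q then 1 else 0)"
    using linear_independent_extend[of "insert Q B" "\<lambda>P. if P = Q then 1 else 0"] by blast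
  interpret g: Vector_Spaces.linear ?s "(*)" g by (rule g(1))
  have ev: "pm_eval (\<lambda>c. c) (\<lambda>\<alpha>. g (Poly_Mapping.single \<alpha> 1)) P = g P" for P
  proof -
    have "g P = g (\<Sum>\<alpha>\<in>Poly_Mapping.keys P. Poly_Mapping.single 0 (Poly_Mapping.lookup P \<alpha>) * Poly_Mapping.single \<alpha> 1)"
      by (simp add: mult_single sum_single_lookup)
    also have "\<dots> = pm_eval (\<lambda>c. c) (\<lambda>\<alpha>. g (Poly_Mapping.single \<alpha> 1)) P"
      by (simp only: g.sum g.scale pm_eval_def)
    finally show ?thesis ..
  qed
  show ?thesis
  proof (rule that)
    fix P assume "P \<in> V"
    then have "P \<in> vs.span B" using B(3) by auto
    moreover have "g R = 0" if "R \<in> B" for R using that B(1) assms(4) g(2) by auto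
    ultimately have "g P = 0" by (rule g.eq_0_on_span[rotated])
    then show "pm_eval (\<lambda>c. c) (\<lambda>\<alpha>. g (Poly_Mapping.single \<alpha> 1)) P = 0" by (simp add: ev)
  next
    show "pm_eval (\<lambda>c. c) (\<lambda>\<alpha>. g (Poly_Mapping.single \<alpha> 1)) Q \<noteq> 0" using g(2) by (simp add: ev)
  qed
qed

definition pd :: "'i \<Rightarrow> ('i, 'k::zero_neq_one) dop" where
  "pd i = Poly_Mapping.single (unit_index i) 1"

definition linear_form :: "('i, 'k::comm_ring_1) dop \<Rightarrow> ('i, 'k) dpoly" where
  "linear_form P = (\<Sum>\<alpha>\<in>Poly_Mapping.keys P. Poly_Mapping.single (Poly_Mapping.single (0, \<alpha>) 1) (Poly_Mapping.lookup P \<alpha>))"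

lemma mpoly_eval_linear_form: "mpoly_eval x (linear_form P) = pm_eval (\<lambda>c. c) (\<lambda>\<alpha>. x (0, \<alpha>)) P"
  unfolding linear_form_def id_additive.pm_eval_sum
  by (simp add: id_additive.pm_eval_single) (simp add: pm_eval_def)

text \<open>The points at which all linear forms coming from \<open>V\<close> vanish. Only the unknown \<open>y\<^sub>0\<close> is constrained; the
values at the other unknowns are arbitrary.\<close>

definition annihilator :: "('i, 'k::comm_ring_1) dop set \<Rightarrow> (nat \<times> ('i \<Rightarrow> nat) \<Rightarrow> 'k) set" where
  "annihilator V = {x. \<forall>P\<in>V. pm_eval (\<lambda>c. c) (\<lambda>\<alpha>. x (0, \<alpha>)) P = 0}"

definition vanishing :: "('i, 'k::comm_ring_1) dop set \<Rightarrow> ('i, 'k) dpoly set" where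
  "vanishing V = {f. \<forall>x\<in>annihilator V. mpoly_eval x f = 0}"

lemma annihilator_line:
  assumes "x \<in> annihilator V" "y \<in> annihilator V"
  shows "(\<lambda>v. x v + s * y v) \<in> annihilator V"
proof -
  have "pm_eval (\<lambda>c. c) (\<lambda>\<alpha>. x (0, \<alpha>) + s * y (0, \<alpha>)) P
     = pm_eval (\<lambda>c. c) (\<lambda>\<alpha>. x (0, \<alpha>)) P + s * pm_eval (\<lambda>c. c) (\<lambda>\<alpha>. y (0, \<alpha>)) P" for P
    by (simp add: pm_eval_def algebra_simps sum.distrib sum_distrib_left)
  with assms show ?thesis by (simp add: annihilator_def)
qed

context differential_field
begin

lemma fn_op_dmult: "fn_op c \<star>\<^bsub>d\<^esub> P = Poly_Mapping.single 0 c * P"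
proof (cases "c = 0")
  case False
  have b: "{\<gamma>. \<forall>i. \<gamma> i \<le> (0::'i \<Rightarrow> nat) i} = {0}" by (auto simp: fun_eq_iff pointwise)
  have "mchoose (0 :: 'i \<Rightarrow> nat) 0 = 1" by (simp add: mchoose_def pointwise)
  moreover have "(0::'i \<Rightarrow> nat) - 0 = 0" by (simp add: fun_eq_iff pointwise)
  ultimately have "fn_op c \<star>\<^bsub>d\<^esub> P = (\<Sum>\<beta>\<in>Poly_Mapping.keys P. Poly_Mapping.single \<beta> (c * Poly_Mapping.lookup P \<beta>))"
    unfolding dmult_alt fn_op_def zero_fun_def[symmetric] using False by (simp add: b del: le_zero_eq)
  also have "\<dots> = Poly_Mapping.single 0 c * P"
    by (subst (3) sum_single_lookup[of P, symmetric]) (simp add: sum_distrib_left mult_single)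
  finally show ?thesis .
qed (simp add: fn_op_def)

lemma pd_dmult: "pd i \<star>\<^bsub>d\<^esub> P = (\<Sum>\<alpha>\<in>Poly_Mapping.keys P.
    Poly_Mapping.single \<alpha> (d i (Poly_Mapping.lookup P \<alpha>)) + Poly_Mapping.single (\<alpha> + unit_index i) (Poly_Mapping.lookup P \<alpha>))"
proof -
  have b: "{\<gamma>. \<forall>j. \<gamma> j \<le> unit_index i j} = {0, unit_index i}"
  proof (intro equalityI subsetI)
    fix \<gamma> assume g: "\<gamma> \<in> {\<gamma>. \<forall>j. \<gamma> j \<le> unit_index i j}"
    then have "\<gamma> j = 0" if "j \<noteq> i" for j using that by (metis le_zero_eq mem_Collect_eq unit_index_apply(2))
    moreover have "\<gamma> i = 0 \<or> \<gamma> i = 1" using g by (metis le_zero_eq mem_Collect_eq unit_index_apply(1) le_Suc_eq One_nat_def)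
    ultimately have "\<gamma> = 0 \<or> \<gamma> = unit_index i" unfolding fun_eq_iff by (metis unit_index_apply zero_fun_apply)
    then show "\<gamma> \<in> {0, unit_index i}" by auto
  qed (auto simp: pointwise)
  have ne: "0 \<noteq> unit_index i" by (metis mdeg_unit_index mdeg_zero zero_neq_one)
  have "mchoose (unit_index i) 0 = 1" "mchoose (unit_index i) (unit_index i) = 1" by (simp_all add: mchoose_def pointwise)
  moreover have "unit_index i - 0 = unit_index i" "unit_index i - unit_index i = 0" by (simp_all add: fun_eq_iff pointwise)
  ultimately show ?thesis
    unfolding dmult_alt pd_def using ne by (simp add: b add.commute)
qed

lemma pm_eval_pd_dmult: "pm_eval (\<lambda>c. c) x (pd i \<star>\<^bsub>d\<^esub> P) =
    (\<Sum>\<alpha>\<in>Poly_Mapping.keys P. d i (Poly_Mapping.lookup P \<alpha>) * x \<alpha> + Poly_Mapping.lookup P \<alpha> * x (\<alpha> + unit_index i))"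
  by (simp add: pd_dmult id_additive.pm_eval_sum id_additive.pm_eval_add id_additive.pm_eval_single)

lemma d_derivation: "derivation_map (d i)"
  by standard (rule d_mult)

text \<open>Differentiating the value \<open>f(x)\<close> differentiates the coefficients of \<open>f\<close> and moves the point with
velocity \<open>d i (x v)\<close>, whereas the derivation of differential polynomials moves the variable \<open>\<partial>\<^sup>\<alpha> y\<^sub>k\<close> to
\<open>\<partial>\<^sub>i \<partial>\<^sup>\<alpha> y\<^sub>k\<close>. The difference is a directional derivative of \<open>f\<close> at \<open>x\<close>.\<close>

lemma mpoly_eval_dpoly_deriv:
  "mpoly_eval x (dpoly_deriv d i f) = d i (mpoly_eval x f) -
     poly (pderiv (line_poly x (\<lambda>v. d i (x v) - x (fst v, snd v + unit_index i)) f)) 0"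
proof -
  interpret derivation_map "d i" by (rule d_derivation)
  have s: "(snd v)(i := snd v i + 1) = snd v + unit_index i" for v :: "nat \<times> ('i \<Rightarrow> nat)"
    by (auto simp: fun_eq_iff pointwise unit_index_def)
  have "mpoly_eval x (dpoly_deriv d i f) = (\<Sum>m\<in>Poly_Mapping.keys f. d i (Poly_Mapping.lookup f m) * monom_eval x m +
     (\<Sum>v\<in>Poly_Mapping.keys m. of_nat (Poly_Mapping.lookup m v) * Poly_Mapping.lookup f m *
        (monom_eval x (m - Poly_Mapping.single v 1) * x (fst v, snd v + unit_index i))))"
    unfolding dpoly_deriv_def s
    by (simp add: id_additive.pm_eval_sum id_additive.pm_eval_add id_additive.pm_eval_single monom_eval_add)
  also have "\<dots> = d i (mpoly_eval x f) -
     poly (pderiv (line_poly x (\<lambda>v. d i (x v) - x (fst v, snd v + unit_index i)) f)) 0"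
    unfolding pderiv_line_poly pm_eval_def d_sum d_mult D_monom_eval sum_subtractf[symmetric]
  proof (rule sum.cong)
    fix m
    show "d i (Poly_Mapping.lookup f m) * monom_eval x m +
        (\<Sum>v\<in>Poly_Mapping.keys m. of_nat (Poly_Mapping.lookup m v) * Poly_Mapping.lookup f m *
          (monom_eval x (m - Poly_Mapping.single v 1) * x (fst v, snd v + unit_index i))) =
      d i (Poly_Mapping.lookup f m) * monom_eval x m +
        Poly_Mapping.lookup f m * (\<Sum>v\<in>Poly_Mapping.keys m.
          of_nat (Poly_Mapping.lookup m v) * monom_eval x (m - Poly_Mapping.single v 1) * d i (x v)) -
        Poly_Mapping.lookup f m * (\<Sum>v\<in>Poly_Mapping.keys m.
          of_nat (Poly_Mapping.lookup m v) * monom_eval x (m - Poly_Mapping.single v 1) *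
            (d i (x v) - x (fst v, snd v + unit_index i)))"
      by (simp add: right_diff_distrib sum_subtractf sum_distrib_left ac_simps)
  qed simp
  finally show ?thesis .
qed

text \<open>The polynomials vanishing on a linear subspace form a prime ideal: two points at which the respective
factors do not vanish are joined by a line inside the subspace, on which the product is a nonzero
univariate polynomial. The ideal is differential because the velocity
\<open>y v = d i (x v) - x (\<partial>\<^sub>i v)\<close> is again a point of the subspace, as \<open>V\<close> is closed under left
multiplication by \<open>\<partial>\<^sub>i\<close>; so the directional derivative above vanishes.\<close>

lemma prime_differential_ideal_vanishing:
  assumes V: "\<And>i P. P \<in> V \<Longrightarrow> pd i \<star>\<^bsub>d\<^esub> P \<in> V"
  shows "prime_differential_ideal d (vanishing V)"
  unfolding prime_differential_ideal_def
proof (intro conjI ballI allI impI)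
  show "0 \<in> vanishing V" by (simp add: vanishing_def)
  show "f + g \<in> vanishing V" if "f \<in> vanishing V" "g \<in> vanishing V" for f g
    using that by (simp add: vanishing_def id_additive.pm_eval_add)
  show "g * f \<in> vanishing V" if "f \<in> vanishing V" for f g
    using that by (simp add: vanishing_def mpoly_eval_mult)
  have "(\<lambda>_. 0) \<in> annihilator V" by (simp add: annihilator_def pm_eval_def)
  moreover have "mpoly_eval x 1 = 1" for x :: "nat \<times> ('i \<Rightarrow> nat) \<Rightarrow> 'k"
    by (simp flip: single_one add: id_additive.pm_eval_single)
  ultimately show "1 \<notin> vanishing V" by (auto simp: vanishing_def)
  show "f \<in> vanishing V \<or> g \<in> vanishing V" if fg: "f * g \<in> vanishing V" for f g
  proof (rule ccontr)
    assume "\<not> ?thesis"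
    then obtain x y where x: "x \<in> annihilator V" "mpoly_eval x f \<noteq> 0"
      and y: "y \<in> annihilator V" "mpoly_eval y g \<noteq> 0" by (auto simp: vanishing_def)
    \<comment> \<open>direction from \<open>x\<close> to \<open>y\<close>, so that \<open>s = 0\<close> is \<open>x\<close> and \<open>s = 1\<close> is \<open>y\<close>\<close>
    define z where "z = (\<lambda>v. y v + (-1) * x v)"
    have z: "z \<in> annihilator V" unfolding z_def by (rule annihilator_line[OF y(1) x(1)])
    have "poly (line_poly x z f) 0 \<noteq> 0" "poly (line_poly x z g) 1 \<noteq> 0"
      using x y by (simp_all add: poly_line_poly z_def)
    then have "line_poly x z f * line_poly x z g \<noteq> 0" by auto
    then obtain s where "poly (line_poly x z f * line_poly x z g) s \<noteq> 0"
      using poly_all_0_iff_0 by blast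
    then have "mpoly_eval (\<lambda>v. x v + s * z v) (f * g) \<noteq> 0"
      by (simp add: poly_line_poly mpoly_eval_mult)
    with fg annihilator_line[OF x(1) z, of s] show False by (auto simp: vanishing_def)
  qed
  show "dpoly_deriv d i f \<in> vanishing V" if f: "f \<in> vanishing V" for f i
    unfolding vanishing_def
  proof safe
    fix x assume x: "x \<in> annihilator V"
    define y where "y = (\<lambda>v. d i (x v) - x (fst v, snd v + unit_index i))"
    have "y \<in> annihilator V"
      unfolding annihilator_def
    proof safe
      fix P assume P: "P \<in> V"
      have "pm_eval (\<lambda>c. c) (\<lambda>\<alpha>. y (0, \<alpha>)) P
        = d i (pm_eval (\<lambda>c. c) (\<lambda>\<alpha>. x (0, \<alpha>)) P) - pm_eval (\<lambda>c. c) (\<lambda>\<alpha>. x (0, \<alpha>)) (pd i \<star>\<^bsub>d\<^esub> P)"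
        unfolding pm_eval_pd_dmult
        unfolding pm_eval_def y_def d_sum d_mult sum_subtractf[symmetric]
        by (rule sum.cong) (simp_all add: algebra_simps)
      then show "pm_eval (\<lambda>c. c) (\<lambda>\<alpha>. y (0, \<alpha>)) P = 0"
        using x P V[OF P] by (simp add: annihilator_def)
    qed
    then have "poly (line_poly x y f) s = 0" for s
      using f annihilator_line[OF x] by (simp add: poly_line_poly vanishing_def)
    then have "line_poly x y f = 0" using poly_all_0_iff_0 by blast
    then show "mpoly_eval x (dpoly_deriv d i f) = 0"
      using f x by (simp add: mpoly_eval_dpoly_deriv vanishing_def flip: y_def)
  qed
qed

lemma dpoly_eval_linear_form: "dpoly_eval d u (linear_form P) = dapply d P (u 0)"
proof -
  have "dpoly_eval d u f = mpoly_eval (\<lambda>v. dpow d (snd v) (u (fst v))) f" for f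
    by (simp add: dpoly_eval_def pm_eval_def monom_eval_def)
  then show ?thesis by (simp add: mpoly_eval_linear_form dapply_pm_eval)
qed

text \<open>A subspace \<open>V\<close> closed under left multiplication is treated as a set of linear differential equations;
the vanishing ideal of its annihilator contains no linear form outside \<open>V\<close>. This is stated for abstract \<open>V\<close>
because it is needed for \<open>V = 0\<close> first: the ring laws behind left ideals rest on faithfulness.\<close>

lemma differentially_closed_solution:
  assumes dc: "differentially_closed d"
    and V: "0 \<in> V" "\<And>P R. P \<in> V \<Longrightarrow> R \<in> V \<Longrightarrow> P + R \<in> V"
      "\<And>c P. P \<in> V \<Longrightarrow> fn_op c \<star>\<^bsub>d\<^esub> P \<in> V" "\<And>i P. P \<in> V \<Longrightarrow> pd i \<star>\<^bsub>d\<^esub> P \<in> V"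
    and S: "finite S" "S \<subseteq> V" and Q: "Q \<notin> V"
  shows "\<exists>u. (\<forall>P\<in>S. dapply d P u = 0) \<and> dapply d Q u \<noteq> 0"
proof -
  obtain x where x: "\<And>P. P \<in> V \<Longrightarrow> pm_eval (\<lambda>c. c) x P = 0" "pm_eval (\<lambda>c. c) x Q \<noteq> 0"
    by (rule separating_functional[of V Q]) (use V Q in \<open>auto simp: fn_op_dmult\<close>)
  have "(\<lambda>v. x (snd v)) \<in> annihilator V" using x(1) by (simp add: annihilator_def)
  then have "linear_form Q \<notin> vanishing V"
    using x(2) by (force simp: vanishing_def mpoly_eval_linear_form)
  moreover have "linear_form ` S \<subseteq> vanishing V"
    using S(2) by (auto simp: vanishing_def mpoly_eval_linear_form annihilator_def)
  moreover have "prime_differential_ideal d (vanishing V)"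
    by (rule prime_differential_ideal_vanishing) (rule V(4))
  ultimately obtain u where "\<forall>f\<in>linear_form ` S. dpoly_eval d u f = 0" "dpoly_eval d u (linear_form Q) \<noteq> 0"
    using dc S(1) unfolding differentially_closed_def by (meson finite_imageI)
  then show ?thesis by (intro exI[of _ "u 0"]) (simp add: dpoly_eval_linear_form)
qed

end

section \<open>The ring of operators\<close>

context differential_field
begin

lemma dapply_of_sum: "dapply d A (\<Sum>x\<in>S. u x) = (\<Sum>x\<in>S. dapply d A (u x))"
  by (induction S rule: infinite_finite_induct) (simp_all add: dapply_plus)

lemma dapply_of_uminus: "dapply d A (- u) = - dapply d A u"
  using dapply_plus[of A u "- u"] by (simp add: add_eq_0_iff)

lemma dapply_of_diff: "dapply d A (u - v) = dapply d A u - dapply d A v"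
  using dapply_plus[of A u "- v"] by (simp add: dapply_of_uminus)

lemma dapply_pd [simp]: "dapply d (pd i) u = d i u"
  by (simp add: pd_def dapply_single)

lemmas dapply_simps = dapply_add dapply_diff dapply_uminus dapply_sum
  dapply_plus dapply_of_diff dapply_of_uminus dapply_of_sum

end

text \<open>The derivations of an arbitrary differential field may satisfy linear relations (all of them may be zero),
while operators are formal. Faithfulness of the action excludes this and makes the ring laws for
\<open>\<star>\<close> consequences of those for composition.\<close>

locale faithful_field = differential_field d for d :: "'i::finite \<Rightarrow> 'k::field_char_0 \<Rightarrow> 'k" +
  assumes faithful: "(\<And>u. dapply d L u = 0) \<Longrightarrow> L = 0"
begin

lemma op_eqI: "(\<And>u. dapply d A u = dapply d B u) \<Longrightarrow> A = B"
  using faithful[of "A - B"] by (simp add: dapply_diff)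

lemma dmult_assoc: "A \<star>\<^bsub>d\<^esub> B \<star>\<^bsub>d\<^esub> C = A \<star>\<^bsub>d\<^esub> (B \<star>\<^bsub>d\<^esub> C)"
  by (rule op_eqI) simp

lemma dmult_add_left: "(A + B) \<star>\<^bsub>d\<^esub> C = A \<star>\<^bsub>d\<^esub> C + B \<star>\<^bsub>d\<^esub> C"
  by (rule op_eqI) (simp add: dapply_simps)

lemma dmult_diff_left: "(A - B) \<star>\<^bsub>d\<^esub> C = A \<star>\<^bsub>d\<^esub> C - B \<star>\<^bsub>d\<^esub> C"
  by (rule op_eqI) (simp add: dapply_simps)

lemma dmult_add_right: "A \<star>\<^bsub>d\<^esub> (B + C) = A \<star>\<^bsub>d\<^esub> B + A \<star>\<^bsub>d\<^esub> C"
  by (rule op_eqI) (simp add: dapply_simps)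

lemma dmult_cancel: "A \<star>\<^bsub>d\<^esub> C = B \<star>\<^bsub>d\<^esub> C \<Longrightarrow> C \<noteq> 0 \<Longrightarrow> A = B"
  using dmult_nonzero[of "A - B" C] by (auto simp: dmult_diff_left)

lemma left_ideal_closed:
  fixes S defines "V \<equiv> {Q. \<exists>A. Q = (\<Sum>P\<in>S. A P \<star>\<^bsub>d\<^esub> P)}"
  assumes "P \<in> V"
  shows "B \<star>\<^bsub>d\<^esub> P \<in> V" and "R \<in> V \<Longrightarrow> P + R \<in> V"
proof -
  obtain A where A: "P = (\<Sum>P\<in>S. A P \<star>\<^bsub>d\<^esub> P)" using assms(2) by (auto simp: V_def)
  have "B \<star>\<^bsub>d\<^esub> P = (\<Sum>P\<in>S. (B \<star>\<^bsub>d\<^esub> A P) \<star>\<^bsub>d\<^esub> P)"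
    unfolding A by (rule op_eqI) (simp add: dapply_simps)
  then show "B \<star>\<^bsub>d\<^esub> P \<in> V"
    unfolding V_def by (intro CollectI exI[of _ "\<lambda>R. B \<star>\<^bsub>d\<^esub> A R"])
  show "P + R \<in> V" if R: "R \<in> V"
  proof -
    obtain A' where A': "R = (\<Sum>P\<in>S. A' P \<star>\<^bsub>d\<^esub> P)" using R by (auto simp: V_def)
    have "P + R = (\<Sum>P\<in>S. (A P + A' P) \<star>\<^bsub>d\<^esub> P)"
      unfolding A A' by (simp add: dmult_add_left sum.distrib)
    then show ?thesis unfolding V_def by (intro CollectI exI[of _ "\<lambda>P. A P + A' P"])
  qed
qed

end

context differential_field
begin

lemma faithful_if_linear_solutions: "contains_linear_solutions d \<Longrightarrow> faithful_field d"
proof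
  fix L assume *: "contains_linear_solutions d" and L: "\<And>u. dapply d L u = 0"
  show "L = 0"
  proof (rule ccontr)
    assume "L \<noteq> 0"
    then have "\<nexists>A. L = (\<Sum>P\<in>{}. A P \<star>\<^bsub>d\<^esub> P)" by simp
    then have "\<exists>u. (\<forall>P\<in>{}. dapply d P u = 0) \<and> dapply d L u \<noteq> 0"
      using *[unfolded contains_linear_solutions_def, THEN spec[of _ "{}"], THEN spec[of _ L]] by blast
    with L show False by auto
  qed
qed

lemma faithful_if_differentially_closed: "differentially_closed d \<Longrightarrow> faithful_field d"
proof
  fix L assume *: "differentially_closed d" and L: "\<And>u. dapply d L u = 0"
  show "L = 0"
  proof (rule ccontr)
    assume "L \<noteq> 0"
    then have "\<exists>u. (\<forall>P\<in>{}. dapply d P u = 0) \<and> dapply d L u \<noteq> 0"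
      by (intro differentially_closed_solution[OF *, of "{0}"]) auto
    with L show False by auto
  qed
qed

lemma contains_linear_solutions_if_differentially_closed:
  assumes "differentially_closed d"
  shows "contains_linear_solutions d"
  unfolding contains_linear_solutions_def
proof (intro allI impI)
  fix S Q assume S: "finite S" and Q: "\<nexists>A. Q = (\<Sum>P\<in>S. A P \<star>\<^bsub>d\<^esub> P)"
  interpret faithful_field d by (rule faithful_if_differentially_closed) (rule assms)
  let ?V = "{Q. \<exists>A. Q = (\<Sum>P\<in>S. A P \<star>\<^bsub>d\<^esub> P)}"
  show "\<exists>u. (\<forall>P\<in>S. dapply d P u = 0) \<and> dapply d Q u \<noteq> 0"
  proof (rule differentially_closed_solution[OF assms, of ?V])
    show "0 \<in> ?V" by (auto intro!: exI[of _ "\<lambda>_. 0"])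
    show "S \<subseteq> ?V"
    proof
      fix R assume R: "R \<in> S"
      have "(\<Sum>P\<in>S. (if P = R then fn_op 1 else 0) \<star>\<^bsub>d\<^esub> P) = (\<Sum>P\<in>S. if P = R then fn_op 1 \<star>\<^bsub>d\<^esub> P else 0)"
        by (rule sum.cong) auto
      also have "\<dots> = R" using S R by (simp add: fn_op_dmult)
      finally show "R \<in> ?V" by (auto intro!: exI[of _ "\<lambda>P. if P = R then fn_op 1 else 0"])
    qed
  qed (use S Q left_ideal_closed[of _ S] in auto)
qed

end

section \<open>Operators of order at most one\<close>

definition vector_field_op :: "('i::finite \<Rightarrow> 'k::comm_ring_1) \<Rightarrow> ('i, 'k) dop" where
  "vector_field_op a = (\<Sum>i\<in>UNIV. Poly_Mapping.single (unit_index i) (a i))"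

lemma unit_index_eq_iff [simp]: "unit_index i = unit_index j \<longleftrightarrow> i = j"
  by (metis unit_index_apply zero_neq_one)

lemma unit_index_nonzero [simp]: "unit_index i \<noteq> 0"
  by (metis unit_index_apply(1) zero_fun_apply zero_neq_one)

lemma lookup_vector_field_op: "Poly_Mapping.lookup (vector_field_op a) (unit_index i) = a i"
  by (simp add: vector_field_op_def lookup_sum lookup_single when_def)

lemma vector_field_op_eq_0_iff: "vector_field_op a = 0 \<longleftrightarrow> (\<forall>i. a i = 0)"
proof
  assume "vector_field_op a = 0"
  then show "\<forall>i. a i = 0" by (metis lookup_vector_field_op lookup_zero)
qed (simp add: vector_field_op_def)

lemma keys_vector_field_op: "\<alpha> \<in> Poly_Mapping.keys (vector_field_op a) \<Longrightarrow> mdeg \<alpha> = 1"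
proof (rule ccontr)
  assume "\<alpha> \<in> Poly_Mapping.keys (vector_field_op a)" "mdeg \<alpha> \<noteq> 1"
  moreover from this have "unit_index x \<noteq> \<alpha>" for x by auto
  ultimately show False
    by (simp add: in_keys_iff vector_field_op_def lookup_sum lookup_single when_def)
qed

lemma fn_op_alt: "fn_op f = Poly_Mapping.single 0 f"
  by (simp add: fn_op_def zero_fun_def)

lemma lookup_fn_op: "Poly_Mapping.lookup (fn_op f) \<alpha> = (if \<alpha> = 0 then f else 0)"
  by (simp add: fn_op_alt lookup_single when_def)

lemma fn_op_zero [simp]: "fn_op 0 = 0"
  and fn_op_diff: "fn_op (f - g) = fn_op f - fn_op (g :: 'k::ab_group_add)"
  by (simp_all add: fn_op_alt single_diff)

lemma fn_op_eq_0_iff [simp]: "fn_op f = 0 \<longleftrightarrow> f = 0"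
  by (metis fn_op_zero lookup_fn_op lookup_zero)

lemma deg_less_fn_op: "deg_less 1 (fn_op f)"
  by (auto simp: fn_op_alt intro: deg_less_single)

lemma ord_fn_op [simp]: "ord (fn_op f :: ('i::finite, 'k::zero) dop) = 0"
proof (cases "fn_op f = (0 :: ('i, 'k) dop)")
  case False
  then obtain \<alpha> where "\<alpha> \<in> Poly_Mapping.keys (fn_op f :: ('i, 'k) dop)" "mdeg \<alpha> = ord (fn_op f :: ('i, 'k) dop)"
    using ord_attained by blast
  then show ?thesis by (auto simp: in_keys_iff lookup_fn_op split: if_splits)
qed (simp add: ord_def)

lemma ord_0_fn: "ord L = 0 \<Longrightarrow> L = fn_op (Poly_Mapping.lookup L 0)"
proof (rule poly_mapping_eqI)
  fix \<alpha> assume o: "ord L = 0"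
  show "Poly_Mapping.lookup L \<alpha> = Poly_Mapping.lookup (fn_op (Poly_Mapping.lookup L 0)) \<alpha>"
    using mdeg_le_ord[of \<alpha> L] by (auto simp: lookup_fn_op o in_keys_iff)
qed

lemma
  fixes a :: "'i::finite \<Rightarrow> 'k::comm_ring_1"
  assumes "\<exists>i. a i \<noteq> 0"
  shows top_part_vector_field_op: "top_part (vector_field_op a + fn_op m) = vector_field_op a" and ord_vector_field_op: "ord (vector_field_op a + fn_op m) = 1"
proof -
  have "vector_field_op a \<noteq> 0" using assms by (simp add: vector_field_op_eq_0_iff)
  from ord_top_part_unique[OF refl this _ deg_less_fn_op] keys_vector_field_op
  show "top_part (vector_field_op a + fn_op m) = vector_field_op a" "ord (vector_field_op a + fn_op m) = 1" by blast+
qed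

lemma ord_le_1_decompose:
  fixes L :: "('i::finite, 'k::comm_ring_1) dop"
  assumes "ord L \<le> 1"
  shows "L = vector_field_op (\<lambda>i. Poly_Mapping.lookup L (unit_index i)) + fn_op (Poly_Mapping.lookup L 0)"
proof (rule poly_mapping_eqI)
  fix \<alpha> :: "'i \<Rightarrow> nat"
  let ?a = "\<lambda>i. Poly_Mapping.lookup L (unit_index i)"
  consider "mdeg \<alpha> = 0" | "mdeg \<alpha> = 1" | "mdeg \<alpha> > 1" by linarith
  then show "Poly_Mapping.lookup L \<alpha> = Poly_Mapping.lookup (vector_field_op ?a + fn_op (Poly_Mapping.lookup L 0)) \<alpha>"
  proof cases
    case 1
    then have "\<alpha> = 0" by simp
    moreover have "0 \<notin> Poly_Mapping.keys (vector_field_op ?a)" using keys_vector_field_op by fastforce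
    ultimately show ?thesis by (simp add: lookup_add lookup_fn_op in_keys_iff)
  next
    case 2
    then obtain i where "\<alpha> = unit_index i" by (rule mdeg_1_cases)
    then show ?thesis by (simp add: lookup_add lookup_fn_op lookup_vector_field_op)
  next
    case 3
    then have "\<alpha> \<notin> Poly_Mapping.keys L" "\<alpha> \<notin> Poly_Mapping.keys (vector_field_op ?a)" "\<alpha> \<noteq> 0"
      using assms mdeg_le_ord[of \<alpha> L] keys_vector_field_op[of \<alpha> ?a] by auto
    then show ?thesis by (simp add: lookup_add lookup_fn_op in_keys_iff)
  qed
qed

lemma ord_1E:
  fixes L :: "('i::finite, 'k::comm_ring_1) dop"
  assumes "ord L = 1"
  obtains a m where "L = vector_field_op a + fn_op m" "\<exists>i. a i \<noteq> 0"
proof -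
  let ?a = "\<lambda>i. Poly_Mapping.lookup L (unit_index i)"
  have L: "L = vector_field_op ?a + fn_op (Poly_Mapping.lookup L 0)" by (rule ord_le_1_decompose) (use assms in simp)
  have "\<exists>i. ?a i \<noteq> 0"
  proof (rule ccontr)
    assume "\<not> ?thesis"
    then have "vector_field_op ?a = 0" by (simp add: vector_field_op_eq_0_iff)
    with L have "L = fn_op (Poly_Mapping.lookup L 0)" by simp
    then have "ord L = 0" by (metis ord_fn_op)
    with assms show False by simp
  qed
  with L show ?thesis by (rule that)
qed

lemma (in differential_field) dapply_vector_field_op: "dapply d (vector_field_op a) u = (\<Sum>i\<in>UNIV. a i * d i u)"
  by (simp add: vector_field_op_def dapply_sum dapply_single)

section \<open>Dual families of vectors\<close>

text \<open>The pairing of a vector field with a differential; vectors \<open>b\<close> stand for derivations and \<open>g\<close> for gradients.\<close>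

definition pair :: "('i::finite \<Rightarrow> 'k::field) \<Rightarrow> ('i \<Rightarrow> 'k) \<Rightarrow> 'k" where
  "pair b g = (\<Sum>i\<in>UNIV. b i * g i)"

lemma pair_add: "pair (b + c) g = pair b g + pair c g"
  by (simp add: pair_def pointwise distrib_right sum.distrib)

lemma pair_scale: "pair (\<lambda>i. s * b i) g = s * pair b g"
  by (simp add: pair_def sum_distrib_left mult.assoc)

lemma pair_zero: "pair 0 g = 0"
  by (simp add: pair_def pointwise)

lemma pair_diff: "pair (b - c) g = pair b g - pair c g"
  by (simp add: pair_def pointwise left_diff_distrib sum_subtractf)

lemma pair_sum: "pair (\<Sum>x\<in>S. b x) g = (\<Sum>x\<in>S. pair (b x) g)"
  by (induction S rule: infinite_finite_induct) (simp_all add: pair_add pair_zero)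

definition basis_vec :: "'i \<Rightarrow> 'i \<Rightarrow> 'k::field" where
  "basis_vec i = (\<lambda>j. if j = i then 1 else 0)"

lemma pair_basis_vec: "pair (basis_vec i) g = g i"
  by (simp add: pair_def basis_vec_def if_distrib if_distribR cong: if_cong)

interpretation fun_vs: vector_space "\<lambda>s (f :: 'i \<Rightarrow> 'k::field) i. s * f i"
  by standard (simp_all add: fun_eq_iff pointwise algebra_simps)

lemma independent_dual:
  fixes A :: "'l \<Rightarrow> 'i::finite \<Rightarrow> 'k::field"
  assumes "\<And>k l. k \<in> T \<Longrightarrow> l \<in> T \<Longrightarrow> pair (A k) (g l) = (if k = l then 1 else 0)"
  shows "inj_on A T" "fun_vs.independent (A ` T)"
proof -
  show inj: "inj_on A T"
  proof (rule inj_onI)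
    fix k l assume a: "k \<in> T" "l \<in> T" "A k = A l"
    then have "pair (A l) (g k) = 1" using assms[OF a(1) a(1)] by simp
    then show "k = l" using assms[OF a(2) a(1)] by (auto split: if_splits)
  qed
  show "fun_vs.independent (A ` T)"
    unfolding fun_vs.dependent_def
  proof safe
    fix k assume k: "k \<in> T" and sp: "A k \<in> fun_vs.span (A ` T - {A k})"
    have "pair b (g k) = 0" if "b \<in> fun_vs.span (A ` T - {A k})" for b
      using that
    proof (induction rule: fun_vs.span_induct)
      case base
      show ?case by (rule fun_vs.subspaceI) (simp_all add: pair_zero pair_add pair_scale)
    next
      case (step b)
      then obtain l where "l \<in> T" "l \<noteq> k" "b = A l" by auto
      with k assms show ?case by simp
    qed
    from this[OF sp] assms[OF k k] show False by simp
  qed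
qed

lemma basis_vec_dual: "pair (basis_vec k) (basis_vec l) = (if k = l then 1 else 0)"
  by (simp only: pair_basis_vec) (simp add: basis_vec_def)

lemma basis_vec_span: "b \<in> fun_vs.span (range (basis_vec :: 'i::finite \<Rightarrow> 'i \<Rightarrow> 'k::field))"
proof -
  have "b = (\<Sum>i\<in>UNIV. (\<lambda>j. b i * basis_vec i j))"
  proof
    fix j
    have "(\<Sum>i\<in>S. (\<lambda>j. b i * basis_vec i j)) j = (\<Sum>i\<in>S. b i * basis_vec i j)" for S :: "'i set"
      by (induction S rule: infinite_finite_induct) (simp_all add: pointwise)
    then show "b j = (\<Sum>i\<in>UNIV. (\<lambda>j. b i * basis_vec i j)) j"
      by (simp add: basis_vec_def if_distrib cong: if_cong)
  qed
  also have "\<dots> \<in> fun_vs.span (range basis_vec)"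
    by (intro fun_vs.span_sum fun_vs.span_scale fun_vs.span_base) auto
  finally show ?thesis .
qed

text \<open>Subtracting from each basis vector its components along the \<open>A k\<close> gives vectors that are annihilated by all
\<open>g l\<close>. If all of them were zero, fewer than \<open>card UNIV\<close> vectors would span the space.\<close>

lemma dual_family_extend:
  fixes A g :: "'i::finite \<Rightarrow> 'i \<Rightarrow> 'k::field"
  assumes dual: "\<And>k l. k \<in> T \<Longrightarrow> l \<in> T \<Longrightarrow> pair (A k) (g l) = (if k = l then 1 else 0)"
    and T: "T \<noteq> UNIV"
  shows "\<exists>b. b \<noteq> 0 \<and> (\<forall>l\<in>T. pair b (g l) = 0)"
proof (rule ccontr)
  assume neg: "\<not> ?thesis"
  have "basis_vec i \<in> fun_vs.span (A ` T)" for i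
  proof -
    define b where "b = basis_vec i - (\<Sum>k\<in>T. (\<lambda>j. g k i * A k j))"
    have "pair b (g l) = 0" if l: "l \<in> T" for l
    proof -
      have "pair b (g l) = g l i - (\<Sum>k\<in>T. g k i * pair (A k) (g l))"
        by (simp add: b_def pair_diff pair_basis_vec pair_sum pair_scale)
      also have "(\<Sum>k\<in>T. g k i * pair (A k) (g l)) = (\<Sum>k\<in>T. if k = l then g l i else 0)"
        by (rule sum.cong) (use dual l in auto)
      finally show ?thesis using l by simp
    qed
    with neg have "b = 0" by blast
    then have "basis_vec i = (\<Sum>k\<in>T. (\<lambda>j. g k i * A k j))" by (simp add: b_def)
    also have "\<dots> \<in> fun_vs.span (A ` T)"
      by (intro fun_vs.span_sum fun_vs.span_scale fun_vs.span_base) auto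
    finally show ?thesis .
  qed
  then have "card (range (basis_vec :: 'i \<Rightarrow> 'i \<Rightarrow> 'k)) \<le> card (A ` T)"
    using fun_vs.independent_span_bound[of "A ` T" "range basis_vec"] independent_dual(2)[OF basis_vec_dual]
    by (metis finite image_subsetI finite_imageI)
  moreover have "card (range (basis_vec :: 'i \<Rightarrow> 'i \<Rightarrow> 'k)) = card (UNIV :: 'i set)"
    by (rule card_image) (rule independent_dual(1)[OF basis_vec_dual])
  moreover have "card (A ` T) \<le> card T" by (rule card_image_le) simp
  moreover have "card T < card (UNIV :: 'i set)" using T by (simp add: psubset_card_mono psubset_eq)
  ultimately show False by simp
qed

text \<open>A nonzero \<open>b\<close> annihilated by all \<open>g l\<close> would be independent of the \<open>A k\<close>, giving one independent vector more
than the dimension allows.\<close>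

lemma dual_family_separates:
  fixes A g :: "'i::finite \<Rightarrow> 'i \<Rightarrow> 'k::field"
  assumes dual: "\<And>k l. pair (A k) (g l) = (if k = l then 1 else 0)"
    and b: "\<And>l. pair b (g l) = 0"
  shows "b = 0"
proof -
  have ind: "inj A" "fun_vs.independent (range A)" using independent_dual[of UNIV A g] dual by auto
  have z: "x = 0" if "x \<in> fun_vs.span (range A)" "\<And>l. pair x (g l) = 0" for x
  proof -
    have "x = (\<Sum>k\<in>UNIV. (\<lambda>i. pair x (g k) * A k i))"
      using that(1)
    proof (induction rule: fun_vs.span_induct)
      case base
      show ?case
      proof (rule fun_vs.subspaceI)
        fix x y assume "x \<in> {x. x = (\<Sum>k\<in>UNIV. (\<lambda>i. pair x (g k) * A k i))}"
          "y \<in> {x. x = (\<Sum>k\<in>UNIV. (\<lambda>i. pair x (g k) * A k i))}"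
        then have "x + y = (\<Sum>k\<in>UNIV. (\<lambda>i. pair x (g k) * A k i)) + (\<Sum>k\<in>UNIV. (\<lambda>i. pair y (g k) * A k i))"
          by simp
        also have "\<dots> = (\<Sum>k\<in>UNIV. (\<lambda>i. pair (x + y) (g k) * A k i))"
        proof -
          have "(\<lambda>i. pair (x + y) (g k) * A k i) = (\<lambda>i. pair x (g k) * A k i) + (\<lambda>i. pair y (g k) * A k i)" for k
            by (simp add: fun_eq_iff pointwise pair_add distrib_right)
          then show ?thesis by (simp add: sum.distrib)
        qed
        finally show "x + y \<in> {x. x = (\<Sum>k\<in>UNIV. (\<lambda>i. pair x (g k) * A k i))}"
          unfolding mem_Collect_eq .
      next
        fix x c assume x: "x \<in> {x. x = (\<Sum>k\<in>UNIV. (\<lambda>i. pair x (g k) * A k i))}"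
        have "(\<lambda>i. c * x i) = (\<lambda>i. c * (\<Sum>k\<in>UNIV. (\<lambda>i. pair x (g k) * A k i)) i)" using x by auto
        also have "\<dots> = (\<Sum>k\<in>UNIV. (\<lambda>i. c * (pair x (g k) * A k i)))"
          by (rule fun_vs.scale_sum_right)
        also have "\<dots> = (\<Sum>k\<in>UNIV. (\<lambda>i. pair (\<lambda>i. c * x i) (g k) * A k i))"
          unfolding pair_scale mult.assoc ..
        finally show "(\<lambda>i. c * x i) \<in> {x. x = (\<Sum>k\<in>UNIV. (\<lambda>i. pair x (g k) * A k i))}"
          unfolding mem_Collect_eq .
      next
        show "0 \<in> {x. x = (\<Sum>k\<in>UNIV. (\<lambda>i. pair x (g k) * A k i))}"
          by (rule CollectI, rule sym, rule sum.neutral) (simp add: pair_zero fun_eq_iff pointwise)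
      qed
    next
      case (step x)
      then obtain k where "x = A k" by auto
      have "(\<Sum>l\<in>UNIV. (\<lambda>i. pair (A k) (g l) * A l i)) = (\<Sum>l\<in>UNIV. if l = k then A k else 0)"
        by (rule sum.cong) (auto simp: dual fun_eq_iff pointwise)
      with \<open>x = A k\<close> show ?case by simp
    qed
    also have "\<dots> = 0"
      by (rule sum.neutral) (simp add: that(2) fun_eq_iff pointwise)
    finally show ?thesis .
  qed
  show ?thesis
  proof (rule ccontr)
    assume "b \<noteq> 0"
    with z b have nb: "b \<notin> fun_vs.span (range A)" by blast
    then have ind': "fun_vs.independent (insert b (range A))" using ind by (simp add: fun_vs.independent_insertI)
    have sub: "insert b (range A) \<subseteq> fun_vs.span (range (basis_vec :: 'i \<Rightarrow> 'i \<Rightarrow> 'k))"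
      using basis_vec_span by blast
    have "card (insert b (range A)) \<le> card (range (basis_vec :: 'i \<Rightarrow> 'i \<Rightarrow> 'k))"
      by (rule fun_vs.independent_span_bound[OF finite_imageI[OF finite] ind' sub, THEN conjunct2])
    also have "\<dots> \<le> card (UNIV :: 'i set)" by (rule card_image_le) simp
    also have "card (insert b (range A)) = Suc (card (UNIV :: 'i set))"
    proof -
      have "b \<notin> range A" using nb fun_vs.span_base by blast
      then show ?thesis using ind(1) by (simp add: card_image)
    qed
    finally show False by simp
  qed
qed

section \<open>Straightening a vector field\<close>

locale linear_solution_field = faithful_field d for d :: "'i::finite \<Rightarrow> 'k::field_char_0 \<Rightarrow> 'k" +
  assumes linear_solutions: "contains_linear_solutions d"
begin

lemma solution:
  assumes "finite S" "\<And>A. Q \<noteq> (\<Sum>P\<in>S. A P \<star>\<^bsub>d\<^esub> P)"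
  obtains u where "\<And>P. P \<in> S \<Longrightarrow> dapply d P u = 0" "dapply d Q u \<noteq> 0"
proof -
  have "\<exists>u. (\<forall>P\<in>S. dapply d P u = 0) \<and> dapply d Q u \<noteq> 0"
    using linear_solutions[unfolded contains_linear_solutions_def, THEN spec[of _ S], THEN spec[of _ Q]] assms
    by blast
  then show ?thesis using that by blast
qed

lemma solution_single:
  assumes "\<And>A. Q \<noteq> A \<star>\<^bsub>d\<^esub> P"
  obtains u where "dapply d P u = 0" "dapply d Q u \<noteq> 0"
  by (rule solution[of "{P}" Q]) (use assms in auto)

text \<open>The equation \<open>X u = 1\<close> is inhomogeneous; it is replaced by \<open>\<partial>\<^sub>i X u = 0\<close> for all \<open>i\<close> together with
\<open>X u \<noteq> 0\<close>, after which the constant \<open>X u\<close> is divided out. The system is solvable because \<open>X\<close> is not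
in the left ideal of the \<open>\<partial>\<^sub>i X\<close>: cancelling \<open>X\<close> would write \<open>1\<close> as \<open>\<Sum> A\<^sub>i \<partial>\<^sub>i\<close>, which kills constants.\<close>

lemma vector_field_op_solution_one:
  assumes a: "\<exists>i. a i \<noteq> 0"
  obtains u where "(\<Sum>i\<in>UNIV. a i * d i u) = 1"
proof -
  let ?X = "vector_field_op a"
  let ?S = "range (\<lambda>i. pd i \<star>\<^bsub>d\<^esub> ?X)"
  have X: "?X \<noteq> 0" using a by (simp add: vector_field_op_eq_0_iff)
  define \<iota> where "\<iota> P = (SOME i. P = pd i \<star>\<^bsub>d\<^esub> ?X)" for P
  have \<iota>: "pd (\<iota> P) \<star>\<^bsub>d\<^esub> ?X = P" if "P \<in> ?S" for P
    by (rule sym, unfold \<iota>_def, rule someI_ex) (use that in auto)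
  have "?X \<noteq> (\<Sum>P\<in>?S. A P \<star>\<^bsub>d\<^esub> P)" for A
  proof
    assume eq: "?X = (\<Sum>P\<in>?S. A P \<star>\<^bsub>d\<^esub> P)"
    define Z where "Z = (\<Sum>P\<in>?S. A P \<star>\<^bsub>d\<^esub> pd (\<iota> P))"
    have "dapply d ?X u = dapply d (Z \<star>\<^bsub>d\<^esub> ?X) u" for u
    proof -
      have "dapply d ?X u = (\<Sum>P\<in>?S. dapply d (A P) (dapply d P u))"
        by (subst eq) (simp add: dapply_sum)
      also have "\<dots> = (\<Sum>P\<in>?S. dapply d (A P) (dapply d (pd (\<iota> P) \<star>\<^bsub>d\<^esub> ?X) u))"
        by (rule sum.cong) (simp_all only: \<iota>)
      finally show ?thesis by (simp add: Z_def dapply_sum)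
    qed
    then have "fn_op 1 \<star>\<^bsub>d\<^esub> ?X = Z \<star>\<^bsub>d\<^esub> ?X" by (intro op_eqI) simp
    then have "fn_op 1 = Z" using X by (rule dmult_cancel)
    then have "1 * 1 = dapply d Z 1" by (metis dapply_fn_op)
    then show False by (simp add: Z_def dapply_sum)
  qed
  then obtain u where u: "\<And>P. P \<in> ?S \<Longrightarrow> dapply d P u = 0" "dapply d ?X u \<noteq> 0"
    by (rule solution[of ?S ?X, rotated]) auto
  define c where "c = dapply d ?X u"
  have "d i c = 0" for i using u(1)[of "pd i \<star>\<^bsub>d\<^esub> ?X"] by (simp add: c_def)
  then have dc: "d i (inverse c) = 0" for i using u(2) by (simp add: d_inverse c_def)
  have "(\<Sum>i\<in>UNIV. a i * d i (u * inverse c)) = (\<Sum>i\<in>UNIV. a i * d i u) * inverse c"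
    by (simp add: d_mult dc sum_distrib_right mult.assoc)
  also have "\<dots> = 1" using u(2) by (simp add: c_def dapply_vector_field_op)
  finally show ?thesis by (rule that)
qed

text \<open>By comparison of orders, the only multiples of a vector field that are vector fields are those by functions.\<close>

lemma vector_field_op_solution_transversal:
  assumes a: "\<exists>i. a i \<noteq> 0" and b: "\<And>p. b \<noteq> (\<lambda>i. p * a i)"
  obtains u where "(\<Sum>i\<in>UNIV. a i * d i u) = 0" "(\<Sum>i\<in>UNIV. b i * d i u) \<noteq> 0"
proof -
  have "vector_field_op b \<noteq> A \<star>\<^bsub>d\<^esub> vector_field_op a" for A
  proof
    assume eq: "vector_field_op b = A \<star>\<^bsub>d\<^esub> vector_field_op a"
    have "\<exists>i. b i \<noteq> 0"
    proof (rule ccontr)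
      assume "\<not> ?thesis"
      then have "b = (\<lambda>i. 0 * a i)" by (intro ext) (simp add: pointwise)
      with b show False by blast
    qed
    then have "ord (vector_field_op b) = 1" "vector_field_op b \<noteq> 0" using ord_vector_field_op[of b 0] by (simp_all add: vector_field_op_eq_0_iff)
    moreover have "ord (vector_field_op a) = 1" "vector_field_op a \<noteq> 0" using ord_vector_field_op[of a 0] a by (simp_all add: vector_field_op_eq_0_iff)
    moreover from eq \<open>vector_field_op b \<noteq> 0\<close> have "A \<noteq> 0" by auto
    ultimately have "ord A = 0" using ord_dmult[of A "vector_field_op a"] by (simp add: eq)
    then obtain p where "A = fn_op p" using ord_0_fn by blast
    then have "b i = p * a i" for i
      using arg_cong[OF eq, of "\<lambda>L. Poly_Mapping.lookup L (unit_index i)"]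
      by (simp add: fn_op_dmult lookup_vector_field_op lookup_scale)
    with b show False by blast
  qed
  then obtain u where "dapply d (vector_field_op a) u = 0" "dapply d (vector_field_op b) u \<noteq> 0"
    by (rule solution_single)
  then show ?thesis by (intro that) (simp_all add: dapply_vector_field_op)
qed

text \<open>Coordinates are added one at a time: as long as fewer than \<open>card UNIV\<close> are known, some vector \<open>b\<close>
is annihilated by all their gradients. It is not a multiple of \<open>a\<close>, as \<open>a\<close> pairs to \<open>1\<close> with the
gradient of \<open>y j\<close>, so some \<open>u\<close> with \<open>X u = 0\<close> and \<open>b \<cdot> du \<noteq> 0\<close> can serve as the next coordinate. The dual
vectors are corrected accordingly; \<open>A j = a\<close> survives because \<open>X u = 0\<close>.\<close>

lemma partial_straightening:
  fixes j :: 'i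
  assumes a: "\<exists>i. a i \<noteq> 0" and n: "1 \<le> n" "n \<le> card (UNIV :: 'i set)"
  shows "\<exists>T y A. j \<in> T \<and> card T = n \<and> A j = a \<and>
    (\<forall>k\<in>T. \<forall>l\<in>T. pair (A k) (\<lambda>i. d i (y l)) = (if k = l then 1 else 0))"
  using n
proof (induction n rule: nat_induct_at_least)
  case base
  obtain u where "(\<Sum>i\<in>UNIV. a i * d i u) = 1" using vector_field_op_solution_one[OF a] by blast
  then show ?case
    by (intro exI[of _ "{j}"] exI[of _ "\<lambda>_. u"] exI[of _ "\<lambda>_. a"]) (simp add: pair_def)
next
  case (Suc n)
  obtain T y A where T: "j \<in> T" "card T = n" "A j = a"
    and dual': "\<forall>k\<in>T. \<forall>l\<in>T. pair (A k) (\<lambda>i. d i (y l)) = (if k = l then 1 else 0)"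
    using Suc.IH[OF Suc_leD[OF Suc.prems]] by (elim exE conjE)
  have dual: "pair (A k) (\<lambda>i. d i (y l)) = (if k = l then 1 else 0)" if "k \<in> T" "l \<in> T" for k l
    by (rule bspec[OF bspec[OF dual' that(1)] that(2)])
  have "T \<noteq> UNIV" using T(2) Suc.prems by auto
  then obtain k where k: "k \<notin> T" by auto
  obtain b where b: "b \<noteq> 0" "\<And>l. l \<in> T \<Longrightarrow> pair b (\<lambda>i. d i (y l)) = 0"
    using dual_family_extend[of T A "\<lambda>l i. d i (y l)"] dual \<open>T \<noteq> UNIV\<close> by blast
  have "b \<noteq> (\<lambda>i. p * a i)" for p
  proof
    assume eq: "b = (\<lambda>i. p * a i)"
    then have "p * pair a (\<lambda>i. d i (y j)) = 0" using b(2)[OF T(1)] by (simp only: pair_scale)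
    then have "p = 0" using dual[OF T(1) T(1)] T(3) by simp
    then have "b = 0" by (simp add: eq fun_eq_iff pointwise)
    with b(1) show False by simp
  qed
  then obtain u where u: "(\<Sum>i\<in>UNIV. a i * d i u) = 0" "(\<Sum>i\<in>UNIV. b i * d i u) \<noteq> 0"
    using vector_field_op_solution_transversal[OF a] by blast
  define e where "e = pair b (\<lambda>i. d i u)"
  have e: "e \<noteq> 0" using u(2) by (simp add: e_def pair_def)
  define b' where "b' = (\<lambda>i. inverse e * b i)"
  have b': "pair b' (\<lambda>i. d i u) = 1" "\<And>l. l \<in> T \<Longrightarrow> pair b' (\<lambda>i. d i (y l)) = 0"
    using e b(2) by (simp_all add: b'_def pair_scale flip: e_def)
  define y' where "y' = y(k := u)"
  define A' where "A' = (\<lambda>l. if l = k then b' else A l - (\<lambda>i. pair (A l) (\<lambda>i. d i u) * b' i))"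
  have "pair (A' p) (\<lambda>i. d i (y' q)) = (if p = q then 1 else 0)" if "p \<in> insert k T" "q \<in> insert k T" for p q
    using that k dual b' by (auto simp: A'_def y'_def pair_diff pair_scale)
  moreover have "A' j = a"
  proof -
    have "j \<noteq> k" using T(1) k by auto
    moreover have "pair a (\<lambda>i. d i u) = 0" using u(1) by (simp add: pair_def)
    ultimately show ?thesis by (simp add: A'_def T(3) fun_eq_iff pointwise)
  qed
  moreover have "card (insert k T) = Suc n" using k T(2) by simp
  ultimately show ?case using T(1) by (intro exI[of _ "insert k T"] exI[of _ y'] exI[of _ A']) auto
qed

lemma straightening:
  fixes j :: 'i
  assumes "\<exists>i. a i \<noteq> 0"
  obtains y A where "change_of_variables d y A" "A j = a"
proof -
  have "1 \<le> card (UNIV :: 'i set)" by (simp add: Suc_le_eq card_gt_0_iff)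
  then obtain T y A where T: "card T = card (UNIV :: 'i set)" "A j = a"
    "\<forall>k\<in>T. \<forall>l\<in>T. pair (A k) (\<lambda>i. d i (y l)) = (if k = l then 1 else 0)"
    using partial_straightening[OF assms, of "card (UNIV :: 'i set)" j] by auto
  then have "T = UNIV" by (intro card_subset_eq) auto
  with T show ?thesis by (intro that[of y A]) (simp_all add: change_of_variables_def pair_def)
qed

end

section \<open>Operators in new variables\<close>

definition coord_monom :: "('i::finite \<Rightarrow> 'k::comm_ring_1) \<Rightarrow> ('i \<Rightarrow> nat) \<Rightarrow> 'k" where
  "coord_monom y \<alpha> = (\<Prod>i\<in>UNIV. y i ^ \<alpha> i)"

context differential_field
begin

lemma d_coord_monom:
  assumes y: "\<And>i k. d i (y k) = (if i = k then 1 else 0)"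
  shows "d i (coord_monom y \<alpha>) = of_nat (\<alpha> i) * coord_monom y (\<alpha> - unit_index i)"
proof -
  interpret derivation_map "d i" by (rule d_derivation)
  let ?r = "\<Prod>w\<in>UNIV - {i}. y w ^ \<alpha> w"
  have "d i (coord_monom y \<alpha>) = (\<Sum>v\<in>UNIV. (\<Prod>w\<in>UNIV - {v}. y w ^ \<alpha> w) * d i (y v ^ \<alpha> v))"
    unfolding coord_monom_def by (rule D_prod) simp
  also have "\<dots> = (\<Sum>v\<in>UNIV. if v = i then ?r * (of_nat (\<alpha> i) * y i ^ (\<alpha> i - 1)) else 0)"
    by (rule sum.cong) (auto simp: D_power y)
  also have "\<dots> = of_nat (\<alpha> i) * (y i ^ (\<alpha> i - 1) * ?r)" by (simp add: ac_simps)
  also have "y i ^ (\<alpha> i - 1) * ?r = coord_monom y (\<alpha> - unit_index i)"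
  proof -
    have "(\<Prod>w\<in>UNIV - {i}. y w ^ (\<alpha> - unit_index i) w) = ?r"
      by (rule prod.cong) (auto simp: pointwise)
    then show ?thesis
      unfolding coord_monom_def
        prod.remove[OF finite UNIV_I, where x = i and g = "\<lambda>v. y v ^ (\<alpha> - unit_index i) v"]
      by (simp add: pointwise)
  qed
  finally show ?thesis .
qed

lemma dpow_coord_monom:
  assumes y: "\<And>i k. d i (y k) = (if i = k then 1 else 0)"
  shows "\<exists>n::nat. dpow d \<beta> (coord_monom y \<alpha>) = of_nat n * coord_monom y (\<alpha> - \<beta>) \<and> (n \<noteq> 0 \<longleftrightarrow> (\<forall>i. \<beta> i \<le> \<alpha> i))"
proof (induction \<beta> rule: mindex_induct)
  case zero
  have "\<alpha> - 0 = \<alpha>" by (simp add: fun_eq_iff pointwise)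
  moreover have "\<forall>i. 0 i \<le> \<alpha> i" by (simp add: pointwise)
  ultimately show ?case by (intro exI[of _ 1]) simp
next
  case (step \<beta> i)
  then obtain n :: nat where n: "dpow d \<beta> (coord_monom y \<alpha>) = of_nat n * coord_monom y (\<alpha> - \<beta>)"
    "n \<noteq> 0 \<longleftrightarrow> (\<forall>i. \<beta> i \<le> \<alpha> i)" by blast
  have "\<alpha> - (\<beta> + unit_index i) = (\<alpha> - \<beta>) - unit_index i" by (simp add: fun_eq_iff pointwise)
  then have "dpow d (\<beta> + unit_index i) (coord_monom y \<alpha>) = of_nat (n * (\<alpha> - \<beta>) i) * coord_monom y (\<alpha> - (\<beta> + unit_index i))"
    by (simp add: dpow_unit_index_add n(1) d_mult d_coord_monom[OF y] zero_fun_apply)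
  moreover have "n * (\<alpha> - \<beta>) i \<noteq> 0 \<longleftrightarrow> (\<forall>j. (\<beta> + unit_index i) j \<le> \<alpha> j)"
  proof -
    have "n * (\<alpha> - \<beta>) i \<noteq> 0 \<longleftrightarrow> (\<forall>j. \<beta> j \<le> \<alpha> j) \<and> \<beta> i < \<alpha> i" using n(2) by (simp add: pointwise not_le)
    also have "\<dots> \<longleftrightarrow> (\<forall>j. (\<beta> + unit_index i) j \<le> \<alpha> j)"
    proof safe
      fix j assume "\<forall>j. \<beta> j \<le> \<alpha> j" "\<beta> i < \<alpha> i"
      then show "(\<beta> + unit_index i) j \<le> \<alpha> j" by (cases "j = i") (simp_all add: pointwise)
    next
      fix j assume "\<forall>j. (\<beta> + unit_index i) j \<le> \<alpha> j"
      then show "\<beta> j \<le> \<alpha> j" by (simp add: pointwise) (meson add_leD1)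
    next
      assume "\<forall>j. (\<beta> + unit_index i) j \<le> \<alpha> j"
      from this[THEN spec[of _ i]] show "\<beta> i < \<alpha> i" by (simp add: pointwise)
    qed
    finally show ?thesis .
  qed
  ultimately show ?case by blast
qed

text \<open>Applied to the monomial \<open>y\<^sup>\<alpha>\<close>, where \<open>\<alpha>\<close> is an exponent of \<open>L\<close> of least degree, all terms of \<open>L\<close> vanish except
the one at \<open>\<alpha>\<close>, whose value is a nonzero multiple of the coefficient.\<close>

lemma faithful_if_coordinates:
  assumes y: "\<And>i k. d i (y k) = (if i = k then 1 else 0)"
  shows "faithful_field d"
proof
  fix L assume z: "\<And>u. dapply d L u = 0"
  show "L = 0"
  proof (rule ccontr)
    assume "L \<noteq> 0"
    then have "Poly_Mapping.keys L \<noteq> {}" by (rule keys_nonempty)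
    then obtain \<alpha> where \<alpha>: "\<alpha> \<in> Poly_Mapping.keys L" "\<And>\<beta>. \<beta> \<in> Poly_Mapping.keys L \<Longrightarrow> mdeg \<alpha> \<le> mdeg \<beta>"
      using ex_has_least_nat[of "\<lambda>\<alpha>. \<alpha> \<in> Poly_Mapping.keys L" _ mdeg] by blast
    obtain n :: "('i \<Rightarrow> nat) \<Rightarrow> nat" where n: "\<And>\<beta>. dpow d \<beta> (coord_monom y \<alpha>) = of_nat (n \<beta>) * coord_monom y (\<alpha> - \<beta>)"
      "\<And>\<beta>. n \<beta> \<noteq> 0 \<longleftrightarrow> (\<forall>i. \<beta> i \<le> \<alpha> i)"
      using dpow_coord_monom[of y _ \<alpha>, OF y] by metis
    have "\<alpha> - \<alpha> = 0" by (simp add: fun_eq_iff pointwise)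
    moreover have "coord_monom y 0 = 1" by (simp add: coord_monom_def pointwise)
    ultimately have "dpow d \<alpha> (coord_monom y \<alpha>) \<noteq> 0" using n(1)[of \<alpha>] n(2)[of \<alpha>] by simp
    moreover have "dpow d \<beta> (coord_monom y \<alpha>) = 0" if "\<beta> \<in> Poly_Mapping.keys L - {\<alpha>}" for \<beta>
      using that n(1)[of \<beta>] n(2)[of \<beta>] mdeg_le_imp_eq[of \<beta> \<alpha>] \<alpha>(2)[of \<beta>] by auto
    then have "dapply d L (coord_monom y \<alpha>) = Poly_Mapping.lookup L \<alpha> * dpow d \<alpha> (coord_monom y \<alpha>)"
      unfolding dapply_def by (subst sum.remove[OF _ \<alpha>(1)]) auto
    ultimately show False using z \<alpha>(1) by (simp add: in_keys_iff)
  qed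
qed

text \<open>The maps given by operators form a ring generated by multiplications and the derivations. Transport between
different systems of derivations is done on this ring of maps, without formulas for the coefficients.\<close>

lemma range_dapply_add: "F \<in> range (dapply d) \<Longrightarrow> G \<in> range (dapply d) \<Longrightarrow> (\<lambda>u. F u + G u) \<in> range (dapply d)"
proof -
  assume "F \<in> range (dapply d)" "G \<in> range (dapply d)"
  then obtain A B where "F = dapply d A" "G = dapply d B" by auto
  then have "(\<lambda>u. F u + G u) = dapply d (A + B)" by (simp add: fun_eq_iff dapply_add)
  then show ?thesis by blast
qed

lemma range_dapply_comp: "F \<in> range (dapply d) \<Longrightarrow> G \<in> range (dapply d) \<Longrightarrow> (\<lambda>u. F (G u)) \<in> range (dapply d)"
proof -
  assume "F \<in> range (dapply d)" "G \<in> range (dapply d)"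
  then obtain A B where "F = dapply d A" "G = dapply d B" by auto
  then have "(\<lambda>u. F (G u)) = dapply d (A \<star>\<^bsub>d\<^esub> B)" by (simp add: fun_eq_iff)
  then show ?thesis by blast
qed

lemma range_dapply_mult: "(\<lambda>u. f * u) \<in> range (dapply d)"
  by (rule range_eqI[of _ _ "fn_op f"]) (simp add: fun_eq_iff)

lemma range_dapply_d: "d i \<in> range (dapply d)"
  by (rule range_eqI[of _ _ "pd i"]) (simp add: fun_eq_iff)

lemma range_dapply_sum: "finite S \<Longrightarrow> (\<And>x. x \<in> S \<Longrightarrow> F x \<in> range (dapply d)) \<Longrightarrow> (\<lambda>u. \<Sum>x\<in>S. F x u) \<in> range (dapply d)"
proof (induction S rule: finite_induct)
  case empty
  show ?case by (rule range_eqI[of _ _ 0]) (simp add: fun_eq_iff)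
next
  case (insert x S)
  then have "(\<lambda>u. F x u + (\<Sum>x\<in>S. F x u)) \<in> range (dapply d)" by (intro range_dapply_add) auto
  with insert show ?case by simp
qed

lemma range_dapply_subset:
  assumes e: "differential_field e" "\<And>i. e i \<in> range (dapply d)"
  shows "dapply e L \<in> range (dapply d)"
proof -
  interpret e: differential_field e by (rule e(1))
  have "dpow e \<alpha> \<in> range (dapply d)" for \<alpha>
  proof (induction \<alpha> rule: mindex_induct)
    case zero
    have "(\<lambda>u. 1 * u) \<in> range (dapply d)" by (rule range_dapply_mult)
    moreover have "dpow e 0 = (\<lambda>u. 1 * u)" by (simp add: fun_eq_iff)
    ultimately show ?case by simp
  next
    case (step \<alpha> i)
    have "dpow e (\<alpha> + unit_index i) = (\<lambda>u. e i (dpow e \<alpha> u))" by (simp add: fun_eq_iff e.dpow_unit_index_add)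
    then show ?case using range_dapply_comp[OF e(2) step] by simp
  qed
  then have "(\<lambda>u. \<Sum>\<alpha>\<in>Poly_Mapping.keys L. Poly_Mapping.lookup L \<alpha> * dpow e \<alpha> u) \<in> range (dapply d)"
    by (intro range_dapply_sum range_dapply_comp[OF range_dapply_mult]) auto
  moreover have "dapply e L = (\<lambda>u. \<Sum>\<alpha>\<in>Poly_Mapping.keys L. Poly_Mapping.lookup L \<alpha> * dpow e \<alpha> u)"
    by (simp add: fun_eq_iff dapply_def)
  ultimately show ?thesis by simp
qed

end

locale new_variables = differential_field d for d :: "'i::finite \<Rightarrow> 'k::field_char_0 \<Rightarrow> 'k" +
  fixes y :: "'i \<Rightarrow> 'k" and A :: "'i \<Rightarrow> 'i \<Rightarrow> 'k"
  assumes change: "change_of_variables d y A"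
begin

abbreviation D :: "'i \<Rightarrow> 'k \<Rightarrow> 'k" where "D \<equiv> new_deriv d A"

lemma D_pair: "D k u = pair (A k) (\<lambda>i. d i u)"
  by (simp add: new_deriv_def pair_def)

lemma D_y: "D k (y l) = (if k = l then 1 else 0)"
  using change by (simp add: change_of_variables_def new_deriv_def)

text \<open>A derivation that annihilates all coordinates is zero. The formula for \<open>d\<close> in terms of the new derivations
and the commutation of the latter follow from this.\<close>

lemma separates: "(\<And>l. pair b (\<lambda>i. d i (y l)) = 0) \<Longrightarrow> b = 0"
  using dual_family_separates[of A "\<lambda>l i. d i (y l)" b] D_y by (simp add: D_pair)

lemma d_in_terms_of_D: "d i u = (\<Sum>k\<in>UNIV. d i (y k) * D k u)"
proof -
  define b where "b = basis_vec i - (\<Sum>k\<in>UNIV. (\<lambda>j. d i (y k) * A k j))"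
  have b: "pair b (\<lambda>i. d i u) = d i u - (\<Sum>k\<in>UNIV. d i (y k) * D k u)" for u
    by (simp add: b_def pair_diff pair_basis_vec pair_sum pair_scale D_pair)
  have "b = 0" by (rule separates) (simp add: b D_y if_distrib cong: if_cong)
  with b[of u] show ?thesis by (simp add: pair_zero)
qed

lemma D_add: "D k (u + v) = D k u + D k v"
  by (simp add: new_deriv_def d_add distrib_left sum.distrib)

lemma D_mult: "D k (u * v) = D k u * v + u * D k v"
  by (simp add: new_deriv_def d_mult algebra_simps sum.distrib sum_distrib_left)

lemma D_const: "D k 0 = 0" "D k 1 = 0"
  by (simp_all add: new_deriv_def)

text \<open>The commutator of two vector fields is a vector field, and it annihilates all coordinates.\<close>

lemma D_commute: "D k (D l u) = D l (D k u)"
proof -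
  define b where "b = (\<lambda>m. (\<Sum>i\<in>UNIV. A k i * d i (A l m)) - (\<Sum>i\<in>UNIV. A l i * d i (A k m)))"
  have DD: "D p (D q u) = (\<Sum>m\<in>UNIV. (\<Sum>i\<in>UNIV. A p i * d i (A q m)) * d m u)
      + (\<Sum>i\<in>UNIV. \<Sum>m\<in>UNIV. A p i * A q m * d i (d m u))" for p q u
  proof -
    have "D p (D q u) = (\<Sum>i\<in>UNIV. \<Sum>m\<in>UNIV. A p i * d i (A q m) * d m u + A p i * A q m * d i (d m u))"
      by (simp add: new_deriv_def d_sum d_mult sum_distrib_left algebra_simps)
    also have "\<dots> = (\<Sum>i\<in>UNIV. \<Sum>m\<in>UNIV. A p i * d i (A q m) * d m u) + (\<Sum>i\<in>UNIV. \<Sum>m\<in>UNIV. A p i * A q m * d i (d m u))"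
      by (simp add: sum.distrib)
    also have "(\<Sum>i\<in>UNIV. \<Sum>m\<in>UNIV. A p i * d i (A q m) * d m u) = (\<Sum>m\<in>UNIV. (\<Sum>i\<in>UNIV. A p i * d i (A q m)) * d m u)"
      by (subst sum.swap) (simp add: sum_distrib_right)
    finally show ?thesis .
  qed
  have "(\<Sum>i\<in>UNIV. \<Sum>m\<in>UNIV. A k i * A l m * d i (d m u)) = (\<Sum>i\<in>UNIV. \<Sum>m\<in>UNIV. A l i * A k m * d i (d m u))" for u
    by (subst sum.swap) (simp add: d_commute ac_simps)
  then have b: "D k (D l u) - D l (D k u) = pair b (\<lambda>i. d i u)" for u
    by (simp add: DD b_def pair_def left_diff_distrib sum_subtractf)
  have "b = 0" by (rule separates) (simp add: b[symmetric] D_y D_const)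
  with b[of u] show ?thesis by (simp add: pair_zero)
qed

sublocale new: differential_field D
  by standard (rule D_add D_mult D_commute)+

sublocale new: faithful_field D
  by (rule new.faithful_if_coordinates) (rule D_y)

lemma range_dapply_D: "range (dapply D) = range (dapply d)"
proof -
  have "D k \<in> range (dapply d)" for k
  proof -
    have "(\<lambda>u. \<Sum>i\<in>UNIV. A k i * d i u) \<in> range (dapply d)"
      by (intro range_dapply_sum range_dapply_comp[OF range_dapply_mult] range_dapply_d) auto
    then show ?thesis by (simp add: new_deriv_def[abs_def])
  qed
  then have 1: "range (dapply D) \<subseteq> range (dapply d)"
    using range_dapply_subset[OF new.differential_field_axioms] by blast
  have "d i \<in> range (dapply D)" for i
  proof -
    have "(\<lambda>u. \<Sum>k\<in>UNIV. d i (y k) * D k u) \<in> range (dapply D)"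
      by (intro new.range_dapply_sum new.range_dapply_comp[OF new.range_dapply_mult] new.range_dapply_d) auto
    moreover have "d i = (\<lambda>u. \<Sum>k\<in>UNIV. d i (y k) * D k u)" using d_in_terms_of_D by blast
    ultimately show ?thesis by simp
  qed
  then have "range (dapply d) \<subseteq> range (dapply D)"
    using new.range_dapply_subset[OF differential_field_axioms] by blast
  with 1 show ?thesis by blast
qed

lemma to_new: "F \<in> range (dapply d) \<Longrightarrow> \<exists>P. \<forall>u. dapply D P u = F u"
  unfolding range_dapply_D[symmetric] by (metis rangeE)

lemma from_new: "F \<in> range (dapply D) \<Longrightarrow> \<exists>P. \<forall>u. dapply d P u = F u"
  unfolding range_dapply_D by (metis rangeE)

text \<open>Here \<open>F\<close> is the first-order operator \<open>\<partial>\<^sub>j + m\<close> as a map, and \<open>f\<close> a nonzero element of its kernel.\<close>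

lemma gauge:
  assumes F: "\<And>u. F u = D j u + m * u" and f: "f \<noteq> 0" "F f = 0"
  shows "F u = f * D j (inverse f * u)"
proof -
  have "D j f = - (m * f)" using F[of f] f(2) by (simp add: eq_neg_iff_add_eq_0)
  then have *: "F (f * v) = f * D j v" for v by (simp add: F D_mult algebra_simps pointwise)
  show ?thesis using *[of "inverse f * u"] f(1) by (simp add: mult.assoc[symmetric])
qed

end

section \<open>Division by a derivation\<close>

definition free_of :: "'i \<Rightarrow> ('i, 'k::zero) dop \<Rightarrow> bool" where
  "free_of j L \<longleftrightarrow> (\<forall>\<alpha>\<in>Poly_Mapping.keys L. \<alpha> j = 0)"

lemma free_of_diff: "free_of j A \<Longrightarrow> free_of j B \<Longrightarrow> free_of j (A - (B :: ('i, 'k::ab_group_add) dop))"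
  by (auto simp: free_of_def in_keys_iff lookup_minus)

lemma free_of_fn_op: "free_of j (fn_op f)"
  by (auto simp: free_of_def in_keys_iff lookup_fn_op pointwise split: if_splits)

context faithful_field
begin

lemma lookup_dmult_eq_0:
  assumes "\<And>\<alpha> \<beta> \<gamma>. \<alpha> \<in> Poly_Mapping.keys A \<Longrightarrow> \<beta> \<in> Poly_Mapping.keys B \<Longrightarrow> \<forall>i. \<gamma> i \<le> \<alpha> i \<Longrightarrow> \<alpha> - \<gamma> + \<beta> \<noteq> \<mu>"
  shows "Poly_Mapping.lookup (A \<star>\<^bsub>d\<^esub> B) \<mu> = 0"
  unfolding dmult_alt lookup_sum
  by (intro sum.neutral ballI lookup_single_not_eq) (use assms in auto)

lemma free_of_dmult:
  assumes "free_of j A" "free_of j B"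
  shows "free_of j (A \<star>\<^bsub>d\<^esub> B)"
  unfolding free_of_def
proof (intro ballI, rule ccontr)
  fix \<mu> assume "\<mu> \<in> Poly_Mapping.keys (A \<star>\<^bsub>d\<^esub> B)" and j: "\<mu> j \<noteq> 0"
  moreover have "Poly_Mapping.lookup (A \<star>\<^bsub>d\<^esub> B) \<mu> = 0"
  proof (rule lookup_dmult_eq_0, rule notI)
    fix \<alpha> \<beta> \<gamma>
    assume "\<alpha> \<in> Poly_Mapping.keys A" "\<beta> \<in> Poly_Mapping.keys B" "\<alpha> - \<gamma> + \<beta> = \<mu>"
    moreover from this have "\<mu> j = \<alpha> j - \<gamma> j + \<beta> j" by (auto simp: pointwise)
    ultimately show False using j assms by (auto simp: free_of_def)
  qed
  ultimately show False by (simp add: in_keys_iff)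
qed

lemma lookup_dmult_pd:
  assumes "\<mu> j = 0"
  shows "Poly_Mapping.lookup (A \<star>\<^bsub>d\<^esub> pd j) \<mu> = 0"
proof (rule lookup_dmult_eq_0, rule notI)
  fix \<alpha> \<beta> \<gamma>
  assume "\<beta> \<in> Poly_Mapping.keys (pd j :: ('i, 'k) dop)" "\<alpha> - \<gamma> + \<beta> = \<mu>"
  then have "\<mu> j = \<alpha> j - \<gamma> j + 1" by (auto simp: pd_def pointwise)
  with assms show False by simp
qed

text \<open>Every term of \<open>A \<partial>\<^sub>j\<close> contains \<open>\<partial>\<^sub>j\<close>.\<close>

lemma free_multiple_eq_0:
  assumes "free_of j (A \<star>\<^bsub>d\<^esub> pd j)"
  shows "A \<star>\<^bsub>d\<^esub> pd j = 0"
proof (rule poly_mapping_eqI)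
  fix \<mu>
  have "Poly_Mapping.lookup (A \<star>\<^bsub>d\<^esub> pd j) \<mu> = 0"
  proof (cases "\<mu> j = 0")
    case False
    then have "\<mu> \<notin> Poly_Mapping.keys (A \<star>\<^bsub>d\<^esub> pd j)"
      using bspec[OF assms[unfolded free_of_def], of \<mu>] by (rule contrapos_nn)
    then show ?thesis by (simp only: in_keys_iff not_not)
  qed (rule lookup_dmult_pd)
  then show "Poly_Mapping.lookup (A \<star>\<^bsub>d\<^esub> pd j) \<mu> = Poly_Mapping.lookup 0 \<mu>" by simp
qed

lemma division_by_pd:
  obtains C R where "L = C \<star>\<^bsub>d\<^esub> pd j + R" "free_of j R"
proof -
  define K where "K = {\<alpha> \<in> Poly_Mapping.keys L. \<alpha> j \<noteq> 0}"
  define C where "C = (\<Sum>\<alpha>\<in>K. Poly_Mapping.single (\<alpha> - unit_index j) (Poly_Mapping.lookup L \<alpha>))"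
  define R where "R = (\<Sum>\<alpha>\<in>Poly_Mapping.keys L - K. Poly_Mapping.single \<alpha> (Poly_Mapping.lookup L \<alpha>))"
  have "C \<star>\<^bsub>d\<^esub> pd j = (\<Sum>\<alpha>\<in>K. Poly_Mapping.single \<alpha> (Poly_Mapping.lookup L \<alpha>))"
  proof (rule op_eqI)
    fix u
    have "dpow d (\<alpha> - unit_index j) (d j u) = dpow d \<alpha> u" if "\<alpha> \<in> K" for \<alpha>
    proof -
      have "\<alpha> = (\<alpha> - unit_index j) + unit_index j" using that by (intro minus_unit_index_add[symmetric]) (simp add: K_def)
      then have "dpow d \<alpha> u = dpow d ((\<alpha> - unit_index j) + unit_index j) u" by simp
      then show ?thesis by (simp add: dpow_add)
    qed
    then show "dapply d (C \<star>\<^bsub>d\<^esub> pd j) u = dapply d (\<Sum>\<alpha>\<in>K. Poly_Mapping.single \<alpha> (Poly_Mapping.lookup L \<alpha>)) u"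
      by (simp add: C_def dapply_sum dapply_single)
  qed
  moreover have "(\<Sum>\<alpha>\<in>K. Poly_Mapping.single \<alpha> (Poly_Mapping.lookup L \<alpha>)) + R = L"
    unfolding R_def using sum.subset_diff[of K "Poly_Mapping.keys L" "\<lambda>\<alpha>. Poly_Mapping.single \<alpha> (Poly_Mapping.lookup L \<alpha>)"]
    by (simp add: sum_single_lookup K_def add.commute)
  moreover have "free_of j R"
    unfolding free_of_def
  proof
    fix \<alpha> assume "\<alpha> \<in> Poly_Mapping.keys R"
    then have "\<alpha> \<in> (\<Union>\<beta>\<in>Poly_Mapping.keys L - K. Poly_Mapping.keys (Poly_Mapping.single \<beta> (Poly_Mapping.lookup L \<beta>)))"
      unfolding R_def using keys_sum by fast
    then show "\<alpha> j = 0" by (auto simp: K_def split: if_splits)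
  qed
  ultimately show ?thesis by (intro that[of C R]) auto
qed

lemma free_of_commutator:
  assumes "free_of j B"
  shows "free_of j (pd j \<star>\<^bsub>d\<^esub> B - B \<star>\<^bsub>d\<^esub> pd j)"
proof -
  have "pd j \<star>\<^bsub>d\<^esub> B - B \<star>\<^bsub>d\<^esub> pd j = (\<Sum>\<alpha>\<in>Poly_Mapping.keys B. Poly_Mapping.single \<alpha> (d j (Poly_Mapping.lookup B \<alpha>)))"
  proof (rule op_eqI)
    fix u
    have "d j (dpow d \<alpha> u) = dpow d \<alpha> (d j u)" for \<alpha>
      by (metis add.commute dpow_add dpow_unit_index)
    then show "dapply d (pd j \<star>\<^bsub>d\<^esub> B - B \<star>\<^bsub>d\<^esub> pd j) u =
        dapply d (\<Sum>\<alpha>\<in>Poly_Mapping.keys B. Poly_Mapping.single \<alpha> (d j (Poly_Mapping.lookup B \<alpha>))) u"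
      by (simp add: dapply_diff dapply_sum dapply_single)
         (simp add: dapply_def d_sum d_mult sum.distrib)
  qed
  moreover have "free_of j (\<Sum>\<alpha>\<in>Poly_Mapping.keys B. Poly_Mapping.single \<alpha> (d j (Poly_Mapping.lookup B \<alpha>)))"
    unfolding free_of_def
  proof
    fix \<alpha> assume "\<alpha> \<in> Poly_Mapping.keys (\<Sum>\<alpha>\<in>Poly_Mapping.keys B. Poly_Mapping.single \<alpha> (d j (Poly_Mapping.lookup B \<alpha>)))"
    then have "\<alpha> \<in> (\<Union>\<beta>\<in>Poly_Mapping.keys B. Poly_Mapping.keys (Poly_Mapping.single \<beta> (d j (Poly_Mapping.lookup B \<beta>))))"
      using keys_sum by fast
    then show "\<alpha> j = 0" using assms by (auto simp: free_of_def split: if_splits)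
  qed
  ultimately show ?thesis by simp
qed

text \<open>With the remainder written as \<open>c R\<close> and \<open>N = c \<partial>\<^sub>j c\<^sup>-\<^sup>1\<close>, the relation \<open>N L = L\<^sub>1 \<partial>\<^sub>j\<close> makes
\<open>\<partial>\<^sub>j R\<close>, hence also \<open>[\<partial>\<^sub>j, R]\<close>, a left multiple of \<open>\<partial>\<^sub>j\<close>. But this commutator only differentiates the
coefficients of \<open>R\<close>, so it is free of \<open>\<partial>\<^sub>j\<close>.\<close>

lemma commuting_remainder:
  assumes c: "c \<noteq> 0" and N: "\<And>u. dapply d N u = c * d j (inverse c * u)"
    and NL: "N \<star>\<^bsub>d\<^esub> L = L1 \<star>\<^bsub>d\<^esub> pd j"
  obtains C R where "L = C \<star>\<^bsub>d\<^esub> pd j + fn_op c \<star>\<^bsub>d\<^esub> R" "pd j \<star>\<^bsub>d\<^esub> R = R \<star>\<^bsub>d\<^esub> pd j"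
proof -
  obtain C R0 where C: "L = C \<star>\<^bsub>d\<^esub> pd j + R0" and free: "free_of j R0" by (rule division_by_pd)
  define R where "R = fn_op (inverse c) \<star>\<^bsub>d\<^esub> R0"
  have R0: "R0 = fn_op c \<star>\<^bsub>d\<^esub> R"
    by (rule op_eqI) (simp add: R_def c mult.assoc[symmetric])
  have fR: "free_of j R" unfolding R_def by (intro free_of_dmult free_of_fn_op free)
  have "pd j \<star>\<^bsub>d\<^esub> R - R \<star>\<^bsub>d\<^esub> pd j = (fn_op (inverse c) \<star>\<^bsub>d\<^esub> (L1 - N \<star>\<^bsub>d\<^esub> C) - R) \<star>\<^bsub>d\<^esub> pd j"
  proof (rule op_eqI)
    fix u
    have "dapply d N (dapply d L u) = dapply d L1 (d j u)"
      using arg_cong[OF NL, of "\<lambda>P. dapply d P u"] by simp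
    then have "dapply d N (dapply d C (d j u)) + dapply d N (dapply d R0 u) = dapply d L1 (d j u)"
      by (simp add: C dapply_simps)
    then have "dapply d L1 (d j u) - dapply d N (dapply d C (d j u)) = dapply d N (dapply d R0 u)"
      by (metis add_diff_cancel_left')
    also have "\<dots> = c * dapply d (pd j \<star>\<^bsub>d\<^esub> R) u" by (simp add: N R_def)
    finally have *: "c * d j (dapply d R u) = dapply d L1 (d j u) - dapply d N (dapply d C (d j u))" by simp
    show "dapply d (pd j \<star>\<^bsub>d\<^esub> R - R \<star>\<^bsub>d\<^esub> pd j) u =
        dapply d ((fn_op (inverse c) \<star>\<^bsub>d\<^esub> (L1 - N \<star>\<^bsub>d\<^esub> C) - R) \<star>\<^bsub>d\<^esub> pd j) u"
      using c by (simp add: dapply_simps *[symmetric])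
  qed
  moreover from this have "free_of j \<dots>" using free_of_commutator[OF fR] by simp
  ultimately have "pd j \<star>\<^bsub>d\<^esub> R - R \<star>\<^bsub>d\<^esub> pd j = 0" using free_multiple_eq_0 by metis
  then show ?thesis using C R0 by (intro that[of C R]) auto
qed

text \<open>Modulo left multiples of \<open>\<partial>\<^sub>j\<close>, both \<open>Q\<close> and \<open>B\<close> may be replaced by their remainders \<open>Q0\<close> and \<open>B0\<close>; for \<open>Q\<close>
this uses that \<open>B\<close> commutes with \<open>\<partial>\<^sub>j\<close>. Then \<open>Q0 B0 = 1\<close> holds exactly, and orders add.\<close>

lemma commuting_unit_remainder:
  assumes comm: "pd j \<star>\<^bsub>d\<^esub> B = B \<star>\<^bsub>d\<^esub> pd j"
    and unit: "fn_op 1 = P \<star>\<^bsub>d\<^esub> pd j + Q \<star>\<^bsub>d\<^esub> B"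
  obtains C g where "B = C \<star>\<^bsub>d\<^esub> pd j + fn_op g"
proof -
  obtain C B0 where B: "B = C \<star>\<^bsub>d\<^esub> pd j + B0" and fB: "free_of j B0" by (rule division_by_pd)
  obtain E Q0 where Q: "Q = E \<star>\<^bsub>d\<^esub> pd j + Q0" and fQ: "free_of j Q0" by (rule division_by_pd)
  have "fn_op 1 - Q0 \<star>\<^bsub>d\<^esub> B0 = (P + E \<star>\<^bsub>d\<^esub> B + Q0 \<star>\<^bsub>d\<^esub> C) \<star>\<^bsub>d\<^esub> pd j"
  proof (rule op_eqI)
    fix u
    have u: "u = dapply d P (d j u) + dapply d Q (dapply d B u)"
      using arg_cong[OF unit, of "\<lambda>P. dapply d P u"] by (simp add: dapply_add)
    have Bu: "dapply d B u = dapply d C (d j u) + dapply d B0 u" by (simp add: B dapply_add)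
    have Q0B: "dapply d Q0 (dapply d B u) = dapply d Q0 (dapply d C (d j u)) + dapply d Q0 (dapply d B0 u)"
      unfolding Bu by (rule dapply_plus)
    have "d j (dapply d B u) = dapply d B (d j u)"
      using arg_cong[OF comm, of "\<lambda>P. dapply d P u"] by simp
    then have "dapply d Q (dapply d B u) = dapply d E (dapply d B (d j u)) + dapply d Q0 (dapply d C (d j u)) + dapply d Q0 (dapply d B0 u)"
      unfolding Q dapply_add dapply_dmult dapply_pd Q0B by (simp only: add.assoc)
    with u have "u = dapply d P (d j u) + dapply d E (dapply d B (d j u)) + dapply d Q0 (dapply d C (d j u)) + dapply d Q0 (dapply d B0 u)"
      by (simp only: add.assoc)
    then have "u - dapply d Q0 (dapply d B0 u) = dapply d P (d j u) + dapply d E (dapply d B (d j u)) + dapply d Q0 (dapply d C (d j u))"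
      unfolding diff_eq_eq .
    then show "dapply d (fn_op 1 - Q0 \<star>\<^bsub>d\<^esub> B0) u = dapply d ((P + E \<star>\<^bsub>d\<^esub> B + Q0 \<star>\<^bsub>d\<^esub> C) \<star>\<^bsub>d\<^esub> pd j) u"
      by (simp only: dapply_diff dapply_add dapply_dmult dapply_pd dapply_fn_op mult_1_left)
  qed
  moreover from this have "free_of j \<dots>"
    using free_of_diff[OF free_of_fn_op[of j 1] free_of_dmult[OF fQ fB]] by simp
  ultimately have 1: "fn_op 1 = Q0 \<star>\<^bsub>d\<^esub> B0" using free_multiple_eq_0 by (metis right_minus_eq)
  then have nz: "Q0 \<noteq> 0" "B0 \<noteq> 0" by auto
  have "ord (Q0 \<star>\<^bsub>d\<^esub> B0) = 0" by (simp flip: 1)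
  then have "ord B0 = 0" by (simp add: ord_dmult[OF nz])
  then show ?thesis using that[of C "Poly_Mapping.lookup B0 0"] B ord_0_fn[of B0] by simp
qed

end

section \<open>First-order intertwiners\<close>

context faithful_field
begin

lemma symbol_cancel_right: "r \<noteq> 0 \<Longrightarrow> p * r = q * r \<Longrightarrow> p = (q :: ('i, 'k) dop)"
  using poly_mapping_no_zero_divisors[of "p - q" r] by (auto simp: left_diff_distrib)

text \<open>Both parts cancel a common factor in \<open>\<sigma>(N) \<sigma>(L) = \<sigma>(L\<^sub>1) \<sigma>(M)\<close>.\<close>

lemma intertwined_symbols:
  assumes "N \<star>\<^bsub>d\<^esub> L = L1 \<star>\<^bsub>d\<^esub> M" "M \<noteq> 0"
  shows "top_part N = top_part M \<Longrightarrow> top_part L = top_part L1"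
    and "top_part L = top_part L1 \<Longrightarrow> L \<noteq> 0 \<Longrightarrow> top_part N = top_part M"
proof -
  have e: "top_part N * top_part L = top_part L1 * top_part M" using assms(1) by (metis top_part_dmult)
  show "top_part L = top_part L1" if s: "top_part N = top_part M"
  proof (rule symbol_cancel_right)
    show "top_part M \<noteq> 0" using assms(2) by simp
    show "top_part L * top_part M = top_part L1 * top_part M" by (rule trans[OF mult.commute e[unfolded s]])
  qed
  show "top_part N = top_part M" if s: "top_part L = top_part L1" and L: "L \<noteq> 0"
  proof (rule symbol_cancel_right)
    show "top_part L1 \<noteq> 0" using L by (simp flip: s)
    show "top_part N * top_part L1 = top_part M * top_part L1" by (rule trans[OF e[unfolded s] mult.commute])
  qed
qed

lemma top_part_fn_op: "top_part (fn_op c) = (fn_op c :: ('i, 'k) dop)"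
proof (rule poly_mapping_eqI)
  fix \<alpha> :: "'i \<Rightarrow> nat"
  show "Poly_Mapping.lookup (top_part (fn_op c)) \<alpha> = Poly_Mapping.lookup (fn_op c) \<alpha>"
    by (simp add: lookup_top_part psymbol_def lookup_fn_op flip: mdeg_def)
qed

lemma equal_symbol_first_order:
  fixes M N :: "('i, 'k) dop"
  assumes "ord M = 1" "top_part N = top_part M"
  obtains h where "N = M + fn_op h"
proof -
  obtain a m where M: "M = vector_field_op a + fn_op m" "\<exists>i. a i \<noteq> 0" using assms(1) by (rule ord_1E)
  have "ord N = 1" using ord_cong[OF assms(2)] assms(1) by simp
  then obtain b n where N: "N = vector_field_op b + fn_op n" "\<exists>i. b i \<noteq> 0" by (rule ord_1E)
  have "vector_field_op a = vector_field_op b" using assms(2) M N by (simp add: top_part_vector_field_op)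
  then have "N = M + fn_op (n - m)" by (simp add: M N fn_op_diff)
  then show ?thesis by (rule that)
qed

lemma conjugate_symbol:
  assumes "c \<noteq> 0"
  shows "top_part (fn_op c \<star>\<^bsub>d\<^esub> M \<star>\<^bsub>d\<^esub> fn_op (inverse c)) = top_part M"
proof -
  have "fn_op c * fn_op (inverse c) = (1 :: ('i, 'k) dop)"
    using assms by (simp add: fn_op_alt mult_single)
  moreover have "fn_op c * top_part M * fn_op (inverse c) = (fn_op c * fn_op (inverse c)) * top_part M"
    by (simp only: ac_simps)
  ultimately show ?thesis by (simp add: top_part_dmult top_part_fn_op)
qed

lemma multiple_of_first_order_not_fn:
  assumes "ord M = 1" "fn_op f = A \<star>\<^bsub>d\<^esub> M"
  shows "f = 0"
proof (rule ccontr)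
  assume "f \<noteq> 0"
  then have "A \<star>\<^bsub>d\<^esub> M \<noteq> 0" by (simp flip: assms(2))
  then have nz: "A \<noteq> 0" "M \<noteq> 0" by auto
  have "ord (A \<star>\<^bsub>d\<^esub> M) = 0" by (simp flip: assms(2))
  then show False using assms(1) by (simp add: ord_dmult[OF nz])
qed

lemma conjugate_intertwines:
  assumes "M \<star>\<^bsub>d\<^esub> B = B \<star>\<^bsub>d\<^esub> M" "c \<noteq> 0"
  shows "(fn_op c \<star>\<^bsub>d\<^esub> M \<star>\<^bsub>d\<^esub> fn_op (inverse c)) \<star>\<^bsub>d\<^esub> (fn_op c \<star>\<^bsub>d\<^esub> B) = (fn_op c \<star>\<^bsub>d\<^esub> B) \<star>\<^bsub>d\<^esub> M"
proof (rule op_eqI)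
  fix u
  have "dapply d M (dapply d B u) = dapply d B (dapply d M u)"
    using arg_cong[OF assms(1), of "\<lambda>P. dapply d P u"] by simp
  then show "dapply d ((fn_op c \<star>\<^bsub>d\<^esub> M \<star>\<^bsub>d\<^esub> fn_op (inverse c)) \<star>\<^bsub>d\<^esub> (fn_op c \<star>\<^bsub>d\<^esub> B)) u =
      dapply d ((fn_op c \<star>\<^bsub>d\<^esub> B) \<star>\<^bsub>d\<^esub> M) u"
    using assms(2) by (simp add: mult.assoc[symmetric])
qed

text \<open>Since \<open>M\<close> commutes with \<open>B\<close>, the conjugate \<open>N = c M c\<^sup>-\<^sup>1\<close> satisfies \<open>N (c B) = (c B) M\<close>. The equality of the symbols
of \<open>L\<close> and \<open>L\<^sub>1\<close> is deduced from the intertwining relation and not from the formula for \<open>L\<^sub>1\<close>, in which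
leading terms may cancel.\<close>

lemma conjugate_darboux:
  assumes "ord M = 1" "decomposition d L M C B c" "fn_op c \<star>\<^bsub>d\<^esub> B \<noteq> 0"
  defines "N \<equiv> fn_op c \<star>\<^bsub>d\<^esub> M \<star>\<^bsub>d\<^esub> fn_op (inverse c)"
  shows "ord N = 1" "darboux d M N L (N \<star>\<^bsub>d\<^esub> C + fn_op c \<star>\<^bsub>d\<^esub> B)"
proof -
  have c: "c \<noteq> 0" using assms(3) by auto
  have L: "L = C \<star>\<^bsub>d\<^esub> M + fn_op c \<star>\<^bsub>d\<^esub> B" and MB: "M \<star>\<^bsub>d\<^esub> B = B \<star>\<^bsub>d\<^esub> M"
    using assms(2) by (auto simp: decomposition_def)
  have s: "top_part N = top_part M" unfolding N_def by (rule conjugate_symbol[OF c])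
  then show "ord N = 1" using ord_cong assms(1) by metis
  have "N \<star>\<^bsub>d\<^esub> L = N \<star>\<^bsub>d\<^esub> C \<star>\<^bsub>d\<^esub> M + N \<star>\<^bsub>d\<^esub> (fn_op c \<star>\<^bsub>d\<^esub> B)"
    by (simp add: L dmult_add_right dmult_assoc)
  also have "\<dots> = (N \<star>\<^bsub>d\<^esub> C + fn_op c \<star>\<^bsub>d\<^esub> B) \<star>\<^bsub>d\<^esub> M"
    unfolding N_def conjugate_intertwines[OF MB c] by (simp add: dmult_add_left)
  finally have e: "N \<star>\<^bsub>d\<^esub> L = (N \<star>\<^bsub>d\<^esub> C + fn_op c \<star>\<^bsub>d\<^esub> B) \<star>\<^bsub>d\<^esub> M" .
  have "M \<noteq> 0" using assms(1) by (auto simp: ord_def)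
  from e intertwined_symbols(1)[OF e this s]
  show "darboux d M N L (N \<star>\<^bsub>d\<^esub> C + fn_op c \<star>\<^bsub>d\<^esub> B)"
    by (simp add: darboux_def psymbol_eq_iff)
qed

lemma factorization_darboux:
  assumes "ord M = 1" "L = C \<star>\<^bsub>d\<^esub> M" "psymbol N = psymbol M"
  shows "from_factorization d M N L (N \<star>\<^bsub>d\<^esub> C)"
proof -
  have e: "N \<star>\<^bsub>d\<^esub> L = (N \<star>\<^bsub>d\<^esub> C) \<star>\<^bsub>d\<^esub> M" by (simp add: assms(2) dmult_assoc)
  have "M \<noteq> 0" using assms(1) by (auto simp: ord_def)
  from intertwined_symbols(1)[OF e this] e assms(2,3) show ?thesis
    unfolding from_factorization_def darboux_def psymbol_eq_iff by blast
qed

text \<open>If \<open>c B = 0\<close>, then \<open>M\<close> is cancelled on the right. Otherwise \<open>N\<close> and \<open>c M c\<^sup>-\<^sup>1\<close> both have the symbol of \<open>M\<close> and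
differ by a function \<open>g\<close> with \<open>g c B\<close> a left multiple of \<open>M\<close>; a nonzero \<open>g\<close> would make \<open>c B\<close> itself such a
multiple, hence a function by reducedness, which is impossible for order reasons.\<close>

lemma darboux_unique:
  assumes M: "ord M = 1" and dec: "decomposition d L M C B c" and dar: "darboux d M N L L1"
  shows "fn_op c \<star>\<^bsub>d\<^esub> B = 0 \<Longrightarrow> (L \<noteq> 0 \<longrightarrow> psymbol N = psymbol M) \<and> L1 = N \<star>\<^bsub>d\<^esub> C"
    and "fn_op c \<star>\<^bsub>d\<^esub> B \<noteq> 0 \<Longrightarrow> reduced d M (fn_op c \<star>\<^bsub>d\<^esub> B) \<Longrightarrow>
      N = fn_op c \<star>\<^bsub>d\<^esub> M \<star>\<^bsub>d\<^esub> fn_op (inverse c) \<and> L1 = N \<star>\<^bsub>d\<^esub> C + fn_op c \<star>\<^bsub>d\<^esub> B"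
proof -
  have M0: "M \<noteq> 0" using M by (auto simp: ord_def)
  have L: "L = C \<star>\<^bsub>d\<^esub> M + fn_op c \<star>\<^bsub>d\<^esub> B" and MB: "M \<star>\<^bsub>d\<^esub> B = B \<star>\<^bsub>d\<^esub> M"
    using dec by (auto simp: decomposition_def)
  have s: "top_part L = top_part L1" and e: "N \<star>\<^bsub>d\<^esub> L = L1 \<star>\<^bsub>d\<^esub> M"
    using dar by (auto simp: darboux_def psymbol_eq_iff)
  note sN = intertwined_symbols(2)[OF e M0 s]
  {
    assume "fn_op c \<star>\<^bsub>d\<^esub> B = 0"
    then have "L1 \<star>\<^bsub>d\<^esub> M = (N \<star>\<^bsub>d\<^esub> C) \<star>\<^bsub>d\<^esub> M" using e L by (simp add: dmult_assoc)
    then show "(L \<noteq> 0 \<longrightarrow> psymbol N = psymbol M) \<and> L1 = N \<star>\<^bsub>d\<^esub> C"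
      using dmult_cancel M0 sN by (auto simp: psymbol_eq_iff)
  next
    let ?R = "fn_op c \<star>\<^bsub>d\<^esub> B" and ?N = "fn_op c \<star>\<^bsub>d\<^esub> M \<star>\<^bsub>d\<^esub> fn_op (inverse c)"
    assume R: "?R \<noteq> 0" and red: "reduced d M ?R"
    have nm: "?R \<noteq> Q \<star>\<^bsub>d\<^esub> M" for Q
    proof
      assume Q: "?R = Q \<star>\<^bsub>d\<^esub> M"
      then have "?R = Q \<star>\<^bsub>d\<^esub> M + fn_op 0" by simp
      with red have "is_fn ?R" unfolding reduced_def by blast
      then obtain f where "?R = fn_op f" by (auto simp: is_fn_def)
      with Q R multiple_of_first_order_not_fn[OF M, of f Q] show False by simp
    qed
    have c: "c \<noteq> 0" using R by auto
    have "L \<noteq> 0"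
    proof
      assume "L = 0"
      with L have "?R = - (C \<star>\<^bsub>d\<^esub> M)" by (simp add: eq_neg_iff_add_eq_0 add.commute)
      also have "\<dots> = (- C) \<star>\<^bsub>d\<^esub> M" by (rule op_eqI) (simp add: dapply_simps)
      finally show False using nm by blast
    qed
    then obtain h where h: "N = M + fn_op h" by (rule equal_symbol_first_order[OF M sN])
    obtain h' where h': "?N = M + fn_op h'" by (rule equal_symbol_first_order[OF M conjugate_symbol[OF c]])
    have "N \<star>\<^bsub>d\<^esub> C \<star>\<^bsub>d\<^esub> M + N \<star>\<^bsub>d\<^esub> ?R = L1 \<star>\<^bsub>d\<^esub> M"
      using e by (simp only: L dmult_add_right dmult_assoc)
    then have "N \<star>\<^bsub>d\<^esub> ?R = L1 \<star>\<^bsub>d\<^esub> M - N \<star>\<^bsub>d\<^esub> C \<star>\<^bsub>d\<^esub> M" by (metis add_diff_cancel_left')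
    then have "(N - ?N) \<star>\<^bsub>d\<^esub> ?R = (L1 - N \<star>\<^bsub>d\<^esub> C - ?R) \<star>\<^bsub>d\<^esub> M"
      by (simp only: dmult_diff_left conjugate_intertwines[OF MB c])
    moreover have "N - ?N = fn_op (h - h')" unfolding h h' by (simp add: fn_op_diff)
    ultimately have g: "fn_op (h - h') \<star>\<^bsub>d\<^esub> ?R = (L1 - N \<star>\<^bsub>d\<^esub> C - ?R) \<star>\<^bsub>d\<^esub> M" by simp
    have "h - h' = 0"
    proof (rule ccontr)
      assume g0: "h - h' \<noteq> 0"
      have "?R = (fn_op (inverse (h - h')) \<star>\<^bsub>d\<^esub> (L1 - N \<star>\<^bsub>d\<^esub> C - ?R)) \<star>\<^bsub>d\<^esub> M"
        unfolding dmult_assoc g[symmetric]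
        by (rule op_eqI) (use g0 in \<open>simp add: mult.assoc[symmetric]\<close>)
      with nm show False by blast
    qed
    then have N: "N = ?N" using h h' by simp
    have "(L1 - N \<star>\<^bsub>d\<^esub> C - ?R) \<star>\<^bsub>d\<^esub> M = 0" using g \<open>h - h' = 0\<close> by simp
    then have "L1 - N \<star>\<^bsub>d\<^esub> C - ?R = 0" using dmult_nonzero M0 by metis
    with N show "N = ?N \<and> L1 = N \<star>\<^bsub>d\<^esub> C + ?R" by (simp add: algebra_simps pointwise)
  }
qed

text \<open>With \<open>c B = f\<close> the operator \<open>B\<close> is multiplication by \<open>f/c\<close>; as it commutes with \<open>M\<close>, conjugation by \<open>c\<close> and by
\<open>f\<close> agree on \<open>M\<close>.\<close>

lemma function_remainder_type_I:
  assumes M: "ord M = 1" and dec: "decomposition d L M C B c"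
    and R: "fn_op c \<star>\<^bsub>d\<^esub> B \<noteq> 0" "is_fn (fn_op c \<star>\<^bsub>d\<^esub> B)"
  defines "N \<equiv> fn_op c \<star>\<^bsub>d\<^esub> M \<star>\<^bsub>d\<^esub> fn_op (inverse c)"
  shows "type_I d M N L (N \<star>\<^bsub>d\<^esub> C + fn_op c \<star>\<^bsub>d\<^esub> B)"
proof -
  obtain f where f: "fn_op c \<star>\<^bsub>d\<^esub> B = fn_op f" using R(2) by (auto simp: is_fn_def)
  have c: "c \<noteq> 0" and f0: "f \<noteq> 0" using R(1) f by auto
  have L: "L = C \<star>\<^bsub>d\<^esub> M + fn_op f" and MB: "M \<star>\<^bsub>d\<^esub> B = B \<star>\<^bsub>d\<^esub> M"
    using dec f by (auto simp: decomposition_def)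
  have B: "dapply d B u = f / c * u" for u
    using arg_cong[OF f, of "\<lambda>P. dapply d P u"] c by (simp add: field_simps pointwise)
  have "N = fn_op f \<star>\<^bsub>d\<^esub> M \<star>\<^bsub>d\<^esub> fn_op (1 / f)"
  proof (rule op_eqI)
    fix u
    have "dapply d M (f / c * (u / f)) = f / c * dapply d M (u / f)"
      using arg_cong[OF MB, of "\<lambda>P. dapply d P (u / f)"] by (simp add: B)
    moreover have "f / c * (u / f) = inverse c * u" "1 / f * u = u / f" using f0 by (simp_all add: field_simps pointwise)
    ultimately show "dapply d N u = dapply d (fn_op f \<star>\<^bsub>d\<^esub> M \<star>\<^bsub>d\<^esub> fn_op (1 / f)) u"
      unfolding N_def using c by simp
  qed
  then show ?thesis
    using conjugate_darboux(2)[OF M dec R(1)] L f f0 unfolding type_I_def N_def by metis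
qed

end

section \<open>Wronskians of one and two functions\<close>

lemma wronskian_single: "wronskian D [f] = f"
  by (simp add: wronskian_def det_single)

lemma wronskian_two: "wronskian D [f, g] = f * D g - g * D f"
proof -
  let ?A = "mat 2 2 (\<lambda>(r, s). (D ^^ r) ([f, g] ! s))"
  have A: "?A \<in> carrier_mat 2 2" by simp
  have "det ?A = (\<Sum>i<2. ?A $$ (i, 0) * cofactor ?A i 0)"
    by (rule laplace_expansion_column[OF A]) simp
  also have "\<dots> = f * D g - g * D f"
    by (simp add: numeral_2_eq_2 cofactor_def det_single mat_delete_def)
  finally show ?thesis by (simp add: wronskian_def numeral_2_eq_2)
qed

section \<open>First-order operators in straightened variables\<close>

context linear_solution_field
begin

lemma first_order_kernel:
  assumes "ord M = 1"
  obtains f where "f \<noteq> 0" "dapply d M f = 0"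
proof -
  have "fn_op 1 \<noteq> A \<star>\<^bsub>d\<^esub> M" for A using multiple_of_first_order_not_fn[OF assms, of 1 A] by auto
  then obtain f where "dapply d M f = 0" "dapply d (fn_op 1) f \<noteq> 0" by (rule solution_single)
  then show ?thesis by (intro that[of f]) auto
qed

lemma first_order_straightening:
  assumes "ord M = 1"
  obtains y A j m where "change_of_variables d y A" "\<And>u. dapply d M u = new_deriv d A j u + m * u"
proof -
  obtain a m where M: "M = vector_field_op a + fn_op m" "\<exists>i. a i \<noteq> 0" using assms by (rule ord_1E)
  obtain y A where A: "change_of_variables d y A" "A undefined = a"
    by (rule straightening[OF M(2), of undefined])
  show ?thesis
    by (rule that[OF A(1), of undefined m]) (simp add: M(1) dapply_add dapply_vector_field_op new_deriv_def A(2))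
qed

text \<open>A single function \<open>f\<close> suffices: \<open>W(f, u)/W(f) = u' - (f'/f) u\<close>, and \<open>f'/f = -m\<close> because \<open>M f = 0\<close>.\<close>

lemma wronskian_type_if_common_kernel:
  assumes M: "ord M = 1" and dar: "darboux d M N L L1"
    and f: "f \<noteq> 0" "dapply d M f = 0" "dapply d L f = 0"
  shows "wronskian_type d M N L L1"
proof -
  obtain y A j m where A: "change_of_variables d y A" and Mu: "\<And>u. dapply d M u = new_deriv d A j u + m * u"
    by (rule first_order_straightening[OF M]) blast
  let ?D = "new_deriv d A j"
  have Df: "?D f = - (m * f)" using Mu[of f] f(2) by (simp add: eq_neg_iff_add_eq_0)
  have "dapply d M g = wronskian ?D ([f] @ [g]) / wronskian ?D [f]" for g
    using f(1) by (simp add: Mu wronskian_single wronskian_two Df field_simps pointwise)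
  moreover have "indep_over_constants d [f]"
    using f(1) by (simp add: indep_over_constants_def)
  ultimately show ?thesis
    unfolding wronskian_type_def using dar A f
    by (intro conjI exI[of _ y] exI[of _ A] exI[of _ j] exI[of _ "[f]"]) (auto simp: wronskian_single)
qed

text \<open>The variables straighten \<open>M\<close>, and \<open>f\<close>, \<open>c0\<close> trivialize \<open>M\<close> and \<open>N\<close>. Division of \<open>L f\<close> by \<open>\<partial>\<^sub>j\<close> gives
\<open>L f = C' \<partial>\<^sub>j + c0 R\<close>, that is \<open>L = (C' f\<^sup>-\<^sup>1) M + (c0/f) (f R f\<^sup>-\<^sup>1)\<close>, and \<open>f R f\<^sup>-\<^sup>1\<close> commutes with
\<open>M = f \<partial>\<^sub>j f\<^sup>-\<^sup>1\<close>.\<close>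

lemma darboux_decomposition:
  assumes M: "ord M = 1" and dar: "darboux d M N L L1"
  shows "\<exists>C B c. decomposition d L M C B c"
proof (cases "L = 0")
  case True
  then have "decomposition d L M 0 0 0" by (simp add: decomposition_def)
  then show ?thesis by blast
next
  case False
  have "M \<noteq> 0" using M by (auto simp: ord_def)
  have NL: "N \<star>\<^bsub>d\<^esub> L = L1 \<star>\<^bsub>d\<^esub> M" and "top_part L = top_part L1" using dar by (auto simp: darboux_def psymbol_eq_iff)
  then have sN: "top_part N = top_part M" using intertwined_symbols(2) \<open>M \<noteq> 0\<close> False by blast
  then obtain h where h: "N = M + fn_op h" by (rule equal_symbol_first_order[OF M])
  have oN: "ord N = 1" using ord_cong[OF sN] M by simp
  obtain c0 where c0: "c0 \<noteq> 0" "dapply d N c0 = 0" by (rule first_order_kernel[OF oN])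
  obtain f where f: "f \<noteq> 0" "dapply d M f = 0" by (rule first_order_kernel[OF M])
  obtain y A j m where A: "change_of_variables d y A" and Mu: "\<And>u. dapply d M u = new_deriv d A j u + m * u"
    by (rule first_order_straightening[OF M]) blast
  interpret new_variables d y A by standard (rule A)
  have Nu: "dapply d N u = D j u + (m + h) * u" for u by (simp add: h dapply_add Mu algebra_simps pointwise)
  note Mu' = gauge[of "dapply d M", OF Mu f] and Nu' = gauge[of "dapply d N", OF Nu c0]
  obtain N' where N': "\<And>u. dapply D N' u = dapply d N u" using to_new[of "dapply d N"] by blast
  \<comment> \<open>multiplying \<open>L\<close> and \<open>L1\<close> by \<open>f\<close> on the right turns \<open>N L = L1 M\<close> into a relation for \<open>\<partial>\<^sub>j\<close>\<close>
  obtain L' where L': "\<And>u. dapply D L' u = dapply d L (f * u)"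
    using to_new[OF range_dapply_comp[OF rangeI range_dapply_mult]] by blast
  obtain L1' where L1': "\<And>u. dapply D L1' u = dapply d L1 (f * u)"
    using to_new[OF range_dapply_comp[OF rangeI range_dapply_mult]] by blast
  have e: "N' \<star>\<^bsub>D\<^esub> L' = L1' \<star>\<^bsub>D\<^esub> pd j"
  proof (rule new.op_eqI)
    fix u
    have "dapply d N (dapply d L (f * u)) = dapply d L1 (dapply d M (f * u))"
      using arg_cong[OF NL, of "\<lambda>P. dapply d P (f * u)"] by simp
    then show "dapply D (N' \<star>\<^bsub>D\<^esub> L') u = dapply D (L1' \<star>\<^bsub>D\<^esub> pd j) u"
      using f(1) by (simp add: N' L' L1' Mu' mult.assoc[symmetric])
  qed
  have N'': "dapply D N' u = c0 * D j (inverse c0 * u)" for u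
    by (simp add: N' Nu')
  obtain C' R where CR: "L' = C' \<star>\<^bsub>D\<^esub> pd j + fn_op c0 \<star>\<^bsub>D\<^esub> R" "pd j \<star>\<^bsub>D\<^esub> R = R \<star>\<^bsub>D\<^esub> pd j"
    by (rule new.commuting_remainder[OF c0(1) N'' e])
  have DR: "D j (dapply D R v) = dapply D R (D j v)" for v
    using arg_cong[OF CR(2), of "\<lambda>P. dapply D P v"] by simp
  obtain C where C: "\<And>u. dapply d C u = dapply D C' (inverse f * u)"
    using from_new[OF new.range_dapply_comp[OF rangeI new.range_dapply_mult]] by blast
  obtain B where B: "\<And>u. dapply d B u = f * dapply D R (inverse f * u)"
    using from_new[OF new.range_dapply_comp[OF new.range_dapply_mult new.range_dapply_comp[OF rangeI new.range_dapply_mult]]]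
    by blast
  have "L = C \<star>\<^bsub>d\<^esub> M + fn_op (c0 / f) \<star>\<^bsub>d\<^esub> B"
  proof (rule op_eqI)
    fix u
    have "dapply d L u = dapply D L' (inverse f * u)" using f(1) by (simp add: L' mult.assoc[symmetric])
    also have "\<dots> = dapply D C' (D j (inverse f * u)) + c0 * dapply D R (inverse f * u)"
      by (simp add: CR(1) new.dapply_add)
    also have "\<dots> = dapply d (C \<star>\<^bsub>d\<^esub> M + fn_op (c0 / f) \<star>\<^bsub>d\<^esub> B) u"
      using f(1) by (simp add: dapply_add C B Mu' mult.assoc[symmetric])
    finally show "dapply d L u = dapply d (C \<star>\<^bsub>d\<^esub> M + fn_op (c0 / f) \<star>\<^bsub>d\<^esub> B) u" .
  qed
  moreover have "M \<star>\<^bsub>d\<^esub> B = B \<star>\<^bsub>d\<^esub> M"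
  proof (rule op_eqI)
    fix u
    show "dapply d (M \<star>\<^bsub>d\<^esub> B) u = dapply d (B \<star>\<^bsub>d\<^esub> M) u"
      using f(1) by (simp add: Mu' B DR mult.assoc[symmetric])
  qed
  ultimately have "decomposition d L M C B (c0 / f)" by (simp add: decomposition_def)
  then show ?thesis by blast
qed

text \<open>A common solution of \<open>M\<close> and \<open>c B\<close> is also one of \<open>L = C M + c B\<close>. It exists unless \<open>1 = E\<^sub>1 M + E\<^sub>2 c B\<close>;
after conjugation by \<open>f\<close> such a relation becomes \<open>1 = P' \<partial>\<^sub>j + Q' B'\<close>, and then \<open>B'\<close> is a function
modulo left multiples of \<open>\<partial>\<^sub>j\<close>. Hence \<open>c B\<close> is a function modulo left multiples of \<open>M\<close>, which reducedness
excludes.\<close>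

lemma reduced_common_kernel:
  assumes M: "ord M = 1" and dec: "decomposition d L M C B c"
    and R: "\<not> is_fn (fn_op c \<star>\<^bsub>d\<^esub> B)" "reduced d M (fn_op c \<star>\<^bsub>d\<^esub> B)"
  obtains g where "g \<noteq> 0" "dapply d M g = 0" "dapply d L g = 0"
proof -
  let ?R = "fn_op c \<star>\<^bsub>d\<^esub> B"
  have L: "L = C \<star>\<^bsub>d\<^esub> M + ?R" and MB: "M \<star>\<^bsub>d\<^esub> B = B \<star>\<^bsub>d\<^esub> M"
    using dec by (auto simp: decomposition_def)
  have nm: "?R \<noteq> Q \<star>\<^bsub>d\<^esub> M + fn_op g" for Q g using R unfolding reduced_def by blast
  have "fn_op 1 \<star>\<^bsub>d\<^esub> M = M" by (rule op_eqI) simp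
  with nm[of "fn_op 1" 0] have ne: "M \<noteq> ?R" by auto
  obtain f where f: "f \<noteq> 0" "dapply d M f = 0" by (rule first_order_kernel[OF M])
  obtain y A j m where A: "change_of_variables d y A" and Mu: "\<And>u. dapply d M u = new_deriv d A j u + m * u"
    by (rule first_order_straightening[OF M]) blast
  interpret new_variables d y A by standard (rule A)
  note Mu' = gauge[of "dapply d M", OF Mu f]
  have Mf: "dapply d M (f * v) = f * D j v" for v using f(1) by (simp add: Mu' mult.assoc[symmetric])
  have MB': "dapply d M (dapply d B u) = dapply d B (dapply d M u)" for u
    using arg_cong[OF MB, of "\<lambda>P. dapply d P u"] by simp
  have "fn_op 1 \<noteq> (\<Sum>P\<in>{M, ?R}. E P \<star>\<^bsub>d\<^esub> P)" for E
  proof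
    assume "fn_op 1 = (\<Sum>P\<in>{M, ?R}. E P \<star>\<^bsub>d\<^esub> P)"
    then have eq: "fn_op 1 = E M \<star>\<^bsub>d\<^esub> M + E ?R \<star>\<^bsub>d\<^esub> ?R" using ne by simp
    obtain P' where P': "\<And>u. dapply D P' u = inverse f * dapply d (E M) (f * u)"
      using to_new[OF range_dapply_comp[OF range_dapply_mult range_dapply_comp[OF rangeI range_dapply_mult]]] by blast
    obtain Q' where Q': "\<And>u. dapply D Q' u = inverse f * dapply d (E ?R) ((c * f) * u)"
      using to_new[OF range_dapply_comp[OF range_dapply_mult range_dapply_comp[OF rangeI range_dapply_mult]]] by blast
    obtain B' where B': "\<And>u. dapply D B' u = inverse f * dapply d B (f * u)"
      using to_new[OF range_dapply_comp[OF range_dapply_mult range_dapply_comp[OF rangeI range_dapply_mult]]] by blast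
    have comm: "pd j \<star>\<^bsub>D\<^esub> B' = B' \<star>\<^bsub>D\<^esub> pd j"
    proof (rule new.op_eqI)
      fix u
      have "f * D j (dapply D B' u) = dapply d B (f * D j u)"
        using f(1) by (simp add: B' Mf[symmetric] MB'[symmetric] mult.assoc[symmetric])
      then show "dapply D (pd j \<star>\<^bsub>D\<^esub> B') u = dapply D (B' \<star>\<^bsub>D\<^esub> pd j) u"
        using f(1) by (simp add: B' field_simps pointwise)
    qed
    have "fn_op 1 = P' \<star>\<^bsub>D\<^esub> pd j + Q' \<star>\<^bsub>D\<^esub> B'"
    proof (rule new.op_eqI)
      fix u
      have "f * u = dapply d (E M) (f * D j u) + dapply d (E ?R) (c * dapply d B (f * u))"
        using arg_cong[OF eq, of "\<lambda>P. dapply d P (f * u)"] by (simp add: dapply_add Mf)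
      then have "inverse f * (f * u) = inverse f * (dapply d (E M) (f * D j u) + dapply d (E ?R) (c * dapply d B (f * u)))"
        by simp
      moreover have "inverse f * (f * u) = u" "c * f * (inverse f * w) = c * w" for w using f(1) by simp_all
      ultimately show "dapply D (fn_op 1) u = dapply D (P' \<star>\<^bsub>D\<^esub> pd j + Q' \<star>\<^bsub>D\<^esub> B') u"
        by (simp only: new.dapply_add new.dapply_dmult new.dapply_fn_op new.dapply_pd P' Q' B' distrib_left mult_1_left)
    qed
    then obtain C' g where B'': "B' = C' \<star>\<^bsub>D\<^esub> pd j + fn_op g"
      by (rule new.commuting_unit_remainder[OF comm])
    obtain Q where Q: "\<And>u. dapply d Q u = (c * f) * dapply D C' (inverse f * u)"
      using from_new[OF new.range_dapply_comp[OF new.range_dapply_mult new.range_dapply_comp[OF rangeI new.range_dapply_mult]]]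
      by blast
    have "?R = Q \<star>\<^bsub>d\<^esub> M + fn_op (c * g)"
    proof (rule op_eqI)
      fix u
      have "dapply d B u = f * dapply D B' (inverse f * u)"
        using f(1) by (simp add: B' mult.assoc[symmetric])
      also have "\<dots> = f * dapply D C' (D j (inverse f * u)) + g * u"
        using f(1) by (simp add: B'' new.dapply_add distrib_left)
      finally show "dapply d ?R u = dapply d (Q \<star>\<^bsub>d\<^esub> M + fn_op (c * g)) u"
        using f(1) by (simp add: dapply_add Q Mu' distrib_left mult.assoc[symmetric])
    qed
    with nm show False by blast
  qed
  then obtain g where g: "\<And>P. P \<in> {M, ?R} \<Longrightarrow> dapply d P g = 0" "dapply d (fn_op 1) g \<noteq> 0"
    by (rule solution[of "{M, ?R}" "fn_op 1", rotated]) auto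
  have "dapply d M g = 0" "dapply d ?R g = 0" by (rule g(1), simp)+
  then have "dapply d L g = 0" unfolding L dapply_add dapply_dmult[of C M] by simp
  with \<open>dapply d M g = 0\<close> g(2) show ?thesis by (intro that[of g]) auto
qed

text \<open>If \<open>c B = Q M + f\<close> is not reduced, the multiple \<open>Q M\<close> is absorbed into \<open>C M\<close>, and \<open>f = f \<cdot> 1\<close> is a reduced remainder.\<close>

lemma reduced_decomposition_exists:
  assumes dec: "decomposition d L M C B c"
  shows "\<exists>C' B' c'. decomposition d L M C' B' c' \<and> reduced d M (fn_op c' \<star>\<^bsub>d\<^esub> B')"
proof (cases "reduced d M (fn_op c \<star>\<^bsub>d\<^esub> B)")
  case False
  then obtain Q f where Q: "fn_op c \<star>\<^bsub>d\<^esub> B = Q \<star>\<^bsub>d\<^esub> M + fn_op f" by (auto simp: reduced_def)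
  have f1: "fn_op f \<star>\<^bsub>d\<^esub> fn_op 1 = fn_op f" by (rule op_eqI) simp
  have "M \<star>\<^bsub>d\<^esub> fn_op 1 = fn_op 1 \<star>\<^bsub>d\<^esub> M" by (rule op_eqI) simp
  moreover have "L = (C + Q) \<star>\<^bsub>d\<^esub> M + fn_op f"
    using dec by (simp add: decomposition_def Q dmult_add_left)
  ultimately have "decomposition d L M (C + Q) (fn_op 1) f" by (simp add: decomposition_def f1)
  moreover have "reduced d M (fn_op f \<star>\<^bsub>d\<^esub> fn_op 1)" unfolding reduced_def f1 is_fn_def by blast
  ultimately show ?thesis by blast
qed (use dec in blast)

lemma factorization_wronskian_type:
  assumes M: "ord M = 1" and L: "L = C \<star>\<^bsub>d\<^esub> M" and N: "psymbol N = psymbol M"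
  shows "wronskian_type d M N L (N \<star>\<^bsub>d\<^esub> C)"
proof -
  obtain f where f: "f \<noteq> 0" "dapply d M f = 0" by (rule first_order_kernel[OF M])
  have "darboux d M N L (N \<star>\<^bsub>d\<^esub> C)"
    using factorization_darboux[OF M L N] by (simp add: from_factorization_def)
  then show ?thesis
    by (rule wronskian_type_if_common_kernel[OF M _ f]) (simp add: L f)
qed

end

theorem theorem4p2:
  fixes d :: "'i::finite \<Rightarrow> 'k::field_char_0 \<Rightarrow> 'k"
    and L M :: "('i, 'k) dop"
  assumes "differential_field d"
    and "differentially_closed d \<or> contains_linear_solutions d"
  shows
    "((\<exists>N L1. ord M = 1 \<and> ord N = 1 \<and> darboux d M N L L1) \<longleftrightarrow>
        ord M = 1 \<and> (\<exists>C B c. decomposition d L M C B c))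
     \<and>
     (\<forall>C B c. ord M = 1 \<longrightarrow> decomposition d L M C B c \<longrightarrow>
        (let cB = fn_op c \<star>\<^bsub>d\<^esub> B; N\<^sub>c = fn_op c \<star>\<^bsub>d\<^esub> M \<star>\<^bsub>d\<^esub> fn_op (inverse c) in
          (cB = 0 \<longrightarrow>
             (\<forall>N. psymbol N = psymbol M \<longrightarrow>
                from_factorization d M N L (N \<star>\<^bsub>d\<^esub> C) \<and> wronskian_type d M N L (N \<star>\<^bsub>d\<^esub> C)))
        \<and> (cB \<noteq> 0 \<longrightarrow> ord N\<^sub>c = 1 \<and> darboux d M N\<^sub>c L (N\<^sub>c \<star>\<^bsub>d\<^esub> C + cB))
        \<and> (cB \<noteq> 0 \<longrightarrow> is_fn cB \<longrightarrow> type_I d M N\<^sub>c L (N\<^sub>c \<star>\<^bsub>d\<^esub> C + cB))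
        \<and> (\<not> is_fn cB \<longrightarrow> reduced d M cB \<longrightarrow> wronskian_type d M N\<^sub>c L (N\<^sub>c \<star>\<^bsub>d\<^esub> C + cB))
        \<and> (\<forall>N L1. darboux d M N L L1 \<longrightarrow>
             (cB = 0 \<longrightarrow> (L \<noteq> 0 \<longrightarrow> psymbol N = psymbol M) \<and> L1 = N \<star>\<^bsub>d\<^esub> C)
           \<and> (cB \<noteq> 0 \<longrightarrow> reduced d M cB \<longrightarrow> N = N\<^sub>c \<and> L1 = N \<star>\<^bsub>d\<^esub> C + cB))
        \<and> (\<exists>C' B' c'. decomposition d L M C' B' c' \<and> reduced d M (fn_op c' \<star>\<^bsub>d\<^esub> B'))))"
proof -
  interpret differential_field d by (rule assms(1))
  have cls: "contains_linear_solutions d"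
    using assms(2) contains_linear_solutions_if_differentially_closed by blast
  interpret faithful_field d by (rule faithful_if_linear_solutions[OF cls])
  interpret linear_solution_field d by standard (rule cls)
  have fact: "from_factorization d M N L (N \<star>\<^bsub>d\<^esub> C)" "wronskian_type d M N L (N \<star>\<^bsub>d\<^esub> C)"
    if "ord M = 1" "decomposition d L M C B c" "fn_op c \<star>\<^bsub>d\<^esub> B = 0" "psymbol N = psymbol M" for C B c N
  proof -
    have "L = C \<star>\<^bsub>d\<^esub> M" using that by (simp add: decomposition_def)
    with that show "from_factorization d M N L (N \<star>\<^bsub>d\<^esub> C)" "wronskian_type d M N L (N \<star>\<^bsub>d\<^esub> C)"
      by (auto intro: factorization_darboux factorization_wronskian_type)
  qed
  have ex: "\<exists>N L1. ord N = 1 \<and> darboux d M N L L1" if "ord M = 1" "decomposition d L M C B c" for C B c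
  proof (cases "fn_op c \<star>\<^bsub>d\<^esub> B = 0")
    case True
    then show ?thesis using fact(1)[OF that True refl] that(1) unfolding from_factorization_def by blast
  next
    case False
    then show ?thesis using conjugate_darboux[OF that False] by blast
  qed
  have wr: "wronskian_type d M (fn_op c \<star>\<^bsub>d\<^esub> M \<star>\<^bsub>d\<^esub> fn_op (inverse c)) L
      (fn_op c \<star>\<^bsub>d\<^esub> M \<star>\<^bsub>d\<^esub> fn_op (inverse c) \<star>\<^bsub>d\<^esub> C + fn_op c \<star>\<^bsub>d\<^esub> B)"
    if M: "ord M = 1" and dec: "decomposition d L M C B c"
      and R: "\<not> is_fn (fn_op c \<star>\<^bsub>d\<^esub> B)" "reduced d M (fn_op c \<star>\<^bsub>d\<^esub> B)" for C B c
  proof -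
    have "fn_op c \<star>\<^bsub>d\<^esub> B \<noteq> 0" using R(1) fn_op_zero unfolding is_fn_def by metis
    note dar = conjugate_darboux(2)[OF M dec this]
    obtain g where "g \<noteq> 0" "dapply d M g = 0" "dapply d L g = 0"
      by (rule reduced_common_kernel[OF M dec R])
    then show ?thesis by (rule wronskian_type_if_common_kernel[OF M dar])
  qed
  show ?thesis
  proof (rule conjI, goal_cases)
    case 1
    show ?case using darboux_decomposition ex by blast
  next
    case 2
    show ?case
      unfolding Let_def
    proof (intro allI impI, goal_cases)
      case (1 C B c)
      note cases = fact[OF 1] conjugate_darboux[OF 1] function_remainder_type_I[OF 1]
        wr[OF 1] reduced_decomposition_exists[OF 1(2)]
      note unique = darboux_unique[OF 1]
      show ?case
        by (intro conjI allI impI; (erule (1) cases | erule cases | rule cases | drule (2) unique(2) | drule (1) unique(1))?)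
          (simp_all add: cases)
    qed
  qed
qed

end
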